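(* Let $n=2k\ge 4$ be even and let $(W,S)$ be the Weyl group of type $D_n$, with $S=\{s_1,\dots,s_{2k}\}$, and let $I=S\setminus\{s_{2k}\}$, so that $W_I\cong S_{2k}$ (acting by permuting coordinates). Let $$U=\{\varepsilon_i+\varepsilon_j : 1\le i<j\le 2k\},$$ and write $u_{ij}=u_{ji}:=\varepsilon_i+\varepsilon_j$ for $1\le i<j\le 2k$. Let $\mathcal M$ be the set of perfect matchings of $[2k]$. Then: (i) $(W,I,U)$ is a QP-triple. (ii) $\Omega_U$ has $(2k-1)!!$ elements, each of the form $R(M)=\{u_{i_1j_1},u_{i_2j_2},\dots,u_{i_kj_k}\}$ for some $M=\{\{i_1,j_1\},\dots,\{i_k,j_k\}\}\in\mathcal M$. (iii) For each $M\in\mathcal M$, $\mathrm{Res}_U(R(M))=\{u_{ij}: 1\le i<j\le 2k,\ \tau_M(i)>j,\ \tau_M(j)>i\}$. (iv) For each $M\in\mathcal M$, the set $\{(i,j): j<i \text{ and } u_{ji}\in\mathrm{Res}_U(R(M))\}=\{(i,j):(j,i)\in D_M\}$ is the Rothe diagram $\hat D_{\mathtt{FPF}}(\tau_M)$ of the fixed point free involution $\tau_M$. (v) For each $M\in\mathcal M$, $\rho_U(R(M))=\ell(\sigma_M)=(\ell(\tau_M)-k)/2$, where $\ell$ is the length (number of inversions) of a permutation. (vi) $\mathrm{QHf}(U)=\sum_{M\in\mathcal M} q^{\ell(\sigma_M)}u_{i_1j_1}u_{i_2j_2}\cdots u_{i_kj_k}$, i.e. $\mathrm{QHf}(U)$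 is the $q$-Hafnian of Jing–Zhang, and $\mathrm{QPf}(U)=\sum_{M\in\mathcal M}(-q)^{\ell(\sigma_M)}u_{i_1j_1}\cdots u_{i_kj_k}$ is the $q$-Pfaffian of Strickland and Jing–Zhang (here $u_{ij}$ stands for the indeterminate $x_{u_{ij}}$). (vii) $\mathrm{Hf}(U)$ is the Hafnian of a $2k\times 2k$ symmetric matrix $(a_{ij})$ with $a_{ij}=u_{ij}$ for all $1\le i<j\le 2k$, and $\mathrm{Pf}(U)$ is the Pfaffian of a $2k\times 2k$ skew-symmetric matrix $(a_{ij})$ with $a_{ij}=u_{ij}$ for all $1\le i<j\le 2k$. (viii) The Poincaré polynomial of $U$ is $\prod_{i=2}^k[2i-1]_q$, and its degrees are $3,5,7,\dots,2k-1$.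
   Context: Root system of type $D_n$: the vectors $\{\pm\varepsilon_i\pm\varepsilon_j:1\le i<j\le n\}$ in $\mathbb R^n$ with the standard dot product $B$; simple roots $\alpha_i=\varepsilon_i-\varepsilon_{i+1}$ ($i<n$), $\alpha_n=\varepsilon_{n-1}+\varepsilon_n$; positive roots $\varepsilon_i\pm\varepsilon_j$ ($i<j$); for a root $\alpha$, $s_\alpha(\beta)=\beta-B(\alpha,\beta)\alpha$; $s_i=s_{\alpha_i}$; $W=\langle S\rangle$; for $J\subseteq S$, $W_J=\langle J\rangle$. A root $\gamma$ is written $\gamma>0$ if it is positive. For a root $\alpha$, $|\alpha|$ denotes the positive root among $\pm\alpha$. The standard action of $W$ on sets $R$ of pairwise orthogonal positive roots is $w\cdot R=\{|w(\alpha)|:\alpha\in R\}$. For $U\subseteq\Phi_+$: $\kappa$ is the maximal size of a pairwise orthogonal subset of $U$ and $\Omega_U$ is the set of pairwise orthogonal subsets of $U$ of size $\kappa$. For $R\in\Omega_U$, $\mathrm{Res}_U(R)=\{\gamma\in U: s_\beta(\gamma)>0\text{ for all }\beta\in R\}$ and $\rho_U(R)=|\mathrm{Res}_U(R)|$. With commuting indeterminates $x_\beta$ ($\beta\in U$), $\mathrm{QHf}(U)=\sum_{R\in\Omega_U}q^{\rho_U(R)}\prod_{\beta\in R}x_\beta$, $\mathrm{QPf}(U)=\mathrm{QHf}(U)|_{q\to -q}$, $\mathrm{Hf}(U)=\mathrm{QHf}(U)|_{q=1}$, $\mathrm{Pf}(U)=\mathrm{QHf}(U)|_{q=-1}$.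 The Poincaré polynomial is $PS_U(q)=\sum_{R\in\Omega_U}q^{\rho_U(R)}$; if $PS_U(q)=\prod_{d\in D}[d]_q$ with $[d]_q=1+q+\dots+q^{d-1}$ and $D$ a multiset of integers $\ge2$, the elements of $D$ are the degrees of $U$. Quasiparabolic sets: for a Coxeter system $(W',S')$ with reflections $T'=\{wsw^{-1}\}$, a scaled $W'$-set is a $W'$-set $X$ with $\lambda:X\to\mathbb Z$ such that $|\lambda(sx)-\lambda(x)|\le1$ for $s\in S'$; it is quasiparabolic if (QP1) $r\in T'$, $\lambda(rx)=\lambda(x)$ implies $rx=x$, and (QP2) $r\in T'$, $s\in S'$, $\lambda(rx)>\lambda(x)$ and $\lambda(srx)<\lambda(sx)$ imply $rx=sx$. $(W,I,U)$ is a QP-triple if $\Omega_U$ is a quasiparabolic $W_I$-set under the restricted standard action with level $\rho_U$. For a perfect matching $M=\{\{i_1,j_1\},\dots,\{i_k,j_k\}\}$ of $[2k]$ with $i_1<\dots<i_k$ and $i_t<j_t$: $\sigma_M\in S_{2k}$ is the permutation with $\sigma_M(2t-1)=i_t$, $\sigma_M(2t)=j_t$; $\tau_M=(i_1,j_1)\cdots(i_k,j_k)$; $D_M=\{(i,j):1\le i<j\le 2k,\ \tau_M(i)>j,\ \tau_M(j)>i\}$. The Rothe diagram of a fixed point free involution $\tau$ (Hamaker–Marberg–Pawlowski) is $\hat D_{\mathtt{FPF}}(\tau)=\{(i,j): j<i,\ \tau(i)>j,\ \tau(j)>i\}$. *)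

theory Defs
  imports
    "HOL-Algebra.Group_Action"
    "HOL-Algebra.Generated_Groups"
    "HOL-Algebra.Multiplicative_Group"
    "HOL-Algebra.Sym_Groups"
    "HOL-Combinatorics.Permutations"
    "HOL-Library.Disjoint_Sets"
    "HOL-Library.Multiset"
    "HOL-Library.Function_Algebras"
    "HOL-Library.Poly_Mapping"
    "HOL-Computational_Algebra.Polynomial"
begin

section \<open>Coxeter systems and quasiparabolic sets\<close>

text \<open>
  A Coxeter system is a group presented by generating involutions \<open>S\<close> subject to the relations
  \<open>(s t)\<^sup>m = 1\<close>, where \<open>m\<close> is the order of \<open>s t\<close> (\<^const>\<open>group.ord\<close> is 0 for infinite order, and the
  relation is then void).  The presentation is expressed by words: two words represent the same
  element of the presented group iff they are related by inserting and deleting relators.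
  The case \<open>s = t\<close> provides the relators \<open>s s\<close>, so that no formal inverses are needed.
\<close>

definition coxeter_step :: "('g, 'b) monoid_scheme \<Rightarrow> 'g set \<Rightarrow> 'g list \<Rightarrow> 'g list \<Rightarrow> bool" where
  "coxeter_step G S xs ys \<longleftrightarrow>
     (\<exists>us\<in>lists S. \<exists>vs\<in>lists S. \<exists>s\<in>S. \<exists>t\<in>S.
        xs = us @ concat (replicate (group.ord G (s \<otimes>\<^bsub>G\<^esub> t)) [s, t]) @ vs \<and> ys = us @ vs)"

definition coxeter_system :: "('g, 'b) monoid_scheme \<Rightarrow> 'g set \<Rightarrow> bool" where
  "coxeter_system G S \<longleftrightarrow>
     group G \<and> S \<subseteq> carrier G \<and> generate G S = carrier G \<and>
     (\<forall>s\<in>S. s \<noteq> \<one>\<^bsub>G\<^esub> \<and> s \<otimes>\<^bsub>G\<^esub> s = \<one>\<^bsub>G\<^esub>) \<and>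
     (\<forall>ws\<in>lists S. foldr (\<lambda>x y. x \<otimes>\<^bsub>G\<^esub> y) ws \<one>\<^bsub>G\<^esub> = \<one>\<^bsub>G\<^esub> \<longrightarrow> equivclp (coxeter_step G S) ws [])"

definition reflections :: "('g, 'b) monoid_scheme \<Rightarrow> 'g set \<Rightarrow> 'g set" where
  "reflections G S = {w \<otimes>\<^bsub>G\<^esub> s \<otimes>\<^bsub>G\<^esub> inv\<^bsub>G\<^esub> w | w s. w \<in> carrier G \<and> s \<in> S}"

definition scaled_set ::
  "('g, 'b) monoid_scheme \<Rightarrow> 'g set \<Rightarrow> 'x set \<Rightarrow> ('g \<Rightarrow> 'x \<Rightarrow> 'x) \<Rightarrow> ('x \<Rightarrow> int) \<Rightarrow> bool" where
  "scaled_set G S X \<phi> lev \<longleftrightarrow>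
     coxeter_system G S \<and> group_action G X \<phi> \<and>
     (\<forall>s\<in>S. \<forall>x\<in>X. \<bar>lev (\<phi> s x) - lev x\<bar> \<le> 1)"

definition quasiparabolic ::
  "('g, 'b) monoid_scheme \<Rightarrow> 'g set \<Rightarrow> 'x set \<Rightarrow> ('g \<Rightarrow> 'x \<Rightarrow> 'x) \<Rightarrow> ('x \<Rightarrow> int) \<Rightarrow> bool" where
  "quasiparabolic G S X \<phi> lev \<longleftrightarrow>
     scaled_set G S X \<phi> lev \<and>
     (\<forall>r\<in>reflections G S. \<forall>x\<in>X. lev (\<phi> r x) = lev x \<longrightarrow> \<phi> r x = x) \<and>
     (\<forall>r\<in>reflections G S. \<forall>s\<in>S. \<forall>x\<in>X.
        lev (\<phi> r x) > lev x \<and> lev (\<phi> s (\<phi> r x)) < lev (\<phi> s x) \<longrightarrow> \<phi> r x = \<phi> s x)"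


section \<open>The root system and Weyl group of type D\<close>

text \<open>
  The dimension varies with the statement, so a vector of \<open>\<real>\<^sup>n\<close> is a function \<open>nat \<Rightarrow> real\<close> that
  vanishes outside \<open>{1..n}\<close>.
\<close>

definition rvecs :: "nat \<Rightarrow> (nat \<Rightarrow> real) set" where
  "rvecs n = {v. \<forall>i. i \<notin> {1..n} \<longrightarrow> v i = 0}"

definition eps :: "nat \<Rightarrow> nat \<Rightarrow> real" where
  "eps i = (\<lambda>m. if m = i then 1 else 0)"

definition dotp :: "nat \<Rightarrow> (nat \<Rightarrow> real) \<Rightarrow> (nat \<Rightarrow> real) \<Rightarrow> real" where
  "dotp n v w = (\<Sum>m=1..n. v m * w m)"

definition pos_roots :: "nat \<Rightarrow> (nat \<Rightarrow> real) set" where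
  "pos_roots n =
     {v. \<exists>i j. 1 \<le> i \<and> i < j \<and> j \<le> n \<and> (v = eps i + eps j \<or> v = eps i - eps j)}"

definition simple_root :: "nat \<Rightarrow> nat \<Rightarrow> nat \<Rightarrow> real" where
  "simple_root n i = (if i < n then eps i - eps (i + 1) else eps (n - 1) + eps n)"

definition root_refl :: "nat \<Rightarrow> (nat \<Rightarrow> real) \<Rightarrow> (nat \<Rightarrow> real) \<Rightarrow> (nat \<Rightarrow> real)" where
  "root_refl n \<alpha> = (\<lambda>\<beta>\<in>rvecs n. \<beta> - (\<lambda>m. dotp n \<alpha> \<beta> * \<alpha> m))"

definition simple_refl :: "nat \<Rightarrow> nat \<Rightarrow> (nat \<Rightarrow> real) \<Rightarrow> (nat \<Rightarrow> real)" where
  "simple_refl n i = root_refl n (simple_root n i)"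

definition simple_refls :: "nat \<Rightarrow> ((nat \<Rightarrow> real) \<Rightarrow> (nat \<Rightarrow> real)) set" where
  "simple_refls n = simple_refl n ` {1..n}"

definition weyl :: "nat \<Rightarrow> ((nat \<Rightarrow> real) \<Rightarrow> (nat \<Rightarrow> real)) monoid" where
  "weyl n = subgroup_generated (BijGroup (rvecs n)) (simple_refls n)"

definition parabolic ::
  "nat \<Rightarrow> ((nat \<Rightarrow> real) \<Rightarrow> (nat \<Rightarrow> real)) set \<Rightarrow> ((nat \<Rightarrow> real) \<Rightarrow> (nat \<Rightarrow> real)) monoid" where
  "parabolic n J = subgroup_generated (weyl n) J"

definition abs_root :: "nat \<Rightarrow> (nat \<Rightarrow> real) \<Rightarrow> (nat \<Rightarrow> real)" where
  "abs_root n \<alpha> = (if \<alpha> \<in> pos_roots n then \<alpha> else - \<alpha>)"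

text \<open>
  The restriction to \<open>X\<close> only makes the action extensional, as \<^locale>\<open>group_action\<close> requires.
  That \<open>X\<close> is mapped to itself is not built in here.
\<close>

definition std_action ::
  "nat \<Rightarrow> (nat \<Rightarrow> real) set set \<Rightarrow> ((nat \<Rightarrow> real) \<Rightarrow> (nat \<Rightarrow> real))
     \<Rightarrow> (nat \<Rightarrow> real) set \<Rightarrow> (nat \<Rightarrow> real) set" where
  "std_action n X w = (\<lambda>R\<in>X. (\<lambda>\<alpha>. abs_root n (w \<alpha>)) ` R)"


section \<open>Maximal orthogonal subsets and QP-triples\<close>

definition orth_set :: "nat \<Rightarrow> (nat \<Rightarrow> real) set \<Rightarrow> bool" where
  "orth_set n R \<longleftrightarrow> pairwise (\<lambda>\<alpha> \<beta>. dotp n \<alpha> \<beta> = 0) R"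

definition kappa :: "nat \<Rightarrow> (nat \<Rightarrow> real) set \<Rightarrow> nat" where
  "kappa n U = Max (card ` {R. R \<subseteq> U \<and> orth_set n R})"

definition Omega :: "nat \<Rightarrow> (nat \<Rightarrow> real) set \<Rightarrow> (nat \<Rightarrow> real) set set" where
  "Omega n U = {R. R \<subseteq> U \<and> orth_set n R \<and> card R = kappa n U}"

definition Res :: "nat \<Rightarrow> (nat \<Rightarrow> real) set \<Rightarrow> (nat \<Rightarrow> real) set \<Rightarrow> (nat \<Rightarrow> real) set" where
  "Res n U R = {\<gamma>\<in>U. \<forall>\<beta>\<in>R. root_refl n \<beta> \<gamma> \<in> pos_roots n}"

definition rho :: "nat \<Rightarrow> (nat \<Rightarrow> real) set \<Rightarrow> (nat \<Rightarrow> real) set \<Rightarrow> nat" where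
  "rho n U R = card (Res n U R)"

definition qp_triple ::
  "nat \<Rightarrow> ((nat \<Rightarrow> real) \<Rightarrow> (nat \<Rightarrow> real)) set \<Rightarrow> (nat \<Rightarrow> real) set \<Rightarrow> bool" where
  "qp_triple n J U \<longleftrightarrow>
     J \<subseteq> simple_refls n \<and> U \<subseteq> pos_roots n \<and>
     quasiparabolic (parabolic n J) J (Omega n U) (std_action n (Omega n U))
       (\<lambda>R. int (rho n U R))"


section \<open>The polynomials QHf and QPf, Poincare polynomials and degrees\<close>

text \<open>
  \<open>('x \<Rightarrow>\<^sub>0 nat) \<Rightarrow>\<^sub>0 'c\<close> is the polynomial ring over \<open>'c\<close> in commuting indeterminates indexed by
  \<open>'x\<close>.  For \<open>'c = int poly\<close> the variable of the coefficient ring is \<open>q\<close>, so that substitutions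
  for \<open>q\<close> act coefficientwise.
\<close>

definition xvar :: "'x \<Rightarrow> ('x \<Rightarrow>\<^sub>0 nat) \<Rightarrow>\<^sub>0 'c::comm_semiring_1" where
  "xvar \<beta> = Poly_Mapping.single (Poly_Mapping.single \<beta> 1) 1"

definition qvar :: "('x \<Rightarrow>\<^sub>0 nat) \<Rightarrow>\<^sub>0 int poly" where
  "qvar = Poly_Mapping.single 0 [:0, 1:]"

definition QHf :: "nat \<Rightarrow> (nat \<Rightarrow> real) set \<Rightarrow> ((nat \<Rightarrow> real) \<Rightarrow>\<^sub>0 nat) \<Rightarrow>\<^sub>0 int poly" where
  "QHf n U = (\<Sum>R\<in>Omega n U. qvar ^ rho n U R * (\<Prod>\<beta>\<in>R. xvar \<beta>))"

definition QPf :: "nat \<Rightarrow> (nat \<Rightarrow> real) set \<Rightarrow> ((nat \<Rightarrow> real) \<Rightarrow>\<^sub>0 nat) \<Rightarrow>\<^sub>0 int poly" where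
  "QPf n U = Poly_Mapping.map (\<lambda>c. pcompose c [:0, -1:]) (QHf n U)"

definition Hf :: "nat \<Rightarrow> (nat \<Rightarrow> real) set \<Rightarrow> ((nat \<Rightarrow> real) \<Rightarrow>\<^sub>0 nat) \<Rightarrow>\<^sub>0 int" where
  "Hf n U = Poly_Mapping.map (\<lambda>c. poly c 1) (QHf n U)"

definition Pf :: "nat \<Rightarrow> (nat \<Rightarrow> real) set \<Rightarrow> ((nat \<Rightarrow> real) \<Rightarrow>\<^sub>0 nat) \<Rightarrow>\<^sub>0 int" where
  "Pf n U = Poly_Mapping.map (\<lambda>c. poly c (-1)) (QHf n U)"

definition PS :: "nat \<Rightarrow> (nat \<Rightarrow> real) set \<Rightarrow> int poly" where
  "PS n U = (\<Sum>R\<in>Omega n U. [:0, 1:] ^ rho n U R)"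

definition qint :: "nat \<Rightarrow> int poly" where
  "qint d = (\<Sum>i<d. [:0, 1:] ^ i)"

definition has_degrees :: "nat \<Rightarrow> (nat \<Rightarrow> real) set \<Rightarrow> nat multiset \<Rightarrow> bool" where
  "has_degrees n U D \<longleftrightarrow> (\<forall>d\<in>#D. d \<ge> 2) \<and> PS n U = (\<Prod>d\<in>#D. qint d)"


section \<open>Perfect matchings\<close>

definition perfect_matchings :: "nat \<Rightarrow> nat set set set" where
  "perfect_matchings n = {M. partition_on {1..n} M \<and> (\<forall>e\<in>M. card e = 2)}"

text \<open>
  \<open>fst_pt M t\<close> and \<open>snd_pt M t\<close> are \<open>i\<^sub>t\<close> and \<open>j\<^sub>t\<close>, with 1-based \<open>t\<close>.
\<close>

definition fst_pt :: "nat set set \<Rightarrow> nat \<Rightarrow> nat" where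
  "fst_pt M t = sorted_list_of_set (Min ` M) ! (t - 1)"

definition snd_pt :: "nat set set \<Rightarrow> nat \<Rightarrow> nat" where
  "snd_pt M t = (THE j. {fst_pt M t, j} \<in> M)"

definition sigma :: "nat \<Rightarrow> nat set set \<Rightarrow> nat \<Rightarrow> nat" where
  "sigma k M m =
     (if m \<in> {1..2*k} then if odd m then fst_pt M ((m + 1) div 2) else snd_pt M (m div 2) else m)"

definition tau :: "nat \<Rightarrow> nat set set \<Rightarrow> nat \<Rightarrow> nat" where
  "tau k M = foldr (\<lambda>t p. transpose (fst_pt M t) (snd_pt M t) \<circ> p) [1..<k + 1] id"

definition matching_diagram :: "nat \<Rightarrow> nat set set \<Rightarrow> (nat \<times> nat) set" where
  "matching_diagram k M =
     {(i, j). 1 \<le> i \<and> i < j \<and> j \<le> 2*k \<and> tau k M i > j \<and> tau k M j > i}"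

definition rothe_FPF :: "nat \<Rightarrow> (nat \<Rightarrow> nat) \<Rightarrow> (nat \<times> nat) set" where
  "rothe_FPF n \<tau> = {(i, j). i \<in> {1..n} \<and> j \<in> {1..n} \<and> j < i \<and> \<tau> i > j \<and> \<tau> j > i}"

definition perm_length :: "nat \<Rightarrow> (nat \<Rightarrow> nat) \<Rightarrow> nat" where
  "perm_length n p = card {(i, j). 1 \<le> i \<and> i < j \<and> j \<le> n \<and> p i > p j}"

definition sum_root :: "nat \<Rightarrow> nat \<Rightarrow> nat \<Rightarrow> real" where
  "sum_root i j = eps i + eps j"

definition matching_roots :: "nat \<Rightarrow> nat set set \<Rightarrow> (nat \<Rightarrow> real) set" where
  "matching_roots k M = (\<lambda>t. sum_root (fst_pt M t) (snd_pt M t)) ` {1..k}"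


section \<open>Hafnians and Pfaffians of matrices\<close>

text \<open>
  A matrix of size \<open>2k\<close> is given by its entries \<open>a i j\<close> with \<open>i, j \<in> {1..2k}\<close>.
\<close>

definition symmetric_mat :: "nat \<Rightarrow> (nat \<Rightarrow> nat \<Rightarrow> 'a) \<Rightarrow> bool" where
  "symmetric_mat n a \<longleftrightarrow> (\<forall>i\<in>{1..n}. \<forall>j\<in>{1..n}. a j i = a i j)"

definition skew_symmetric_mat :: "nat \<Rightarrow> (nat \<Rightarrow> nat \<Rightarrow> 'a::uminus) \<Rightarrow> bool" where
  "skew_symmetric_mat n a \<longleftrightarrow> (\<forall>i\<in>{1..n}. \<forall>j\<in>{1..n}. a j i = - a i j)"

definition hafnian :: "nat \<Rightarrow> (nat \<Rightarrow> nat \<Rightarrow> 'a::comm_ring_1) \<Rightarrow> 'a" where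
  "hafnian k a = (\<Sum>M\<in>perfect_matchings (2*k). \<Prod>t=1..k. a (fst_pt M t) (snd_pt M t))"

definition pfaffian :: "nat \<Rightarrow> (nat \<Rightarrow> nat \<Rightarrow> 'a::comm_ring_1) \<Rightarrow> 'a" where
  "pfaffian k a =
     (\<Sum>M\<in>perfect_matchings (2*k).
        of_int (sign (sigma k M)) * (\<Prod>t=1..k. a (fst_pt M t) (snd_pt M t)))"

text \<open>
  The q-analogues are sums over the permutations \<open>\<pi>\<close> of \<open>[2k]\<close> with \<open>\<pi>(2t-1) < \<pi>(2t)\<close> and
  \<open>\<pi>(1) < \<pi>(3) < \<dots> < \<pi>(2k-1)\<close>.
\<close>

definition pf_perms :: "nat \<Rightarrow> (nat \<Rightarrow> nat) set" where
  "pf_perms k =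
     {\<pi>. \<pi> permutes {1..2*k} \<and> (\<forall>t\<in>{1..k}. \<pi> (2*t - 1) < \<pi> (2*t)) \<and>
         (\<forall>t\<in>{1..<k}. \<pi> (2*t - 1) < \<pi> (2*t + 1))}"

definition q_hafnian :: "nat \<Rightarrow> 'a::comm_ring_1 \<Rightarrow> (nat \<Rightarrow> nat \<Rightarrow> 'a) \<Rightarrow> 'a" where
  "q_hafnian k q a =
     (\<Sum>\<pi>\<in>pf_perms k. q ^ perm_length (2*k) \<pi> * (\<Prod>t=1..k. a (\<pi> (2*t - 1)) (\<pi> (2*t))))"

definition q_pfaffian :: "nat \<Rightarrow> 'a::comm_ring_1 \<Rightarrow> (nat \<Rightarrow> nat \<Rightarrow> 'a) \<Rightarrow> 'a" where
  "q_pfaffian k q a =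
     (\<Sum>\<pi>\<in>pf_perms k. (- q) ^ perm_length (2*k) \<pi> * (\<Prod>t=1..k. a (\<pi> (2*t - 1)) (\<pi> (2*t))))"

end

(*
  A perfect matching M is the same as a fixed point free involution tau on [2k], and the level of the
  corresponding set of roots is the size of the diagram D(tau) = {i < j : j < tau i, i < tau j}.  Every
  element of D(tau) accounts for two inversions of tau, and only the k transposed pairs remain, so
  l(tau) = k + 2 |D(tau)|.  Since the reflection r = (a b) acts by conjugation and
  l(p r) > l(p) iff p a < p b, conjugation by r raises the level, lowers it, or fixes tau according to
  whether tau a < tau b, tau b < tau a with tau a /= b, or tau a = b; both quasiparabolic axioms follow.
  Removing the pair {c, max} from a matching lowers the level by the number of points strictly between
  c and the maximum, whatever the rest of the matching, which gives the Poincare polynomial as a product.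
  The degrees are unique because the largest one is detected by a primitive root of unity.  W_I is a
  Coxeter group by the normal form u (m, m-1, ..., j) for words in adjacent transpositions.
*)
theory Submission
  imports Defs
begin

section \<open>Inversions of permutations\<close>

text \<open>Levels are compared through lengths because multiplication by \<open>r\<close> on one
  side has a clean length criterion, whereas conjugation multiplies on both sides. As \<tau> and
  \<open>r\<close> are involutions, \<open>\<tau> r\<close> and \<open>r \<tau>\<close> are inverse
  to each other and equally long, so a conjugation becomes two one-sided comparisons. When \<tau>
  does not exchange \<open>a\<close> and \<open>b\<close>, \<open>r\<close> fixes their images, so
  both comparisons point the same way. The second axiom rests on the fact that an adjacent
  transposition reverses the order of just one pair. The recursion over matchings leaves point sets
  that are no longer intervals, hence involutions and diagrams are relative to a finite set
  \<open>A\<close>. The length of \<sigma> is matched with the diagram directly: the first point of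
  a block is smaller than everything listed after it, so every inversion of \<sigma> starts at the
  second point of a block. \<open>coxeter_system\<close> asks for a presentation by insertion and
  deletion of relators. Words are therefore reduced by braid moves on indices, and each move is then
  derived from relators; a normal form is tested by asking which point it sends to
  \<open>m + 1\<close>.\<close>

definition inversions :: "nat \<Rightarrow> (nat \<Rightarrow> nat) \<Rightarrow> (nat \<times> nat) set" where
  "inversions n p = {(i, j). 1 \<le> i \<and> i < j \<and> j \<le> n \<and> p i > p j}"

lemma perm_length_eq_card_inversions: "perm_length n p = card (inversions n p)"
  by (simp add: perm_length_def inversions_def)

lemma finite_inversions [simp]: "finite (inversions n p)"
  by (rule finite_subset[of _ "{1..n} \<times> {1..n}"]) (auto simp: inversions_def)

text \<open>An inversion at the positions \<open>i < j\<close> reappears in the inverse permutation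
  at the positions \<open>p j < p i\<close>, so the two inversion sets are in bijection.\<close>

lemma perm_length_inv:
  assumes p: "p permutes {1..n}"
  shows "perm_length n (inv' p) = perm_length n p"
proof -
  have "bij_betw (\<lambda>(i, j). (p j, p i)) (inversions n p) (inversions n (inv' p))"
  proof (rule bij_betw_byWitness[where f' = "\<lambda>(i, j). (inv' p j, inv' p i)"])
    show "(\<lambda>(i, j). (p j, p i)) ` inversions n p \<subseteq> inversions n (inv' p)"
    proof clarify
      fix i j assume "(i, j) \<in> inversions n p"
      then have ij: "1 \<le> i" "i < j" "j \<le> n" "p j < p i" by (auto simp: inversions_def)
      then have "p i \<in> {1..n}" "p j \<in> {1..n}"
        using permutes_in_image[OF p, of i] permutes_in_image[OF p, of j] by simp_all
      with ij show "(p j, p i) \<in> inversions n (inv' p)"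
        by (simp add: inversions_def permutes_inverses[OF p])
    qed
    show "(\<lambda>(i, j). (inv' p j, inv' p i)) ` inversions n (inv' p) \<subseteq> inversions n p"
    proof clarify
      fix i j assume "(i, j) \<in> inversions n (inv' p)"
      then have ij: "1 \<le> i" "i < j" "j \<le> n" "inv' p j < inv' p i" by (auto simp: inversions_def)
      then have "inv' p i \<in> {1..n}" "inv' p j \<in> {1..n}"
        using permutes_in_image[OF permutes_inv[OF p], of i] permutes_in_image[OF permutes_inv[OF p], of j]
          by simp_all
      with ij show "(inv' p j, inv' p i) \<in> inversions n p"
        by (simp add: inversions_def permutes_inverses[OF p])
    qed
  qed (use permutes_inverses[OF p] in auto)
  from bij_betw_same_card[OF this] show ?thesis
    by (simp add: perm_length_eq_card_inversions)
qed

text \<open>For strict growth an injection that misses one pair is enough: a pair is moved by the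
  transposition when this keeps its order and stays put otherwise, and \<open>(a, b)\<close> is
  never hit.\<close>

lemma perm_length_transpose_less:
  assumes p: "p permutes {1..n}" and ab: "1 \<le> a" "a < b" "b \<le> n" and less: "p a < p b"
  shows "perm_length n p < perm_length n (p \<circ> transpose a b)"
proof -
  let ?r = "transpose a b"
  define f where "f = (\<lambda>(i, j). if ?r i < ?r j then (?r i, ?r j) else (i, j))"
  have f_in: "f x \<in> inversions n (p \<circ> ?r)" if x: "x \<in> inversions n p" for x
  proof -
    obtain i j where ij: "x = (i, j)" "1 \<le> i" "i < j" "j \<le> n" "p i > p j"
      using x by (auto simp: inversions_def)
    have r_in: "?r i \<in> {1..n}" "?r j \<in> {1..n}"
      using ab ij by (auto simp: transpose_def)
    show ?thesis
    proof (cases "?r i < ?r j")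
      case True
      then show ?thesis using ij r_in by (simp add: f_def inversions_def)
    next
      case False
      \<comment> \<open>The transposition reverses a pair \<open>i < j\<close> only if the pair
        starts at \<open>a\<close> and ends no later than \<open>b\<close>, or ends at
        \<open>b\<close> and starts after \<open>a\<close>. Replacing the value \<open>p a\<close>
        by the larger \<open>p b\<close>, or \<open>p b\<close> by the smaller \<open>p a\<close>,
        preserves such an inversion.\<close>
      have "i = a \<and> j < b \<and> j \<noteq> a \<or> j = b \<and> a < i \<or> i = a \<and> j = b"
        using False ij ab by (auto simp: transpose_def split: if_splits)
      then have "p (?r j) < p (?r i)"
      proof (elim disjE conjE)
        assume "i = a" "j < b" "j \<noteq> a"
        then show ?thesis using ij less by simp
      next
        assume "j = b" "a < i"
        then show ?thesis using ij less by simp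
      next
        assume "i = a" "j = b"
        then show ?thesis using less by simp
      qed
      then show ?thesis using False ij by (simp add: f_def inversions_def)
    qed
  qed
  have r_eq: "?r x = ?r y \<longleftrightarrow> x = y" for x y
    by (metis transpose_involutory)
  have inj: "inj_on f (inversions n p)"
  proof (rule inj_onI)
    fix x y assume "x \<in> inversions n p" "y \<in> inversions n p" "f x = f y"
    then show "x = y"
      by (cases x; cases y) (auto simp: f_def inversions_def r_eq split: if_splits)
  qed
  have notin: "(a, b) \<notin> f ` inversions n p"
    using less ab by (auto simp: f_def inversions_def transpose_def split: if_splits)
  have ab_in: "(a, b) \<in> inversions n (p \<circ> ?r)"
    using less ab by (auto simp: inversions_def)
  have "f ` inversions n p \<subset> inversions n (p \<circ> ?r)"
    using f_in notin ab_in by blast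
  then have "card (f ` inversions n p) < card (inversions n (p \<circ> ?r))"
    by (intro psubset_card_mono) auto
  then show ?thesis
    by (simp add: perm_length_eq_card_inversions card_image[OF inj])
qed

section \<open>Adjacent transpositions: exact change of length and induction on length\<close>

abbreviation adj :: "nat \<Rightarrow> nat \<Rightarrow> nat" where
  "adj i \<equiv> transpose i (Suc i)"

lemma adj_less: "x < y \<Longrightarrow> (x, y) \<noteq> (i, Suc i) \<Longrightarrow> adj i x < adj i y"
  unfolding transpose_def by (cases "x = i"; cases "x = Suc i"; cases "y = i"; cases "y = Suc i") auto

lemma adj_in_iff: "1 \<le> i \<Longrightarrow> i < n \<Longrightarrow> adj i x \<in> {1..n} \<longleftrightarrow> x \<in> {1..n}"
  unfolding transpose_def by auto

text \<open>Unlike a general transposition, \<open>adj i\<close> reverses the order of no pair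
  except \<open>(i, Suc i)\<close>. It therefore maps the old inversions bijectively to the new ones
  other than \<open>(i, Suc i)\<close> itself.\<close>

lemma perm_length_adj:
  assumes p: "p permutes {1..n}" and i: "1 \<le> i" "i < n" and less: "p i < p (Suc i)"
  shows "perm_length n (p \<circ> adj i) = Suc (perm_length n p)"
proof -
  have "bij_betw (\<lambda>(x, y). (adj i x, adj i y)) (inversions n p) (inversions n (p \<circ> adj i) - {(i, Suc i)})"
  proof (rule bij_betw_byWitness[where f' = "\<lambda>(x, y). (adj i x, adj i y)"])
    show "(\<lambda>(x, y). (adj i x, adj i y)) ` inversions n p \<subseteq> inversions n (p \<circ> adj i) - {(i, Suc i)}"
    proof (rule image_subsetI, unfold split_paired_all case_prod_conv)
      fix x y assume "(x, y) \<in> inversions n p"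
      then have xy: "x \<in> {1..n}" "y \<in> {1..n}" "x < y" "p y < p x" by (auto simp: inversions_def)
      then have "(x, y) \<noteq> (i, Suc i)" using less by auto
      moreover from this have "(adj i x, adj i y) \<noteq> (i, Suc i)"
        using xy(3) by (metis Suc_n_not_le_n less_imp_le prod.inject transpose_apply_first
            transpose_apply_second transpose_involutory)
      ultimately show "(adj i x, adj i y) \<in> inversions n (p \<circ> adj i) - {(i, Suc i)}"
        using xy adj_less[of x y i] adj_in_iff[OF i, of x] adj_in_iff[OF i, of y]
        by (simp add: inversions_def)
    qed
    show "(\<lambda>(x, y). (adj i x, adj i y)) ` (inversions n (p \<circ> adj i) - {(i, Suc i)}) \<subseteq> inversions n p"
    proof (rule image_subsetI, unfold split_paired_all case_prod_conv)
      fix x y assume "(x, y) \<in> inversions n (p \<circ> adj i) - {(i, Suc i)}"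
      then show "(adj i x, adj i y) \<in> inversions n p"
        using adj_less[of x y i] adj_in_iff[OF i, of x] adj_in_iff[OF i, of y]
        by (auto simp: inversions_def)
    qed
  qed auto
  from bij_betw_same_card[OF this]
  have "card (inversions n p) = card (inversions n (p \<circ> adj i) - {(i, Suc i)})" .
  moreover have "(i, Suc i) \<in> inversions n (p \<circ> adj i)"
    using i less by (auto simp: inversions_def)
  ultimately show ?thesis
    by (metis card.remove finite_inversions perm_length_eq_card_inversions)
qed

lemma permutes_adj: "1 \<le> i \<Longrightarrow> i < n \<Longrightarrow> adj i permutes {1..n}"
  by (intro permutes_swap_id) auto

text \<open>Without a descent the list of values is a sorted list with the distinct entries
  \<open>1..n\<close>, and there is only one such list.\<close>

lemma permutes_no_descent_imp_id:
  assumes p: "p permutes {1..n}" and nd: "\<And>i. 1 \<le> i \<Longrightarrow> i < n \<Longrightarrow> p i \<le> p (Suc i)"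
  shows "p = id"
proof -
  have "sorted (map p [1..<Suc n])"
    unfolding sorted_iff_nth_Suc using nd by (auto simp del: upt_Suc)
  moreover have "distinct (map p [1..<Suc n])"
    using permutes_inj_on[OF p] by (simp add: distinct_map del: upt_Suc)
  moreover have "set (map p [1..<Suc n]) = set [1..<Suc n]"
    using permutes_image[OF p] by (simp add: atLeastLessThanSuc_atLeastAtMost del: upt_Suc)
  ultimately have eq: "map p [1..<Suc n] = [1..<Suc n]"
    by (intro sorted_distinct_set_unique) (auto simp del: upt_Suc)
  have "p x = x" for x
  proof (cases "x \<in> {1..n}")
    case True
    then have "x \<in> set [1..<Suc n]" by auto
    moreover have "map p [1..<Suc n] = map id [1..<Suc n]"
      unfolding eq list.map_id ..
    ultimately show ?thesis unfolding map_eq_conv by auto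
  qed (rule permutes_not_in[OF p])
  then show ?thesis by (simp add: fun_eq_iff)
qed

text \<open>Induction on the length: a permutation other than the identity has a descent, and
  undoing it by \<open>adj i\<close> shortens the permutation. The step may assume
  \<open>p i < p (Suc i)\<close>, so each application of it lengthens by exactly one.\<close>

lemma perm_adj_induct [consumes 1, case_names id adj]:
  assumes p: "p permutes {1..n}"
    and base: "P id"
    and step: "\<And>p i. p permutes {1..n} \<Longrightarrow> 1 \<le> i \<Longrightarrow> i < n \<Longrightarrow> p i < p (Suc i) \<Longrightarrow> P p
                 \<Longrightarrow> P (p \<circ> adj i)"
  shows "P p"
  using p
proof (induction "perm_length n p" arbitrary: p rule: less_induct)
  case less
  show ?case
  proof (cases "\<exists>i. 1 \<le> i \<and> i < n \<and> p i > p (Suc i)")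
    case False
    then have "p = id"
      using less.prems by (intro permutes_no_descent_imp_id) (auto simp: not_less)
    then show ?thesis using base by simp
  next
    case True
    then obtain i where i: "1 \<le> i" "i < n" "p i > p (Suc i)" by blast
    let ?p = "p \<circ> adj i"
    have perm: "?p permutes {1..n}"
      by (rule permutes_compose[OF permutes_adj[OF i(1,2)] less.prems])
    have undo: "?p \<circ> adj i = p" by (auto simp: fun_eq_iff)
    have "perm_length n p = Suc (perm_length n ?p)"
      using perm_length_adj[OF perm i(1,2)] i(3) undo by simp
    then have "P ?p" using less.hyps perm by simp
    from step[OF perm i(1,2) _ this] show ?thesis
      using i(3) undo by simp
  qed
qed

lemma perm_length_id [simp]: "perm_length n id = 0"
proof -
  have "inversions n id = {}" by (auto simp: inversions_def)
  then show ?thesis by (simp add: perm_length_eq_card_inversions)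
qed

lemma sign_eq_perm_length:
  assumes "p permutes {1..n}"
  shows "sign p = (- 1) ^ perm_length n p"
  using assms
proof (induction rule: perm_adj_induct)
  case id
  show ?case unfolding perm_length_id by simp
next
  case (adj p i)
  have "permutation p" using adj(1) permutation_permutes by blast
  then have "sign (p \<circ> adj i) = sign p * - 1"
    by (simp add: sign_compose permutation_swap_id sign_swap_id)
  then show ?case
    unfolding perm_length_adj[OF adj(1-4)] adj(5) power_Suc by (simp only: mult.commute)
qed

section \<open>Fixed point free involutions\<close>

text \<open>The point set \<open>A\<close> is arbitrary because deleting a pair from an involution
  on \<open>{1..2 * k}\<close> leaves a set with gaps, and the recursion for the generating function
  runs through such sets.\<close>

definition fpf :: "nat set \<Rightarrow> (nat \<Rightarrow> nat) set" where
  "fpf A = {\<tau>. \<tau> permutes A \<and> \<tau> \<circ> \<tau> = id \<and> (\<forall>x\<in>A. \<tau> x \<noteq> x)}"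

definition diagram :: "nat set \<Rightarrow> (nat \<Rightarrow> nat) \<Rightarrow> (nat \<times> nat) set" where
  "diagram A \<tau> = {(i, j). i \<in> A \<and> j \<in> A \<and> i < j \<and> j < \<tau> i \<and> i < \<tau> j}"

lemma finite_diagram [simp]: "finite A \<Longrightarrow> finite (diagram A \<tau>)"
  by (rule finite_subset[of _ "A \<times> A"]) (auto simp: diagram_def)

lemma fpf_permutes: "\<tau> \<in> fpf A \<Longrightarrow> \<tau> permutes A"
  and fpf_involution [simp]: "\<tau> \<in> fpf A \<Longrightarrow> \<tau> (\<tau> x) = x"
  and fpf_neq: "\<tau> \<in> fpf A \<Longrightarrow> x \<in> A \<Longrightarrow> \<tau> x \<noteq> x"
  by (auto simp: fpf_def fun_eq_iff)

lemma fpf_in_iff: "\<tau> \<in> fpf A \<Longrightarrow> \<tau> x \<in> A \<longleftrightarrow> x \<in> A"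
  by (rule permutes_in_image[OF fpf_permutes])

lemma fpf_eq_iff: "\<tau> \<in> fpf A \<Longrightarrow> \<tau> x = \<tau> y \<longleftrightarrow> x = y"
  by (metis fpf_involution)

lemma fpf_finite: "finite A \<Longrightarrow> finite (fpf A)"
  by (rule finite_subset[OF _ finite_permutations[of A]]) (auto simp: fpf_def)

lemma fpf_conj:
  assumes t: "\<tau> \<in> fpf A" and r: "r permutes A"
  shows "r \<circ> \<tau> \<circ> inv' r \<in> fpf A"
proof -
  have perm: "r \<circ> \<tau> \<circ> inv' r permutes A"
    by (intro permutes_compose permutes_inv r fpf_permutes[OF t])
  have neq: "r (\<tau> (inv' r x)) \<noteq> x" if "x \<in> A" for x
  proof
    assume "r (\<tau> (inv' r x)) = x"
    then have "\<tau> (inv' r x) = inv' r x" using permutes_inverses(2)[OF r] by metis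
    moreover have "inv' r x \<in> A" using that permutes_in_image[OF permutes_inv[OF r]] by metis
    ultimately show False using fpf_neq[OF t] by blast
  qed
  have "(r \<circ> \<tau> \<circ> inv' r) \<circ> (r \<circ> \<tau> \<circ> inv' r) = id"
    by (simp add: fun_eq_iff permutes_inverses[OF r] fpf_involution[OF t])
  then show ?thesis
    using perm neq unfolding fpf_def by auto
qed

lemma fpf_conj_transpose:
  assumes t: "\<tau> \<in> fpf A" and ab: "a \<in> A" "b \<in> A"
  shows "transpose a b \<circ> \<tau> \<circ> transpose a b \<in> fpf A"
  using fpf_conj[OF t permutes_swap_id[OF ab]] by simp

text \<open>Each element \<open>(i, j)\<close> of the diagram accounts for the two inversions \<open>(i, \<tau> j)\<close> and
  \<open>(j, \<tau> i)\<close>; the remaining inversions are the \<open>k\<close> pairs exchanged by \<open>\<tau>\<close>.\<close>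

lemma perm_length_fpf:
  assumes t: "\<tau> \<in> fpf {1..2 * k}"
  shows "perm_length (2 * k) \<tau> = k + 2 * card (diagram {1..2 * k} \<tau>)"
proof -
  let ?A = "{1..2 * k}" and ?I = "inversions (2 * k) \<tau>"
  have [simp]: "Suc 0 \<le> \<tau> x" "\<tau> x \<le> 2 * k" if "Suc 0 \<le> x" "x \<le> 2 * k" for x
    using fpf_in_iff[OF t, of x] that by simp_all
  note [simp] = fpf_involution[OF t]
  \<comment> \<open>Inversions are classified by how \<open>i\<close> compares with the partner of
    \<open>j\<close>; each of the first two classes is a copy of the diagram.\<close>
  define I1 where "I1 = {(i, j) \<in> ?I. i < \<tau> j}"
  define I2 where "I2 = {(i, j) \<in> ?I. \<tau> j < i}"
  define I3 where "I3 = {(i, j) \<in> ?I. \<tau> j = i}"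
  have fin: "finite I1" "finite I2" "finite I3"
    unfolding I1_def I2_def I3_def by (rule finite_subset[OF _ finite_inversions[of "2*k" \<tau>]]; auto)+
  have "?I = I1 \<union> (I2 \<union> I3)" by (auto simp: I1_def I2_def I3_def)
  moreover have "I1 \<inter> (I2 \<union> I3) = {}" "I2 \<inter> I3 = {}" by (auto simp: I1_def I2_def I3_def)
  ultimately have "card ?I = card I1 + (card I2 + card I3)"
    using fin by (simp add: card_Un_disjoint)
  moreover have "card (diagram ?A \<tau>) = card I1"
  proof (rule bij_betw_same_card[of "\<lambda>(i, j). (i, \<tau> j)"],
      rule bij_betw_byWitness[where f' = "\<lambda>(i, j). (i, \<tau> j)"])
    show "(\<lambda>(i, j). (i, \<tau> j)) ` diagram ?A \<tau> \<subseteq> I1"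
      by (auto simp: diagram_def I1_def inversions_def)
    show "(\<lambda>(i, j). (i, \<tau> j)) ` I1 \<subseteq> diagram ?A \<tau>"
      by (auto simp: diagram_def I1_def inversions_def)
  qed auto
  moreover have "card (diagram ?A \<tau>) = card I2"
  proof (rule bij_betw_same_card[of "\<lambda>(i, j). (j, \<tau> i)"],
      rule bij_betw_byWitness[where f' = "\<lambda>(i, j). (\<tau> j, i)"])
    show "(\<lambda>(i, j). (j, \<tau> i)) ` diagram ?A \<tau> \<subseteq> I2"
      by (auto simp: diagram_def I2_def inversions_def)
    show "(\<lambda>(i, j). (\<tau> j, i)) ` I2 \<subseteq> diagram ?A \<tau>"
      by (auto simp: diagram_def I2_def inversions_def)
  qed auto
  moreover have "card I3 = k"
  proof -
    \<comment> \<open>\<tau> exchanges the points below their partner with those above it, so each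
      kind makes up half of the \<open>2 * k\<close> points; the former kind indexes
      \<open>I3\<close>.\<close>
    define L where "L = {x \<in> ?A. x < \<tau> x}"
    define R where "R = {x \<in> ?A. \<tau> x < x}"
    have "x \<in> L \<union> R" if "x \<in> ?A" for x
      using fpf_neq[OF t that] that by (auto simp: L_def R_def)
    then have "?A \<subseteq> L \<union> R" by blast
    then have "L \<union> R = ?A" by (auto simp: L_def R_def)
    moreover have "L \<inter> R = {}" by (auto simp: L_def R_def)
    moreover have "finite L" "finite R" by (simp_all add: L_def R_def)
    ultimately have "card L + card R = 2 * k"
      using card_Un_disjoint[of L R] by simp
    moreover have "card L = card R"
    proof (rule bij_betw_same_card[of \<tau>], rule bij_betw_byWitness[where f' = \<tau>])
      show "\<tau> ` L \<subseteq> R" "\<tau> ` R \<subseteq> L" by (auto simp: L_def R_def)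
    qed auto
    moreover have "card L = card I3"
    proof (rule bij_betw_same_card[of "\<lambda>x. (x, \<tau> x)"], rule bij_betw_byWitness[where f' = fst])
      show "(\<lambda>x. (x, \<tau> x)) ` L \<subseteq> I3" "fst ` I3 \<subseteq> L"
        by (auto simp: L_def I3_def inversions_def)
    qed (auto simp: I3_def)
    ultimately show ?thesis by simp
  qed
  ultimately show ?thesis by (simp add: perm_length_eq_card_inversions)
qed

section \<open>Conjugation by a transposition and the size of the diagram\<close>

abbreviation conj_transpose :: "nat \<Rightarrow> nat \<Rightarrow> (nat \<Rightarrow> nat) \<Rightarrow> nat \<Rightarrow> nat" where
  "conj_transpose a b \<tau> \<equiv> transpose a b \<circ> \<tau> \<circ> transpose a b"

lemma conj_transpose_twice [simp]: "conj_transpose a b (conj_transpose a b \<tau>) = \<tau>"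
  by (simp add: fun_eq_iff)

lemma fpf_conj_transpose_eq:
  assumes t: "\<tau> \<in> fpf A" and "\<tau> a = b"
  shows "conj_transpose a b \<tau> = \<tau>"
proof
  fix x
  have "\<tau> b = a" using assms fpf_involution by metis
  moreover have "\<tau> x \<noteq> a \<and> \<tau> x \<noteq> b" if "x \<noteq> a" "x \<noteq> b"
    using that assms(2) \<open>\<tau> b = a\<close> fpf_eq_iff[OF t] by metis
  ultimately show "conj_transpose a b \<tau> x = \<tau> x"
    using assms(2) by (cases "x = a"; cases "x = b") auto
qed

text \<open>Lets the comparison of \<tau> a with \<tau> b be reused after \<tau> has been multiplied
  by the transposition on the left.\<close>

lemma fpf_transpose_image:
  assumes t: "\<tau> \<in> fpf A" and ab: "a \<in> A" "b \<in> A" "\<tau> a \<noteq> b"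
  shows "transpose a b (\<tau> a) = \<tau> a" "transpose a b (\<tau> b) = \<tau> b"
proof -
  have "\<tau> b \<noteq> a" using assms fpf_involution by metis
  then show "transpose a b (\<tau> a) = \<tau> a" "transpose a b (\<tau> b) = \<tau> b"
    using fpf_neq[OF t ab(1)] fpf_neq[OF t ab(2)] ab(3) by auto
qed

lemma transpose_comp_fpf_permutes_inv:
  assumes t: "\<tau> \<in> fpf A" and ab: "a \<in> A" "b \<in> A"
  shows "\<tau> \<circ> transpose a b permutes A" "transpose a b \<circ> \<tau> permutes A"
    "inv' (\<tau> \<circ> transpose a b) = transpose a b \<circ> \<tau>"
proof -
  show "\<tau> \<circ> transpose a b permutes A" "transpose a b \<circ> \<tau> permutes A"
    by (intro permutes_compose fpf_permutes[OF t] permutes_swap_id ab)+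
  show "inv' (\<tau> \<circ> transpose a b) = transpose a b \<circ> \<tau>"
    by (rule inv_unique_comp) (simp_all add: fun_eq_iff fpf_involution[OF t])
qed

text \<open>The length rises from \<tau> to \<open>\<tau> r\<close>, is kept by passing to the
  inverse \<open>r \<tau>\<close>, and rises again to \<open>r \<tau> r\<close>. By
  \<open>perm_length_fpf\<close> the lengths of the two involutions compare as their diagrams
  do.\<close>

lemma card_diagram_conj_less:
  assumes t: "\<tau> \<in> fpf {1..2 * k}" and ab: "1 \<le> a" "a < b" "b \<le> 2 * k" and less: "\<tau> a < \<tau> b"
  shows "card (diagram {1..2 * k} \<tau>) < card (diagram {1..2 * k} (conj_transpose a b \<tau>))"
proof -
  have in_A: "a \<in> {1..2 * k}" "b \<in> {1..2 * k}" using ab by auto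
  have neq: "\<tau> a \<noteq> b" using less ab fpf_involution[OF t, of a] by auto
  have "perm_length (2 * k) \<tau> < perm_length (2 * k) (\<tau> \<circ> transpose a b)"
    by (rule perm_length_transpose_less[OF fpf_permutes[OF t] ab less])
  also have "\<dots> = perm_length (2 * k) (transpose a b \<circ> \<tau>)"
    using perm_length_inv[OF transpose_comp_fpf_permutes_inv(1)[OF t in_A]]
    by (simp only: transpose_comp_fpf_permutes_inv(3)[OF t in_A])
  also have "\<dots> < perm_length (2 * k) (conj_transpose a b \<tau>)"
    using fpf_transpose_image[OF t in_A neq] less
    by (intro perm_length_transpose_less[OF transpose_comp_fpf_permutes_inv(2)[OF t in_A] ab])
      simp
  finally show ?thesis
    by (simp only: perm_length_fpf[OF t] perm_length_fpf[OF fpf_conj_transpose[OF t in_A]])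
qed

lemma card_diagram_conj_greater:
  assumes t: "\<tau> \<in> fpf {1..2 * k}" and ab: "1 \<le> a" "a < b" "b \<le> 2 * k"
    and gr: "\<tau> b < \<tau> a" and neq: "\<tau> a \<noteq> b"
  shows "card (diagram {1..2 * k} (conj_transpose a b \<tau>)) < card (diagram {1..2 * k} \<tau>)"
proof -
  let ?t = "conj_transpose a b \<tau>"
  have in_A: "a \<in> {1..2 * k}" "b \<in> {1..2 * k}" using ab by auto
  \<comment> \<open>Conjugating twice gives \<tau> back, so a fall from \<tau> to \<open>?t\<close>
    is a rise from \<open>?t\<close> to \<tau>.\<close>
  have "?t a < ?t b" using fpf_transpose_image[OF t in_A neq] gr by simp
  from card_diagram_conj_less[OF fpf_conj_transpose[OF t in_A] ab this]
  show ?thesis unfolding conj_transpose_twice .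
qed

text \<open>Each of the two multiplications by \<open>adj i\<close> lengthens by exactly one. The
  length grows by two in all, and the diagram enters it with the factor two.\<close>

lemma card_diagram_conj_adj:
  assumes t: "\<tau> \<in> fpf {1..2 * k}" and i: "1 \<le> i" "i < 2 * k" and less: "\<tau> i < \<tau> (Suc i)"
  shows "card (diagram {1..2 * k} (conj_transpose i (Suc i) \<tau>)) = Suc (card (diagram {1..2 * k} \<tau>))"
proof -
  have in_A: "i \<in> {1..2 * k}" "Suc i \<in> {1..2 * k}" using i by auto
  have neq: "\<tau> i \<noteq> Suc i" using less fpf_involution[OF t, of i] by auto
  have "perm_length (2 * k) (conj_transpose i (Suc i) \<tau>) = Suc (perm_length (2 * k) (adj i \<circ> \<tau>))"
    using fpf_transpose_image[OF t in_A neq] less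
    by (intro perm_length_adj[OF transpose_comp_fpf_permutes_inv(2)[OF t in_A] i]) simp
  also have "perm_length (2 * k) (adj i \<circ> \<tau>) = perm_length (2 * k) (\<tau> \<circ> adj i)"
    using perm_length_inv[OF transpose_comp_fpf_permutes_inv(1)[OF t in_A]]
    by (simp only: transpose_comp_fpf_permutes_inv(3)[OF t in_A])
  also have "\<dots> = Suc (perm_length (2 * k) \<tau>)"
    by (rule perm_length_adj[OF fpf_permutes[OF t] i less])
  finally show ?thesis
    unfolding perm_length_fpf[OF t] perm_length_fpf[OF fpf_conj_transpose[OF t in_A]] by linarith
qed

lemma card_diagram_adj_bound:
  assumes t: "\<tau> \<in> fpf {1..2 * k}" and i: "1 \<le> i" "i < 2 * k"
  shows "\<bar>int (card (diagram {1..2 * k} (conj_transpose i (Suc i) \<tau>)))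
            - int (card (diagram {1..2 * k} \<tau>))\<bar> \<le> 1"
proof -
  let ?t = "conj_transpose i (Suc i) \<tau>"
  have in_A: "i \<in> {1..2 * k}" "Suc i \<in> {1..2 * k}" using i by auto
  have "\<tau> i \<noteq> \<tau> (Suc i)" using fpf_eq_iff[OF t, of i "Suc i"] by simp
  then consider "\<tau> i < \<tau> (Suc i)" | "\<tau> i = Suc i" | "\<tau> (Suc i) < \<tau> i" "\<tau> i \<noteq> Suc i"
    by linarith
  then show ?thesis
  proof cases
    case 1
    then show ?thesis by (simp only: card_diagram_conj_adj[OF t i])
  next
    case 2
    then show ?thesis by (simp only: fpf_conj_transpose_eq[OF t])
  next
    case 3
    then have "?t i < ?t (Suc i)" using fpf_transpose_image[OF t in_A] by simp
    from card_diagram_conj_adj[OF fpf_conj_transpose[OF t in_A] i this]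
    show ?thesis unfolding conj_transpose_twice by linarith
  qed
qed

text \<open>If \<tau> does not exchange \<open>a\<close> and \<open>b\<close>, the level strictly
  rises or strictly falls; if it does, \<tau> commutes with the transposition.\<close>

lemma card_diagram_conj_eq_imp:
  assumes t: "\<tau> \<in> fpf {1..2 * k}" and ab: "1 \<le> a" "a < b" "b \<le> 2 * k"
    and eq: "card (diagram {1..2 * k} (conj_transpose a b \<tau>)) = card (diagram {1..2 * k} \<tau>)"
  shows "conj_transpose a b \<tau> = \<tau>"
proof -
  have "\<not> \<tau> a < \<tau> b" using card_diagram_conj_less[OF t ab] eq by linarith
  moreover have "\<tau> a \<noteq> \<tau> b" using fpf_eq_iff[OF t, of a b] ab by simp
  ultimately have "\<tau> a = b" using card_diagram_conj_greater[OF t ab] eq by linarith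
  then show ?thesis by (rule fpf_conj_transpose_eq[OF t])
qed

text \<open>If conjugating by \<open>s = (i i+1)\<close> reverses the effect of \<open>r = (a b)\<close> on the level, then either
  \<open>r = s\<close> or \<open>\<tau>\<close> maps \<open>(a, b)\<close> to \<open>(i, i+1)\<close>, so that \<open>s = \<tau> r \<tau>\<close> commutes with \<open>r\<close>.\<close>

lemma card_diagram_conj_reversed_imp_eq:
  assumes t: "\<tau> \<in> fpf {1..2 * k}" and ab: "1 \<le> a" "a < b" "b \<le> 2 * k" and i: "1 \<le> i" "i < 2 * k"
    and up: "card (diagram {1..2 * k} \<tau>) < card (diagram {1..2 * k} (conj_transpose a b \<tau>))"
    and down: "card (diagram {1..2 * k} (conj_transpose i (Suc i) (conj_transpose a b \<tau>)))
                 < card (diagram {1..2 * k} (conj_transpose i (Suc i) \<tau>))"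
  shows "conj_transpose a b \<tau> = conj_transpose i (Suc i) \<tau>"
proof (cases "(a, b) = (i, Suc i)")
  case False
  let ?s = "adj i" and ?t = "conj_transpose i (Suc i) \<tau>"
  have in_A: "a \<in> {1..2 * k}" "b \<in> {1..2 * k}" "i \<in> {1..2 * k}" "Suc i \<in> {1..2 * k}"
    using ab i by auto
  have less: "\<tau> a < \<tau> b"
  proof (rule ccontr)
    assume "\<not> \<tau> a < \<tau> b"
    moreover have "\<tau> a \<noteq> \<tau> b" using fpf_eq_iff[OF t, of a b] ab by simp
    moreover have "\<tau> a \<noteq> b" using fpf_conj_transpose_eq[OF t] up by fastforce
    ultimately show False using card_diagram_conj_greater[OF t ab] up by linarith
  qed
  have s_ab: "?s a < ?s b" using adj_less[OF ab(2) False] .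
  have s_in: "1 \<le> ?s a" "?s b \<le> 2 * k"
    using adj_in_iff[OF i, of a] adj_in_iff[OF i, of b] in_A by simp_all
  \<comment> \<open>Conjugation by \<open>s\<close> turns \<open>r\<close> into the transposition of
    \<open>?s a\<close> and \<open>?s b\<close>. The assumed fall then says that \<open>s\<close>
    reverses the order of \<tau> a and \<tau> b, which happens only for the pair
    \<open>(i, Suc i)\<close>.\<close>
  have "transpose (?s a) (?s b) = ?s \<circ> transpose a b \<circ> ?s"
    by (simp add: fun_eq_iff transpose_def)
  then have "conj_transpose (?s a) (?s b) ?t = conj_transpose i (Suc i) (conj_transpose a b \<tau>)"
    by (simp add: fun_eq_iff)
  then have "\<not> ?t (?s a) < ?t (?s b)"
    using card_diagram_conj_less[OF fpf_conj_transpose[OF t in_A(3,4)] s_in(1) s_ab s_in(2)] down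
    by (metis less_asym)
  then have "\<not> ?s (\<tau> a) < ?s (\<tau> b)" by simp
  then have eq: "\<tau> a = i" "\<tau> b = Suc i" using adj_less[OF less, of i] by auto
  have inv: "\<tau> i = a" "\<tau> (Suc i) = b" using eq fpf_involution[OF t] by metis+
  \<comment> \<open>Now \<open>a\<close>, \<open>b\<close>, \<open>i\<close>, \<open>Suc i\<close>
    turn out to be four different points, with \<open>a\<close> paired to \<open>i\<close> and
    \<open>b\<close> to \<open>Suc i\<close>. Conjugation by either transposition re-pairs them as
    \<open>a\<close> with \<open>Suc i\<close> and \<open>b\<close> with \<open>i\<close>.\<close>
  have dist: "a \<noteq> i" "b \<noteq> Suc i" using fpf_neq[OF t] in_A inv by metis+
  have dist': "a \<noteq> Suc i" "b \<noteq> i" using dist inv eq ab by auto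
  have other: "\<tau> x \<notin> {a, b, i, Suc i}" if "x \<notin> {a, b, i, Suc i}" for x
    using that eq inv fpf_eq_iff[OF t, of x a] fpf_eq_iff[OF t, of x b]
      fpf_eq_iff[OF t, of x i] fpf_eq_iff[OF t, of x "Suc i"] by simp
  show ?thesis
  proof
    fix x
    show "conj_transpose a b \<tau> x = conj_transpose i (Suc i) \<tau> x"
    proof (cases "x \<in> {a, b, i, Suc i}")
      case True
      then consider "x = a" | "x = b" | "x = i" | "x = Suc i" by blast
      then show ?thesis
        using ab(2) by cases (simp_all add: eq inv dist dist' dist[symmetric] dist'[symmetric])
    next
      case False
      then show ?thesis using other[OF False] by simp
    qed
  qed
qed simp

section \<open>The generating function of the diagram size\<close>

text \<open>A new minimum does not change how many points lie above the others and itself has all of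
  them above it, so it contributes the next power of \<open>q\<close>.\<close>

lemma sum_power_card_greater:
  fixes q :: "'a::comm_semiring_1" and B :: "nat set"
  assumes "finite B"
  shows "(\<Sum>c\<in>B. q ^ card {y \<in> B. c < y}) = (\<Sum>j<card B. q ^ j)"
  using assms
proof (induction rule: finite_linorder_min_induct)
  case empty
  show ?case by simp
next
  case (insert b B)
  have b: "b \<notin> B" using insert(2) by blast
  have "{y \<in> insert b B. b < y} = B" using insert(2) by auto
  moreover have "{y \<in> insert b B. c < y} = {y \<in> B. c < y}" if "c \<in> B" for c
    using insert(2) that by (auto dest: less_asym)
  ultimately show ?case using insert b by (simp add: add.commute)
qed

section \<open>Adjoining a pair to a fixed point free involution and deleting one\<close>

lemma transpose_comp_fpf:
  assumes t: "\<tau> \<in> fpf (A - {c, m})" and cm: "c \<in> A" "m \<in> A" "c \<noteq> m"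
  shows "transpose c m \<circ> \<tau> \<in> fpf A" "(transpose c m \<circ> \<tau>) c = m" "(transpose c m \<circ> \<tau>) m = c"
    "\<And>x. x \<in> A - {c, m} \<Longrightarrow> (transpose c m \<circ> \<tau>) x = \<tau> x"
proof -
  have fix_cm: "\<tau> c = c" "\<tau> m = m"
    using permutes_not_in[OF fpf_permutes[OF t]] by simp_all
  show c: "(transpose c m \<circ> \<tau>) c = m" and m: "(transpose c m \<circ> \<tau>) m = c"
    using fix_cm by simp_all
  have "\<tau> x \<noteq> c \<and> \<tau> x \<noteq> m" if "x \<noteq> c" "x \<noteq> m" for x
    using fpf_eq_iff[OF t, of x c] fpf_eq_iff[OF t, of x m] fix_cm that by simp
  then have other: "(transpose c m \<circ> \<tau>) x = \<tau> x" if "x \<noteq> c" "x \<noteq> m" for x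
    using that by simp
  then show "\<And>x. x \<in> A - {c, m} \<Longrightarrow> (transpose c m \<circ> \<tau>) x = \<tau> x" by blast
  have "transpose c m \<circ> \<tau> permutes A"
    by (intro permutes_compose permutes_swap_id cm permutes_subset[OF fpf_permutes[OF t]]) blast
  moreover have "(transpose c m \<circ> \<tau>) ((transpose c m \<circ> \<tau>) x) = x" for x
  proof (cases "x = c \<or> x = m")
    case True
    then show ?thesis using c m by metis
  next
    case False
    then have "\<tau> x \<noteq> c" "\<tau> x \<noteq> m" using fix_cm fpf_eq_iff[OF t] by metis+
    then show ?thesis using other False fpf_involution[OF t] by metis
  qed
  moreover have "(transpose c m \<circ> \<tau>) x \<noteq> x" if "x \<in> A" for x
  proof (cases "x = c \<or> x = m")
    case True
    then show ?thesis using c m cm by metis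
  next
    case False
    then show ?thesis using other[of x] fpf_neq[OF t, of x] that by simp
  qed
  ultimately show "transpose c m \<circ> \<tau> \<in> fpf A" unfolding fpf_def by (simp add: fun_eq_iff)
qed

lemma transpose_comp_fpf_remove:
  assumes t: "\<tau> \<in> fpf A" and m: "m \<in> A"
  shows "transpose (\<tau> m) m \<circ> \<tau> \<in> fpf (A - {\<tau> m, m})"
proof -
  let ?t = "transpose (\<tau> m) m \<circ> \<tau>"
  have neq: "\<tau> m \<noteq> m" by (rule fpf_neq[OF t m])
  have fixed: "?t m = m" "?t (\<tau> m) = \<tau> m" using fpf_involution[OF t, of m] by simp_all
  have other: "?t x = \<tau> x" if "x \<noteq> m" "x \<noteq> \<tau> m" for x
    using fpf_eq_iff[OF t, of x m] fpf_eq_iff[OF t, of x "\<tau> m"] fpf_involution[OF t, of m] that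
    by simp
  have "?t permutes A"
    by (intro permutes_compose permutes_swap_id fpf_permutes[OF t] m)
       (use fpf_in_iff[OF t] m in simp)
  then have "?t permutes (A - {\<tau> m, m})"
  proof (rule permutes_superset)
    fix x assume "x \<in> A - (A - {\<tau> m, m})"
    then have "x = m \<or> x = \<tau> m" by blast
    then show "?t x = x" using fixed by metis
  qed
  moreover have "?t (?t x) = x" for x
  proof (cases "x = m \<or> x = \<tau> m")
    case True
    then show ?thesis using fixed by metis
  next
    case False
    then have "\<tau> x \<noteq> m" "\<tau> x \<noteq> \<tau> m" using fpf_eq_iff[OF t] fpf_involution[OF t] by metis+
    then show ?thesis using other False fpf_involution[OF t] by metis
  qed
  moreover have "?t x \<noteq> x" if "x \<in> A - {\<tau> m, m}" for x
    using other[of x] that fpf_neq[OF t, of x] by simp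
  ultimately show ?thesis unfolding fpf_def by (simp add: fun_eq_iff)
qed

text \<open>The maximum \<open>m\<close> occurs in no diagram element, so the pair
  \<open>{c, m}\<close> adds only elements with \<open>c\<close> as a coordinate. Since the image of
  \<open>c\<close> is \<open>m\<close>, the condition on that image holds automatically, and what
  remains constrains one point and its partner.\<close>

lemma card_diagram_transpose_comp:
  assumes A: "finite A" and m: "m \<in> A" "\<And>x. x \<in> A \<Longrightarrow> x \<le> m" and c: "c \<in> A - {m}"
    and t: "\<tau> \<in> fpf (A - {c, m})"
  shows "card (diagram A (transpose c m \<circ> \<tau>))
           = card (diagram (A - {c, m}) \<tau>) + card {y \<in> A - {m}. c < y}"
proof -
  define B where "B = A - {c, m}"
  define t' where "t' = transpose c m \<circ> \<tau>"
  have cm: "c \<in> A" "c \<noteq> m" "c < m" using c m(2)[of c] by auto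
  note t'_simps = transpose_comp_fpf(2,3)[OF t cm(1) m(1) cm(2), folded t'_def]
  have t'_B: "t' x = \<tau> x" if "x \<in> B" for x
    using transpose_comp_fpf(4)[OF t cm(1) m(1) cm(2)] that by (simp add: B_def t'_def)
  note t = t[folded B_def]
  have finB: "finite B" using A by (simp add: B_def)
  have tB: "\<tau> x \<in> B" if "x \<in> B" for x using fpf_in_iff[OF t] that by simp
  have B_less: "x < m" "x \<noteq> c" if "x \<in> B" for x using m(2)[of x] that by (auto simp: B_def)
  have A_eq: "A = insert c (insert m B)" using cm m by (auto simp: B_def)
  define E1 where "E1 = {i \<in> B. i < c \<and> c < \<tau> i}"
  define E2 where "E2 = {j \<in> B. c < j \<and> c < \<tau> j}"
  have fin: "finite E1" "finite E2" using finB by (simp_all add: E1_def E2_def)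
  have "diagram A t' = diagram B \<tau> \<union> ((\<lambda>i. (i, c)) ` E1 \<union> (\<lambda>j. (c, j)) ` E2)" (is "?L = ?R")
  proof
    show "?L \<subseteq> ?R"
    proof
      fix x assume "x \<in> ?L"
      then obtain i j where x: "x = (i, j)" and ij: "i \<in> A" "j \<in> A" "i < j" "j < t' i" "i < t' j"
        by (auto simp: diagram_def)
      have "i \<noteq> m" using ij m(2)[of j] by auto
      \<comment> \<open>In a diagram element \<open>(i, j)\<close> the point \<open>j\<close> lies
        below the image of \<open>i\<close>, which is impossible for the maximum.\<close>
      moreover have "j \<noteq> m"
      proof
        assume "j = m"
        then have "m < t' i" using ij by simp
        moreover have "t' i \<in> A"
          using fpf_in_iff[OF transpose_comp_fpf(1)[OF t[unfolded B_def] cm(1) m(1) cm(2)]] ij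
          by (simp add: t'_def)
        ultimately show False using m(2) by fastforce
      qed
      ultimately consider "i \<in> B" "j \<in> B" | "i \<in> B" "j = c" | "i = c" "j \<in> B"
        using ij A_eq by blast
      then show "x \<in> ?R"
      proof cases
        case 1
        then show ?thesis using ij x t'_B by (simp add: diagram_def)
      next
        case 2
        then show ?thesis using ij x t'_B by (simp add: E1_def)
      next
        case 3
        then show ?thesis using ij x t'_B by (simp add: E2_def)
      qed
    qed
    show "?R \<subseteq> ?L"
      using t'_B t'_simps B_less cm by (auto simp: diagram_def E1_def E2_def A_eq)
  qed
  moreover have "diagram B \<tau> \<inter> ((\<lambda>i. (i, c)) ` E1 \<union> (\<lambda>j. (c, j)) ` E2) = {}"
    using B_less(2) by (auto simp: diagram_def)
  moreover have "(\<lambda>i. (i, c)) ` E1 \<inter> (\<lambda>j. (c, j)) ` E2 = {}"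
    by (auto simp: E1_def E2_def)
  ultimately have "card (diagram A t') = card (diagram B \<tau>) + (card E1 + card E2)"
    using fin finB by (simp add: card_Un_disjoint card_image inj_on_def)
  also have "card E1 + card E2 = card (E1 \<union> E2)"
    using fin by (intro card_Un_disjoint[symmetric]) (auto simp: E1_def E2_def)
  \<comment> \<open>Both kinds of new elements together are indexed by the points whose partner
    exceeds \<open>c\<close>. Passing to the partner shows that their number does not depend on
    \<tau>.\<close>
  also have "E1 \<union> E2 = {x \<in> B. c < \<tau> x}"
    using B_less(2) by (fastforce simp: E1_def E2_def)
  also have "card \<dots> = card {y \<in> A - {m}. c < y}"
  proof (rule bij_betw_same_card[of \<tau>], rule bij_betw_byWitness[where f' = \<tau>])
    show "\<tau> ` {x \<in> B. c < \<tau> x} \<subseteq> {y \<in> A - {m}. c < y}"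
      using tB by (auto simp: B_def)
    show "\<tau> ` {y \<in> A - {m}. c < y} \<subseteq> {x \<in> B. c < \<tau> x}"
    proof (rule image_subsetI)
      fix y assume "y \<in> {y \<in> A - {m}. c < y}"
      then have "y \<in> B" "c < y" by (auto simp: B_def)
      then show "\<tau> y \<in> {x \<in> B. c < \<tau> x}" using tB fpf_involution[OF t] by simp
    qed
  qed (simp_all add: fpf_involution[OF t])
  finally show ?thesis unfolding t'_def B_def .
qed

text \<open>With \<open>q\<close> in an arbitrary commutative semiring, one identity serves twice:
  \<open>q = 1\<close> in the natural numbers counts the involutions, and the polynomial variable
  gives the Poincare polynomial.\<close>

lemma sum_power_card_diagram:
  fixes q :: "'a::comm_semiring_1"
  assumes "finite A" "card A = 2 * k"
  shows "(\<Sum>\<tau>\<in>fpf A. q ^ card (diagram A \<tau>)) = (\<Prod>i=1..k. \<Sum>j<2 * i - 1. q ^ j)"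
  using assms
proof (induction k arbitrary: A)
  case 0
  then have "A = {}" by simp
  moreover have "fpf {} = {id}" by (auto simp: fpf_def)
  moreover have "card (diagram {} \<tau>) = 0" for \<tau> by (simp add: diagram_def)
  ultimately show ?case by simp
next
  case (Suc k)
  let ?m = "Max A"
  have m: "?m \<in> A" "\<And>x. x \<in> A \<Longrightarrow> x \<le> ?m" using Suc.prems by (auto intro!: Max_in)
  \<comment> \<open>An involution is cut into the partner \<open>c\<close> of the maximum and its
    action on the remaining points. Composition with the transposition of \<open>c\<close> and
    \<open>?m\<close> does both the cutting and the gluing.\<close>
  have "(\<Sum>\<tau>\<in>fpf A. q ^ card (diagram A \<tau>))
     = (\<Sum>(c, \<tau>)\<in>Sigma (A - {?m}) (\<lambda>c. fpf (A - {c, ?m})). q ^ card (diagram A (transpose c ?m \<circ> \<tau>)))"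
  proof (rule sum.reindex_bij_witness[where i = "\<lambda>(c, \<tau>). transpose c ?m \<circ> \<tau>"
        and j = "\<lambda>\<tau>. (\<tau> ?m, transpose (\<tau> ?m) ?m \<circ> \<tau>)"])
    fix \<tau> assume t: "\<tau> \<in> fpf A"
    have "\<tau> ?m \<in> A - {?m}" using fpf_in_iff[OF t] fpf_neq[OF t] m by simp
    then show "(\<tau> ?m, transpose (\<tau> ?m) ?m \<circ> \<tau>) \<in> Sigma (A - {?m}) (\<lambda>c. fpf (A - {c, ?m}))"
      using transpose_comp_fpf_remove[OF t m(1)] by simp
  next
    fix x assume "x \<in> Sigma (A - {?m}) (\<lambda>c. fpf (A - {c, ?m}))"
    then obtain c \<tau> where x: "x = (c, \<tau>)" "c \<in> A" "c \<noteq> ?m" "\<tau> \<in> fpf (A - {c, ?m})" by auto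
    note facts = transpose_comp_fpf[OF x(4,2) m(1) x(3)]
    show "(\<lambda>(c, \<tau>). transpose c ?m \<circ> \<tau>) x \<in> fpf A" using facts(1) by (simp add: x(1))
    show "(\<lambda>\<tau>. (\<tau> ?m, transpose (\<tau> ?m) ?m \<circ> \<tau>)) ((\<lambda>(c, \<tau>). transpose c ?m \<circ> \<tau>) x) = x"
      unfolding x(1) case_prod_conv facts(3) by (simp add: fun_eq_iff)
  qed (auto simp flip: comp_assoc)
  also have "\<dots> = (\<Sum>(c, \<tau>)\<in>Sigma (A - {?m}) (\<lambda>c. fpf (A - {c, ?m})).
                     q ^ card {y \<in> A - {?m}. c < y} * q ^ card (diagram (A - {c, ?m}) \<tau>))"
  proof (rule sum.cong[OF refl])
    fix x assume "x \<in> Sigma (A - {?m}) (\<lambda>c. fpf (A - {c, ?m}))"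
    then obtain c \<tau> where x: "x = (c, \<tau>)" "c \<in> A - {?m}" "\<tau> \<in> fpf (A - {c, ?m})" by blast
    have eq: "card (diagram A (transpose c ?m \<circ> \<tau>))
                = card (diagram (A - {c, ?m}) \<tau>) + card {y \<in> A - {?m}. c < y}"
      using card_diagram_transpose_comp[OF Suc.prems(1) m x(2,3)] by blast
    show "(case x of (c, \<tau>) \<Rightarrow> q ^ card (diagram A (transpose c ?m \<circ> \<tau>))) =
       (case x of (c, \<tau>) \<Rightarrow> q ^ card {y \<in> A - {?m}. c < y} * q ^ card (diagram (A - {c, ?m}) \<tau>))"
      unfolding x(1) case_prod_conv eq by (simp only: power_add mult.commute)
  qed
  also have "\<dots> = (\<Sum>c\<in>A - {?m}. q ^ card {y \<in> A - {?m}. c < y} *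
                     (\<Sum>\<tau>\<in>fpf (A - {c, ?m}). q ^ card (diagram (A - {c, ?m}) \<tau>)))"
    using Suc.prems(1) by (simp add: sum.Sigma[symmetric] fpf_finite sum_distrib_left)
  also have "\<dots> = (\<Sum>c\<in>A - {?m}. q ^ card {y \<in> A - {?m}. c < y} * (\<Prod>i=1..k. \<Sum>j<2 * i - 1. q ^ j))"
  proof (rule sum.cong[OF refl])
    fix c assume c: "c \<in> A - {?m}"
    have "card (A - {c, ?m}) = 2 * k"
      using c m(1) Suc.prems by (simp add: card_Diff_subset)
    with Suc.IH[of "A - {c, ?m}"] Suc.prems(1)
    show "q ^ card {y \<in> A - {?m}. c < y} *
            (\<Sum>\<tau>\<in>fpf (A - {c, ?m}). q ^ card (diagram (A - {c, ?m}) \<tau>)) =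
          q ^ card {y \<in> A - {?m}. c < y} * (\<Prod>i=1..k. \<Sum>j<2 * i - 1. q ^ j)"
      by simp
  qed
  also have "\<dots> = (\<Sum>c\<in>A - {?m}. q ^ card {y \<in> A - {?m}. c < y}) * (\<Prod>i=1..k. \<Sum>j<2 * i - 1. q ^ j)"
    by (rule sum_distrib_right[symmetric])
  also have "(\<Sum>c\<in>A - {?m}. q ^ card {y \<in> A - {?m}. c < y}) = (\<Sum>j<2 * Suc k - 1. q ^ j)"
    using sum_power_card_greater[of "A - {?m}" q] Suc.prems m(1) by simp
  also have "\<dots> * (\<Prod>i=1..k. \<Sum>j<2 * i - 1. q ^ j) = (\<Prod>i=1..Suc k. \<Sum>j<2 * i - 1. q ^ j)"
    by (simp add: mult.commute)
  finally show ?case .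
qed

lemma card_fpf: "finite A \<Longrightarrow> card A = 2 * k \<Longrightarrow> card (fpf A) = (\<Prod>i=1..k. 2 * i - 1)"
  using sum_power_card_diagram[of A k "1::nat"] by simp

section \<open>Perfect matchings as permutations and as involutions\<close>

lemma perfect_matchings_unique:
  assumes "M \<in> perfect_matchings n" "e \<in> M" "e' \<in> M" "x \<in> e" "x \<in> e'"
  shows "e = e'"
  using assms disjointD[of M e e'] by (auto simp: perfect_matchings_def partition_on_def)

lemma perfect_matchings_finite_edges:
  assumes "M \<in> perfect_matchings n"
  shows "finite M"
  using assms finite_elements[of "{1..n}" M] by (simp add: perfect_matchings_def)

lemma perfect_matchings_edge:
  assumes M: "M \<in> perfect_matchings n" and e: "e \<in> M"
  obtains i j where "e = {i, j}" "i < j" "1 \<le> i" "j \<le> n" "Min e = i"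
proof -
  have "card e = 2" "e \<subseteq> {1..n}" using M e by (auto simp: perfect_matchings_def partition_on_def)
  then obtain x y where xy: "e = {x, y}" "x \<noteq> y" by (auto simp: card_2_iff)
  show thesis
  proof (rule that[of "min x y" "max x y"])
    show "e = {min x y, max x y}" using xy by (auto simp: min_def max_def)
    show "1 \<le> min x y" "max x y \<le> n" using \<open>e \<subseteq> {1..n}\<close> xy by auto
    show "Min e = min x y" using xy by (simp add: min_def)
  qed (use xy in auto)
qed

lemma card_perfect_matching:
  assumes M: "M \<in> perfect_matchings (2 * k)"
  shows "card M = k"
proof -
  have "2 * k = card (\<Union> M)"
    using M by (simp add: perfect_matchings_def partition_on_def)
  also have "\<dots> = (\<Sum>e\<in>M. card e)"
    using M by (intro card_Union_disjoint)
      (auto simp: perfect_matchings_def partition_on_def card_2_iff intro: card_ge_0_finite)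
  also have "\<dots> = 2 * card M" using M by (simp add: perfect_matchings_def)
  finally show ?thesis by simp
qed

text \<open>Guarantees that the sorted list of minima has one entry for each edge, so that
  \<open>fst_pt\<close> stays within that list.\<close>

lemma inj_on_Min_perfect_matching:
  assumes M: "M \<in> perfect_matchings n"
  shows "inj_on Min M"
proof (rule inj_onI)
  fix e e' assume e: "e \<in> M" "e' \<in> M" "Min e = Min e'"
  obtain i j where "e = {i, j}" "Min e = i" using perfect_matchings_edge[OF M e(1)] by metis
  moreover obtain i' j' where "e' = {i', j'}" "Min e' = i'"
    using perfect_matchings_edge[OF M e(2)] by metis
  ultimately show "e = e'" using perfect_matchings_unique[OF M e(1,2), of i] e(3) by simp
qed

lemma fst_pt_strict_mono:
  assumes M: "M \<in> perfect_matchings (2 * k)" and tu: "1 \<le> t" "t < u" "u \<le> k"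
  shows "fst_pt M t < fst_pt M u"
proof -
  have "card (Min ` M) = k"
    using card_image[OF inj_on_Min_perfect_matching[OF M]] card_perfect_matching[OF M] by simp
  then show ?thesis
    unfolding fst_pt_def using tu sorted_wrt_nth_less[OF strict_sorted_list_of_set[of "Min ` M"], of "t - 1" "u - 1"]
    by simp
qed

lemma fst_pt_image:
  assumes M: "M \<in> perfect_matchings (2 * k)"
  shows "fst_pt M ` {1..k} = Min ` M"
proof -
  have fin: "finite (Min ` M)" using perfect_matchings_finite_edges[OF M] by simp
  have len: "length (sorted_list_of_set (Min ` M)) = k"
    using card_image[OF inj_on_Min_perfect_matching[OF M]] card_perfect_matching[OF M] by simp
  \<comment> \<open>\<open>fst_pt\<close> counts from 1, list positions from 0.\<close>
  have "{1..k} = Suc ` {0..<k}"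
    by (simp add: atLeastLessThanSuc_atLeastAtMost)
  then have "fst_pt M ` {1..k} = (!) (sorted_list_of_set (Min ` M)) ` {0..<k}"
    by (simp only: image_image fst_pt_def diff_Suc_1)
  also have "\<dots> = set (sorted_list_of_set (Min ` M))"
    using nth_image[of k "sorted_list_of_set (Min ` M)"] len by (simp only: take_all le_refl)
  also have "\<dots> = Min ` M" using fin by simp
  finally show ?thesis .
qed

lemma fst_snd_pt:
  assumes M: "M \<in> perfect_matchings (2 * k)" and t: "t \<in> {1..k}"
  shows "{fst_pt M t, snd_pt M t} \<in> M" "fst_pt M t < snd_pt M t"
proof -
  have "fst_pt M t \<in> Min ` M" using fst_pt_image[OF M] t by blast
  then obtain e where e: "e \<in> M" "fst_pt M t = Min e" by blast
  obtain i j where ij: "e = {i, j}" "i < j" "Min e = i" using perfect_matchings_edge[OF M e(1)] by metis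
  have "snd_pt M t = j" unfolding snd_pt_def
  proof (rule the_equality)
    show "{fst_pt M t, j} \<in> M" using e ij by simp
    fix j' assume "{fst_pt M t, j'} \<in> M"
    then have "{i, j'} = {i, j}" using perfect_matchings_unique[OF M, of "{i, j'}" e i] e ij by simp
    then show "j' = j" by (auto simp: doubleton_eq_iff)
  qed
  then show "{fst_pt M t, snd_pt M t} \<in> M" "fst_pt M t < snd_pt M t" using e ij by simp_all
qed

lemma perfect_matching_eq_fst_snd_image:
  assumes M: "M \<in> perfect_matchings (2 * k)"
  shows "M = (\<lambda>t. {fst_pt M t, snd_pt M t}) ` {1..k}"
proof
  show "(\<lambda>t. {fst_pt M t, snd_pt M t}) ` {1..k} \<subseteq> M" using fst_snd_pt[OF M] by blast
  show "M \<subseteq> (\<lambda>t. {fst_pt M t, snd_pt M t}) ` {1..k}"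
  proof
    fix e assume e: "e \<in> M"
    then have "Min e \<in> fst_pt M ` {1..k}" using fst_pt_image[OF M] by blast
    then obtain t where t: "t \<in> {1..k}" "fst_pt M t = Min e" by auto
    have "Min e \<in> e" using perfect_matchings_edge[OF M e] by (metis insertI1)
    then have "e = {fst_pt M t, snd_pt M t}"
      by (intro perfect_matchings_unique[OF M e fst_snd_pt(1)[OF M t(1)], of "Min e"]) (simp_all add: t(2))
    then show "e \<in> (\<lambda>t. {fst_pt M t, snd_pt M t}) ` {1..k}" using t by blast
  qed
qed

section \<open>Matchings and the permutations that list their pairs in canonical order\<close>

lemma sigma_odd_even:
  assumes "t \<in> {1..k}"
  shows "sigma k M (2 * t - 1) = fst_pt M t" "sigma k M (2 * t) = snd_pt M t"
proof -
  have "2 * t - 1 \<in> {1..2 * k}" "odd (2 * t - 1)" "(2 * t - 1 + 1) div 2 = t" using assms by auto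
  then show "sigma k M (2 * t - 1) = fst_pt M t" by (simp add: sigma_def)
  show "sigma k M (2 * t) = snd_pt M t" using assms by (simp add: sigma_def)
qed

lemma odd_even_cases:
  assumes "m \<in> {1..2 * k :: nat}"
  obtains t where "t \<in> {1..k}" "m = 2 * t - 1" | t where "t \<in> {1..k}" "m = 2 * t"
proof (cases "odd m")
  case True
  then obtain u where "m = 2 * u + 1" by (rule oddE)
  then show ?thesis using that(1)[of "Suc u"] assms by simp
next
  case False
  then obtain u where "m = 2 * u" by blast
  then show ?thesis using that(2)[of u] assms by simp
qed

lemma sigma_in_pf_perms:
  assumes M: "M \<in> perfect_matchings (2 * k)"
  shows "sigma k M \<in> pf_perms k"
proof -
  let ?A = "{1..2 * k}"
  have Un: "\<Union> M = ?A" using M by (simp add: perfect_matchings_def partition_on_def)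
  have "?A \<subseteq> sigma k M ` ?A"
  proof
    fix x assume "x \<in> ?A"
    then have "x \<in> \<Union> ((\<lambda>t. {fst_pt M t, snd_pt M t}) ` {1..k})"
      using Un perfect_matching_eq_fst_snd_image[OF M] by simp
    then obtain t where t: "t \<in> {1..k}" "x = fst_pt M t \<or> x = snd_pt M t" by blast
    then have "x = sigma k M (2 * t - 1) \<or> x = sigma k M (2 * t)"
      using sigma_odd_even[OF t(1)] by simp
    moreover have "2 * t - 1 \<in> ?A" "2 * t \<in> ?A" using t(1) by auto
    ultimately show "x \<in> sigma k M ` ?A" by blast
  qed
  moreover have "sigma k M m \<in> ?A" if m: "m \<in> ?A" for m
    using m
  proof (cases rule: odd_even_cases)
    case (1 t)
    then show ?thesis using sigma_odd_even(1)[OF 1(1)] fst_snd_pt(1)[OF M 1(1)] Un by auto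
  next
    case (2 t)
    then show ?thesis using sigma_odd_even(2)[OF 2(1)] fst_snd_pt(1)[OF M 2(1)] Un by auto
  qed
  ultimately have im: "sigma k M ` ?A = ?A" by blast
  then have "inj_on (sigma k M) ?A" by (intro eq_card_imp_inj_on) simp_all
  then have "sigma k M permutes ?A"
    using im by (intro bij_imp_permutes) (auto simp: bij_betw_def sigma_def)
  moreover have "sigma k M (2 * t - 1) < sigma k M (2 * t)" if "t \<in> {1..k}" for t
    using fst_snd_pt(2)[OF M that] sigma_odd_even[OF that] by simp
  moreover have "sigma k M (2 * t - 1) < sigma k M (2 * t + 1)" if "t \<in> {1..<k}" for t
  proof -
    have "t \<in> {1..k}" "Suc t \<in> {1..k}" using that by auto
    then show ?thesis
      using sigma_odd_even(1)[of t k M] sigma_odd_even(1)[of "Suc t" k M]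
        fst_pt_strict_mono[OF M, of t "Suc t"] by simp
  qed
  ultimately show ?thesis unfolding pf_perms_def by blast
qed

lemma pf_perms_permutes: "\<pi> \<in> pf_perms k \<Longrightarrow> \<pi> permutes {1..2 * k}"
  and pf_perms_less: "\<pi> \<in> pf_perms k \<Longrightarrow> t \<in> {1..k} \<Longrightarrow> \<pi> (2 * t - 1) < \<pi> (2 * t)"
  by (auto simp: pf_perms_def)

lemma pf_perms_mono:
  assumes p: "\<pi> \<in> pf_perms k" and tu: "1 \<le> t" "t < u" "u \<le> k"
  shows "\<pi> (2 * t - 1) < \<pi> (2 * u - 1)"
  using tu(2,3)
proof (induction u)
  case (Suc u)
  have step: "\<pi> (2 * u - 1) < \<pi> (2 * Suc u - 1)"
    using p Suc.prems tu(1) by (simp add: pf_perms_def)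
  show ?case
  proof (cases "t = u")
    case False
    then have "\<pi> (2 * t - 1) < \<pi> (2 * u - 1)" using Suc by simp
    then show ?thesis using step by simp
  qed (use step in simp)
qed simp

lemma pf_perms_eq_iff:
  assumes p: "\<pi> \<in> pf_perms k" and tu: "t \<in> {1..k}" "u \<in> {1..k}"
  shows "\<pi> (2 * t - 1) = \<pi> (2 * u - 1) \<longleftrightarrow> t = u" "\<pi> (2 * t) = \<pi> (2 * u) \<longleftrightarrow> t = u"
    "\<pi> (2 * t - 1) \<noteq> \<pi> (2 * u)"
proof -
  have inj: "\<pi> x = \<pi> y \<longleftrightarrow> x = y" for x y
    using permutes_inj[OF pf_perms_permutes[OF p]] by (simp add: inj_eq)
  show "\<pi> (2 * t - 1) = \<pi> (2 * u - 1) \<longleftrightarrow> t = u" unfolding inj using tu by auto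
  show "\<pi> (2 * t) = \<pi> (2 * u) \<longleftrightarrow> t = u" unfolding inj by simp
  show "\<pi> (2 * t - 1) \<noteq> \<pi> (2 * u)" unfolding inj using tu(1) by (auto; presburger)
qed

text \<open>Inverse of \<open>sigma k\<close> on \<open>pf_perms k\<close>: it forgets the order of
  the blocks and the order within each block.\<close>

definition matching_of :: "nat \<Rightarrow> (nat \<Rightarrow> nat) \<Rightarrow> nat set set" where
  "matching_of k \<pi> = (\<lambda>t. {\<pi> (2 * t - 1), \<pi> (2 * t)}) ` {1..k}"

lemma matching_of_sigma:
  assumes "M \<in> perfect_matchings (2 * k)"
  shows "matching_of k (sigma k M) = M"
proof -
  have "matching_of k (sigma k M) = (\<lambda>t. {fst_pt M t, snd_pt M t}) ` {1..k}"
    unfolding matching_of_def by (intro image_cong refl) (simp only: sigma_odd_even)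
  then show ?thesis using perfect_matching_eq_fst_snd_image[OF assms] by simp
qed

lemma matching_of_in_perfect_matchings:
  assumes p: "\<pi> \<in> pf_perms k"
  shows "matching_of k \<pi> \<in> perfect_matchings (2 * k)"
proof -
  note eq_iff = pf_perms_eq_iff[OF p] pf_perms_eq_iff(3)[OF p, symmetric]
  have in_A: "\<pi> m \<in> {1..2 * k} \<longleftrightarrow> m \<in> {1..2 * k}" for m
    by (rule permutes_in_image[OF pf_perms_permutes[OF p]])
  have "\<Union> (matching_of k \<pi>) = {1..2 * k}"
  proof
    show "\<Union> (matching_of k \<pi>) \<subseteq> {1..2 * k}"
    proof
      fix x assume "x \<in> \<Union> (matching_of k \<pi>)"
      then obtain t where t: "t \<in> {1..k}" "x = \<pi> (2 * t - 1) \<or> x = \<pi> (2 * t)"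
        by (auto simp: matching_of_def)
      moreover have "2 * t - 1 \<in> {1..2 * k}" "2 * t \<in> {1..2 * k}" using t(1) by auto
      ultimately show "x \<in> {1..2 * k}" using in_A by metis
    qed
    show "{1..2 * k} \<subseteq> \<Union> (matching_of k \<pi>)"
    proof
      fix x assume "x \<in> {1..2 * k}"
      then obtain m where m: "m \<in> {1..2 * k}" "x = \<pi> m"
        using permutes_image[OF pf_perms_permutes[OF p]] by blast
      from m(1) show "x \<in> \<Union> (matching_of k \<pi>)"
        by (cases rule: odd_even_cases) (use m(2) in \<open>auto simp: matching_of_def\<close>)
    qed
  qed
  moreover have "disjoint (matching_of k \<pi>)"
  proof (rule disjointI)
    fix e e' assume "e \<in> matching_of k \<pi>" "e' \<in> matching_of k \<pi>" "e \<noteq> e'"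
    then obtain t u where "t \<in> {1..k}" "u \<in> {1..k}" "e = {\<pi> (2 * t - 1), \<pi> (2 * t)}"
      "e' = {\<pi> (2 * u - 1), \<pi> (2 * u)}" "t \<noteq> u"
      unfolding matching_of_def by blast
    then show "e \<inter> e' = {}" using eq_iff[of t u] eq_iff[of u t] by simp
  qed
  moreover have "card e = 2" if "e \<in> matching_of k \<pi>" for e
  proof -
    obtain t where "t \<in> {1..k}" "e = {\<pi> (2 * t - 1), \<pi> (2 * t)}"
      using \<open>e \<in> matching_of k \<pi>\<close> by (auto simp: matching_of_def)
    then show ?thesis using eq_iff(3)[of t t] by simp
  qed
  moreover have "{} \<notin> matching_of k \<pi>" by (auto simp: matching_of_def)
  ultimately show ?thesis unfolding perfect_matchings_def partition_on_def by blast
qed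

text \<open>The minima of the blocks are the values at odd positions, which increase by definition
  of \<open>pf_perms\<close>. They are therefore the sorted list from which \<open>fst_pt\<close>
  reads.\<close>

lemma sigma_matching_of:
  assumes p: "\<pi> \<in> pf_perms k"
  shows "sigma k (matching_of k \<pi>) = \<pi>"
proof -
  let ?M = "matching_of k \<pi>"
  have M: "?M \<in> perfect_matchings (2 * k)" by (rule matching_of_in_perfect_matchings[OF p])
  define xs where "xs = map (\<lambda>t. \<pi> (2 * t - 1)) [1..<Suc k]"
  have Min_eq: "Min {\<pi> (2 * t - 1), \<pi> (2 * t)} = \<pi> (2 * t - 1)" if "t \<in> {1..k}" for t
    using pf_perms_less[OF p that] by simp
  have "Min ` ?M = (\<lambda>t. \<pi> (2 * t - 1)) ` {1..k}"
    unfolding matching_of_def image_image by (intro image_cong refl Min_eq)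
  then have "set xs = Min ` ?M"
    by (simp only: xs_def set_map set_upt atLeastLessThanSuc_atLeastAtMost)
  moreover have "sorted_wrt (<) xs"
    unfolding xs_def sorted_wrt_map
    by (rule sorted_wrt_mono_rel[OF _ sorted_wrt_upt]) (use pf_perms_mono[OF p] in auto)
  ultimately have sorted: "sorted_list_of_set (Min ` ?M) = xs"
    by (metis sorted_list_of_set.idem_if_sorted_distinct strict_sorted_iff)
  have fst: "fst_pt ?M t = \<pi> (2 * t - 1)" if "t \<in> {1..k}" for t
  proof -
    have "t - 1 < length [1..<Suc k]" "1 + (t - 1) < Suc k" "1 + (t - 1) = t" using that by auto
    then show ?thesis unfolding fst_pt_def sorted xs_def by (simp only: nth_map nth_upt)
  qed
  have snd: "snd_pt ?M t = \<pi> (2 * t)" if t: "t \<in> {1..k}" for t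
    unfolding snd_pt_def fst[OF t]
  proof (rule the_equality)
    show e: "{\<pi> (2 * t - 1), \<pi> (2 * t)} \<in> ?M" using t by (auto simp: matching_of_def)
    fix j assume "{\<pi> (2 * t - 1), j} \<in> ?M"
    from perfect_matchings_unique[OF M this e, of "\<pi> (2 * t - 1)"]
    show "j = \<pi> (2 * t)" by (auto simp: doubleton_eq_iff)
  qed
  show ?thesis
  proof
    fix m
    show "sigma k ?M m = \<pi> m"
    proof (cases "m \<in> {1..2 * k}")
      case True
      then show ?thesis
      proof (cases rule: odd_even_cases)
        case (1 t)
        then show ?thesis using sigma_odd_even(1)[OF 1(1)] fst by simp
      next
        case (2 t)
        then show ?thesis using sigma_odd_even(2)[OF 2(1)] snd by simp
      qed
    next
      case False
      then show ?thesis
        using permutes_not_in[OF pf_perms_permutes[OF p] False] by (auto simp: sigma_def)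
    qed
  qed
qed

lemma bij_betw_sigma: "bij_betw (sigma k) (perfect_matchings (2 * k)) (pf_perms k)"
proof (rule bij_betw_byWitness[where f' = "matching_of k"])
  show "sigma k ` perfect_matchings (2 * k) \<subseteq> pf_perms k"
    by (rule image_subsetI) (rule sigma_in_pf_perms)
  show "matching_of k ` pf_perms k \<subseteq> perfect_matchings (2 * k)"
    by (rule image_subsetI) (rule matching_of_in_perfect_matchings)
qed (simp_all add: matching_of_sigma sigma_matching_of)

text \<open>The pairs are disjoint, so each transposition affects only its own two points. Allowing
  any repetition-free list of block indices makes the claim inductive: points of blocks not yet
  listed are fixed.\<close>

lemma foldr_transpose_pairs:
  assumes p: "\<pi> \<in> pf_perms k" and ts: "distinct ts" "set ts \<subseteq> {1..k}"
    and F: "F = foldr (\<lambda>t p. transpose (\<pi> (2 * t - 1)) (\<pi> (2 * t)) \<circ> p) ts id"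
    and t: "t \<in> {1..k}"
  shows "F (\<pi> (2 * t - 1)) = (if t \<in> set ts then \<pi> (2 * t) else \<pi> (2 * t - 1)) \<and>
         F (\<pi> (2 * t)) = (if t \<in> set ts then \<pi> (2 * t - 1) else \<pi> (2 * t))"
  using ts F
proof (induction ts arbitrary: F)
  case Nil
  then show ?case by simp
next
  case (Cons u ts)
  define G where "G = foldr (\<lambda>t p. transpose (\<pi> (2 * t - 1)) (\<pi> (2 * t)) \<circ> p) ts id"
  have F: "F x = transpose (\<pi> (2 * u - 1)) (\<pi> (2 * u)) (G x)" for x
    unfolding Cons.prems(3) G_def by (simp only: foldr.simps comp_apply)
  have u: "u \<in> {1..k}" "u \<notin> set ts" and ts: "distinct ts" "set ts \<subseteq> {1..k}"
    using Cons.prems by auto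
  note IH = Cons.IH[OF ts G_def]
  show ?case
  proof (cases "t = u")
    case True
    then show ?thesis unfolding F using IH u by simp
  next
    case False
    have "transpose (\<pi> (2 * u - 1)) (\<pi> (2 * u)) (\<pi> (2 * t - 1)) = \<pi> (2 * t - 1)"
      "transpose (\<pi> (2 * u - 1)) (\<pi> (2 * u)) (\<pi> (2 * t)) = \<pi> (2 * t)"
      using pf_perms_eq_iff[OF p t u(1)] pf_perms_eq_iff[OF p u(1) t] False
      by (metis transpose_apply_other)+
    then show ?thesis unfolding F using IH False by simp
  qed
qed

lemma tau_sigma:
  assumes M: "M \<in> perfect_matchings (2 * k)" and t: "t \<in> {1..k}"
  shows "tau k M (sigma k M (2 * t - 1)) = sigma k M (2 * t)"
    "tau k M (sigma k M (2 * t)) = sigma k M (2 * t - 1)"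
proof -
  have set: "set [1..<k + 1] = {1..k}" by auto
  have "tau k M = foldr (\<lambda>t p. transpose (sigma k M (2 * t - 1)) (sigma k M (2 * t)) \<circ> p) [1..<k + 1] id"
    unfolding tau_def
  proof (rule foldr_cong)
    fix t and p :: "nat \<Rightarrow> nat"
    assume "t \<in> set [1..<k + 1]"
    then have "t \<in> {1..k}" unfolding set .
    then show "transpose (fst_pt M t) (snd_pt M t) \<circ> p
                 = transpose (sigma k M (2 * t - 1)) (sigma k M (2 * t)) \<circ> p"
      by (simp only: sigma_odd_even)
  qed simp_all
  from foldr_transpose_pairs[OF sigma_in_pf_perms[OF M] distinct_upt _ this t, unfolded set] t
  show "tau k M (sigma k M (2 * t - 1)) = sigma k M (2 * t)"
    "tau k M (sigma k M (2 * t)) = sigma k M (2 * t - 1)"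
    by auto
qed

lemma tau_in_fpf:
  assumes M: "M \<in> perfect_matchings (2 * k)"
  shows "tau k M \<in> fpf {1..2 * k}"
proof -
  note s = sigma_in_pf_perms[OF M]
  note tau_sigma = tau_sigma[OF M]
  have *: "tau k M (tau k M x) = x \<and> tau k M x \<noteq> x" if x: "x \<in> {1..2 * k}" for x
  proof -
    obtain m where m: "m \<in> {1..2 * k}" "x = sigma k M m"
      using permutes_image[OF pf_perms_permutes[OF s]] x by blast
    from m(1) show ?thesis
    proof (cases rule: odd_even_cases)
      case (1 t)
      then show ?thesis using tau_sigma[OF 1(1)] m(2) pf_perms_less[OF s 1(1)] by simp
    next
      case (2 t)
      then show ?thesis using tau_sigma[OF 2(1)] m(2) pf_perms_less[OF s 2(1)] by simp
    qed
  qed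
  have "foldr (\<lambda>t p. transpose (fst_pt M t) (snd_pt M t) \<circ> p) ts id permutes {1..2 * k}"
    if "set ts \<subseteq> {1..k}" for ts
    using that
  proof (induction ts)
    case (Cons t ts)
    have "fst_pt M t \<in> \<Union> M" "snd_pt M t \<in> \<Union> M" using Cons.prems fst_snd_pt(1)[OF M, of t] by auto
    then have "transpose (fst_pt M t) (snd_pt M t) permutes {1..2 * k}"
      using M by (intro permutes_swap_id) (auto simp: perfect_matchings_def partition_on_def)
    moreover have "foldr (\<lambda>t p. transpose (fst_pt M t) (snd_pt M t) \<circ> p) (t # ts) id
        = transpose (fst_pt M t) (snd_pt M t) \<circ> foldr (\<lambda>t p. transpose (fst_pt M t) (snd_pt M t) \<circ> p) ts id"
      by simp
    ultimately show ?case
      using permutes_compose[OF Cons.IH] Cons.prems by (simp only: set_simps insert_subset)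
  next
    case Nil
    show ?case using permutes_id[of "{1..2 * k}"] by (simp add: id_def)
  qed
  from this[of "[1..<k + 1]"] have perm: "tau k M permutes {1..2 * k}"
    unfolding tau_def by fastforce
  have "tau k M (tau k M x) = x" for x
    using *[of x] permutes_not_in[OF perm, of x] by (cases "x \<in> {1..2 * k}") simp_all
  then have "tau k M \<circ> tau k M = id" by (simp add: fun_eq_iff)
  then show ?thesis using perm * unfolding fpf_def by blast
qed

text \<open>From here on \<open>tau k M\<close> is the map to the partner, independently of the
  order in which the pairs are listed.\<close>

lemma perfect_matching_edge_iff:
  assumes M: "M \<in> perfect_matchings (2 * k)" and x: "x \<in> {1..2 * k}"
  shows "{x, y} \<in> M \<longleftrightarrow> tau k M x = y"
proof -
  have edge: "{x, tau k M x} \<in> M"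
  proof -
    obtain m where m: "m \<in> {1..2 * k}" "x = sigma k M m"
      using permutes_image[OF pf_perms_permutes[OF sigma_in_pf_perms[OF M]]] x by blast
    from m(1) show ?thesis
    proof (cases rule: odd_even_cases)
      case (1 t)
      then show ?thesis
        using tau_sigma[OF M 1(1)] m(2) fst_snd_pt(1)[OF M 1(1)] sigma_odd_even[OF 1(1)] by simp
    next
      case (2 t)
      then show ?thesis
        using tau_sigma[OF M 2(1)] m(2) fst_snd_pt(1)[OF M 2(1)] sigma_odd_even[OF 2(1)]
        by (simp add: insert_commute)
    qed
  qed
  moreover have "tau k M x = y" if "{x, y} \<in> M"
    using perfect_matchings_unique[OF M that edge, of x] by (auto simp: doubleton_eq_iff)
  ultimately show ?thesis by blast
qed

lemma perfect_matching_eq_tau: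
  assumes M: "M \<in> perfect_matchings (2 * k)"
  shows "M = (\<lambda>x. {x, tau k M x}) ` {1..2 * k}"
proof
  show "(\<lambda>x. {x, tau k M x}) ` {1..2 * k} \<subseteq> M"
    using perfect_matching_edge_iff[OF M] by blast
  show "M \<subseteq> (\<lambda>x. {x, tau k M x}) ` {1..2 * k}"
  proof
    fix e assume e: "e \<in> M"
    obtain i j where ij: "e = {i, j}" "i < j" "1 \<le> i" "j \<le> 2 * k"
      using perfect_matchings_edge[OF M e] by metis
    then have "i \<in> {1..2 * k}" by simp
    moreover from this have "tau k M i = j" using perfect_matching_edge_iff[OF M, of i j] e ij by simp
    ultimately show "e \<in> (\<lambda>x. {x, tau k M x}) ` {1..2 * k}" using ij(1) by blast
  qed
qed

text \<open>The inverse sends a fixed point free involution to the set of its orbits.\<close>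

lemma bij_betw_tau: "bij_betw (tau k) (perfect_matchings (2 * k)) (fpf {1..2 * k})"
proof (rule bij_betw_byWitness[where f' = "\<lambda>\<tau>. (\<lambda>x. {x, \<tau> x}) ` {1..2 * k}"])
  let ?A = "{1..2 * k}"
  show "\<forall>M\<in>perfect_matchings (2 * k). (\<lambda>x. {x, tau k M x}) ` ?A = M"
    using perfect_matching_eq_tau by blast
  show "tau k ` perfect_matchings (2 * k) \<subseteq> fpf ?A" using tau_in_fpf by blast
  have pm: "(\<lambda>x. {x, \<tau> x}) ` ?A \<in> perfect_matchings (2 * k)" if t: "\<tau> \<in> fpf ?A" for \<tau>
  proof -
    have "\<Union> ((\<lambda>x. {x, \<tau> x}) ` ?A) = ?A" using fpf_in_iff[OF t] by blast
    moreover have "disjoint ((\<lambda>x. {x, \<tau> x}) ` ?A)"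
    proof (rule disjointI)
      fix e e' assume "e \<in> (\<lambda>x. {x, \<tau> x}) ` ?A" "e' \<in> (\<lambda>x. {x, \<tau> x}) ` ?A" and neq: "e \<noteq> e'"
      then obtain x y where xy: "e = {x, \<tau> x}" "e' = {y, \<tau> y}" by blast
      have "x \<noteq> y" "x \<noteq> \<tau> y" "\<tau> x \<noteq> y" using neq fpf_involution[OF t] unfolding xy by (metis insert_commute)+
      then show "e \<inter> e' = {}" using fpf_eq_iff[OF t, of x y] unfolding xy by blast
    qed
    moreover have "card {x, \<tau> x} = 2" if "x \<in> ?A" for x
      using fpf_neq[OF t that] by simp
    ultimately show ?thesis unfolding perfect_matchings_def partition_on_def by blast
  qed
  then show "(\<lambda>\<tau>. (\<lambda>x. {x, \<tau> x}) ` ?A) ` fpf ?A \<subseteq> perfect_matchings (2 * k)" by blast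
  show "\<forall>\<tau>\<in>fpf ?A. tau k ((\<lambda>x. {x, \<tau> x}) ` ?A) = \<tau>"
  proof (intro ballI ext)
    fix \<tau> x assume t: "\<tau> \<in> fpf ?A"
    let ?M = "(\<lambda>x. {x, \<tau> x}) ` ?A"
    show "tau k ?M x = \<tau> x"
    proof (cases "x \<in> ?A")
      case True
      then have "{x, \<tau> x} \<in> ?M" by blast
      then show ?thesis using perfect_matching_edge_iff[OF pm[OF t] True] by blast
    next
      case False
      then show ?thesis
        using permutes_not_in[OF fpf_permutes[OF t] False]
          permutes_not_in[OF fpf_permutes[OF tau_in_fpf[OF pm[OF t]]] False] by simp
    qed
  qed
qed

text \<open>In an inversion \<open>(a, b)\<close> the value at \<open>a\<close> is the second point
  of a block. Exchanging it for the first point of that block, which lies below the value at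
  \<open>b\<close> and below that value's partner, gives the diagram element.\<close>

lemma perm_length_sigma:
  assumes M: "M \<in> perfect_matchings (2 * k)"
  shows "perm_length (2 * k) (sigma k M) = card (diagram {1..2 * k} (tau k M))"
proof -
  define \<pi> where "\<pi> = sigma k M"
  define \<tau> where "\<tau> = tau k M"
  let ?A = "{1..2 * k}"
  have p: "\<pi> \<in> pf_perms k" and t: "\<tau> \<in> fpf ?A"
    unfolding \<pi>_def \<tau>_def by (rule sigma_in_pf_perms[OF M], rule tau_in_fpf[OF M])
  note perm = pf_perms_permutes[OF p]
  have tp: "\<tau> (\<pi> (2 * t - 1)) = \<pi> (2 * t)" "\<tau> (\<pi> (2 * t)) = \<pi> (2 * t - 1)" if "t \<in> {1..k}" for t
    unfolding \<pi>_def \<tau>_def by (rule tau_sigma[OF M that])+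
  have block: "\<exists>u. t < u \<and> u \<le> k \<and> (q = 2 * u - 1 \<or> q = 2 * u)"
    if "2 * t < q" "q \<le> 2 * k" for t q
  proof -
    have "q \<in> ?A" using that by simp
    then show ?thesis
    proof (cases rule: odd_even_cases)
      case (1 u)
      then have "t < u" "u \<le> k" using that by auto
      then show ?thesis using 1 by blast
    next
      case (2 u)
      then have "t < u" "u \<le> k" using that by auto
      then show ?thesis using 2 by blast
    qed
  qed
  \<comment> \<open>Blocks are listed by increasing first points, so the first point of block
    \<open>t\<close> lies below both points of every later block.\<close>
  have le: "\<pi> (2 * t - 1) < \<pi> q \<and> \<pi> (2 * t - 1) < \<tau> (\<pi> q)"
    if q: "2 * t < q" "q \<le> 2 * k" "1 \<le> t" for t q
  proof -
    obtain u where u: "t < u" "u \<le> k" "q = 2 * u - 1 \<or> q = 2 * u" using block[OF q(1,2)] by metis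
    then have "\<pi> (2 * t - 1) < \<pi> (2 * u - 1)" by (intro pf_perms_mono[OF p q(3)])
    moreover have u_in: "u \<in> {1..k}" using u q(3) by simp
    moreover have "\<pi> (2 * u - 1) < \<pi> (2 * u)" by (rule pf_perms_less[OF p u_in])
    moreover have "\<pi> q \<in> {\<pi> (2 * u - 1), \<pi> (2 * u)}" "\<tau> (\<pi> q) \<in> {\<pi> (2 * u - 1), \<pi> (2 * u)}"
      using u(3) tp[OF u_in] by (metis insertI1 insertI2)+
    ultimately show ?thesis by (metis insertE less_trans singletonD)
  qed
  have "bij_betw (\<lambda>(a, b). (\<tau> (\<pi> a), \<pi> b)) (inversions (2 * k) \<pi>) (diagram ?A \<tau>)"
  proof (rule bij_betw_byWitness[where f' = "\<lambda>(i, j). (inv' \<pi> (\<tau> i), inv' \<pi> j)"])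
    show "\<forall>x\<in>inversions (2 * k) \<pi>. (\<lambda>(i, j). (inv' \<pi> (\<tau> i), inv' \<pi> j)) ((\<lambda>(a, b). (\<tau> (\<pi> a), \<pi> b)) x) = x"
      by (auto simp: fpf_involution[OF t] permutes_inverses[OF perm])
    show "\<forall>x\<in>diagram ?A \<tau>. (\<lambda>(a, b). (\<tau> (\<pi> a), \<pi> b)) ((\<lambda>(i, j). (inv' \<pi> (\<tau> i), inv' \<pi> j)) x) = x"
      by (auto simp: fpf_involution[OF t] permutes_inverses[OF perm])
    show "(\<lambda>(a, b). (\<tau> (\<pi> a), \<pi> b)) ` inversions (2 * k) \<pi> \<subseteq> diagram ?A \<tau>"
    proof (rule image_subsetI, unfold split_paired_all case_prod_conv)
      fix a b assume "(a, b) \<in> inversions (2 * k) \<pi>"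
      then have ab: "1 \<le> a" "a < b" "b \<le> 2 * k" "\<pi> b < \<pi> a" by (auto simp: inversions_def)
      then have ab_in: "a \<in> ?A" "b \<in> ?A" by auto
      from ab_in(1) show "(\<tau> (\<pi> a), \<pi> b) \<in> diagram ?A \<tau>"
      proof (cases rule: odd_even_cases)
        \<comment> \<open>An odd position holds the first point of its block, and no later value is
          smaller: no inversion starts there.\<close>
        case (1 t)
        have "\<pi> (2 * t - 1) < \<pi> b"
        proof (cases "b = 2 * t")
          case True
          then show ?thesis using pf_perms_less[OF p 1(1)] by simp
        next
          case False
          then have "2 * t < b" "1 \<le> t" using ab(1,2) 1 by auto
          then show ?thesis using le[of t b] ab(3) by blast
        qed
        then show ?thesis using ab 1 by simp
      next
        case (2 t)
        then have "2 * t < b" "1 \<le> t" using ab(2) by auto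
        then have "\<pi> (2 * t - 1) < \<pi> b" "\<pi> (2 * t - 1) < \<tau> (\<pi> b)" using le[of t b] ab(3) by blast+
        moreover have "\<tau> (\<pi> a) = \<pi> (2 * t - 1)" using tp[OF 2(1)] 2(2) by simp
        moreover have "\<tau> (\<pi> a) \<in> ?A" "\<pi> b \<in> ?A"
          unfolding fpf_in_iff[OF t] permutes_in_image[OF perm] by (rule ab_in)+
        moreover have "\<pi> b < \<tau> (\<tau> (\<pi> a))" using ab(4) unfolding fpf_involution[OF t] .
        ultimately show ?thesis by (simp add: diagram_def)
      qed
    qed
    show "(\<lambda>(i, j). (inv' \<pi> (\<tau> i), inv' \<pi> j)) ` diagram ?A \<tau> \<subseteq> inversions (2 * k) \<pi>"
    proof (rule image_subsetI, unfold split_paired_all case_prod_conv)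
      fix i j assume "(i, j) \<in> diagram ?A \<tau>"
      then have ij: "i \<in> ?A" "j \<in> ?A" "i < j" "j < \<tau> i" "i < \<tau> j" by (auto simp: diagram_def)
      have "i \<in> \<pi> ` ?A" "j \<in> \<pi> ` ?A" unfolding permutes_image[OF perm] by (rule ij)+
      then obtain a b where ab: "a \<in> ?A" "b \<in> ?A" "i = \<pi> a" "j = \<pi> b" by blast
      from ab(1) obtain t where t: "t \<in> {1..k}" "a = 2 * t - 1"
      proof (cases rule: odd_even_cases)
        case (1 t)
        then show ?thesis using that by blast
      next
        case (2 t)
        then show ?thesis using tp[OF 2(1)] pf_perms_less[OF p 2(1)] ij ab by simp
      qed
      \<comment> \<open>Otherwise the block of \<open>j\<close> is not later than block
        \<open>t\<close>, so its first point is at most \<open>i\<close>; but that point is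
        \<open>j\<close> or the partner of \<open>j\<close>, and both exceed
        \<open>i\<close>.\<close>
      have "2 * t < b"
      proof (rule ccontr)
        assume "\<not> 2 * t < b"
        from ab(2) obtain u where u: "u \<in> {1..k}" "b = 2 * u - 1 \<or> b = 2 * u"
          by (cases rule: odd_even_cases) blast+
        then have "u \<le> t" using \<open>\<not> 2 * t < b\<close> by auto
        then have "\<pi> (2 * u - 1) \<le> \<pi> (2 * t - 1)"
          using pf_perms_mono[OF p, of u t] u t by (cases "u = t") auto
        then show False using u(2) ij ab t tp[OF u(1)] by auto
      qed
      moreover have "\<tau> i = \<pi> (2 * t)" using tp[OF t(1)] ab t by simp
      ultimately show "(inv' \<pi> (\<tau> i), inv' \<pi> j) \<in> inversions (2 * k) \<pi>"
        using ij ab t(1) by (simp add: inversions_def permutes_inverses[OF perm])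
    qed
  qed
  from bij_betw_same_card[OF this] show ?thesis
    by (simp add: perm_length_eq_card_inversions \<pi>_def \<tau>_def)
qed

section \<open>The Coxeter presentation of the symmetric group\<close>

text \<open>Words are index lists, so the reduction to normal form is independent of any group. The
  surrounding words are confined to the letters \<open>1..<n\<close>, because each move must later
  become a relation between words in the generators.\<close>

inductive braid_eq :: "nat \<Rightarrow> nat list \<Rightarrow> nat list \<Rightarrow> bool" for n where
  braid_refl: "braid_eq n xs xs"
| braid_sym: "braid_eq n xs ys \<Longrightarrow> braid_eq n ys xs"
| braid_trans [trans]: "braid_eq n xs ys \<Longrightarrow> braid_eq n ys zs \<Longrightarrow> braid_eq n xs zs"
| square_move: "us \<in> lists {1..<n} \<Longrightarrow> vs \<in> lists {1..<n} \<Longrightarrow> i \<in> {1..<n}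
    \<Longrightarrow> braid_eq n (us @ [i, i] @ vs) (us @ vs)"
| braid_move: "us \<in> lists {1..<n} \<Longrightarrow> vs \<in> lists {1..<n} \<Longrightarrow> i \<in> {1..<n} \<Longrightarrow> Suc i \<in> {1..<n}
    \<Longrightarrow> braid_eq n (us @ [i, Suc i, i] @ vs) (us @ [Suc i, i, Suc i] @ vs)"
| commute_move: "us \<in> lists {1..<n} \<Longrightarrow> vs \<in> lists {1..<n} \<Longrightarrow> i \<in> {1..<n} \<Longrightarrow> j \<in> {1..<n} \<Longrightarrow> Suc i < j
    \<Longrightarrow> braid_eq n (us @ [i, j] @ vs) (us @ [j, i] @ vs)"

lemma braid_eq_context:
  assumes "braid_eq n xs ys" "us \<in> lists {1..<n}" "vs \<in> lists {1..<n}"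
  shows "braid_eq n (us @ xs @ vs) (us @ ys @ vs)"
  using assms
proof (induction rule: braid_eq.induct)
  case (square_move us' vs' i)
  then show ?case using braid_eq.square_move[of "us @ us'" n "vs' @ vs" i] by simp
next
  case (braid_move us' vs' i)
  then show ?case using braid_eq.braid_move[of "us @ us'" n "vs' @ vs" i] by simp
next
  case (commute_move us' vs' i j)
  then show ?case using braid_eq.commute_move[of "us @ us'" n "vs' @ vs" i j] by simp
qed (blast intro: braid_eq.intros)+

lemma braid_eq_commute_letter:
  assumes "w \<in> lists {1..<n}" "i \<in> {1..<n}" "\<forall>l\<in>set w. Suc i < l \<or> Suc l < i"
  shows "braid_eq n (w @ [i]) ([i] @ w)"
  using assms
proof (induction w rule: list.induct)
  case Nil
  show ?case by (simp add: braid_eq.braid_refl)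
next
  case (Cons a w)
  have "braid_eq n ([a] @ (w @ [i]) @ []) ([a] @ ([i] @ w) @ [])"
    using Cons by (intro braid_eq_context) simp_all
  moreover have "braid_eq n ([] @ [a, i] @ w) ([] @ [i, a] @ w)"
  proof -
    have facts: "[] \<in> lists {1..<n}" "w \<in> lists {1..<n}" "a \<in> {1..<n}" using Cons.prems by simp_all
    from Cons.prems(3) have "Suc i < a \<or> Suc a < i" by simp
    then show ?thesis
      using braid_eq.commute_move[OF facts(1,2,3) Cons.prems(2)]
        braid_eq.braid_sym[OF braid_eq.commute_move[OF facts(1,2) Cons.prems(2) facts(3)]] by blast
  qed
  ultimately show ?case unfolding append_Cons append_Nil append_Nil2 by (rule braid_eq.braid_trans)
qed

text \<open>Appending a letter \<open>i\<close> to the normal form \<open>u m (m-1) \<dots> j\<close> extends or shortens the descending run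
  when \<open>i = j - 1\<close> or \<open>i = j\<close>; otherwise a letter below \<open>m\<close> moves through the run into \<open>u\<close>.\<close>

lemma braid_eq_normal_form:
  assumes "xs \<in> lists {1..m}" "1 \<le> m" "m < n"
  shows "\<exists>u\<in>lists {1..<m}. \<exists>j. 1 \<le> j \<and> j \<le> Suc m \<and> braid_eq n xs (u @ rev [j..<Suc m])"
  using assms(1)
proof (induction xs rule: rev_induct)
  case Nil
  have "braid_eq n [] ([] @ rev [Suc m..<Suc m])" by (simp add: braid_eq.braid_refl)
  then show ?case using lists.Nil by (metis le_refl le_add1 plus_1_eq_Suc)
next
  case (snoc i xs)
  then obtain u j where u: "u \<in> lists {1..<m}" and j: "1 \<le> j" "j \<le> Suc m"
    and eq: "braid_eq n xs (u @ rev [j..<Suc m])" by auto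
  have i: "1 \<le> i" "i \<le> m" using snoc.prems by auto
  have i_n: "i \<in> {1..<n}" using i assms(3) by simp
  have u_n: "u \<in> lists {1..<n}" using u assms(3) by (auto simp: in_lists_conv_set)
  have run_n: "rev [a..<b] \<in> lists {1..<n}" if "1 \<le> a" "b \<le> Suc m" for a b
    using that assms(3) by (auto simp: in_lists_conv_set)
  have eq': "braid_eq n (xs @ [i]) (u @ rev [j..<Suc m] @ [i])"
    using braid_eq_context[OF eq, of "[]" "[i]"] i_n by simp
  \<comment> \<open>A letter that passes through the descending run and comes out as some
    \<open>l < m\<close> is absorbed by \<open>u\<close>.\<close>
  have prepend: ?case if "braid_eq n (rev [j..<Suc m] @ [i]) ([l] @ rev [j..<Suc m])" "1 \<le> l" "l < m" for l
  proof -
    have "braid_eq n (u @ (rev [j..<Suc m] @ [i]) @ []) (u @ ([l] @ rev [j..<Suc m]) @ [])"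
      by (rule braid_eq_context[OF that(1) u_n]) simp
    then have "braid_eq n (xs @ [i]) ((u @ [l]) @ rev [j..<Suc m])"
      using braid_eq.braid_trans[OF eq'] by simp
    moreover have "u @ [l] \<in> lists {1..<m}" using u that by simp
    ultimately show ?thesis using j by blast
  qed
  consider "i = j" | "Suc i = j" | "Suc i < j" | p where "i = Suc p" "j \<le> p"
    using i by (metis Suc_lessI Suc_less_eq less_Suc_eq_le less_imp_Suc_add linorder_neqE_nat
        add_Suc_right le_add1 less_iff_Suc_add)
  then show ?case
  proof cases
    case 1
    have "rev [j..<Suc m] = rev [Suc j..<Suc m] @ [j]"
      using 1 i upt_conv_Cons[of j "Suc m"] by (simp del: upt_Suc)
    then have "braid_eq n (u @ rev [j..<Suc m] @ [i]) ((u @ rev [Suc j..<Suc m]) @ [])"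
      using braid_eq.square_move[of "u @ rev [Suc j..<Suc m]" n "[]" i] u_n run_n[of "Suc j" "Suc m"] i_n 1
      by simp
    then have "braid_eq n (xs @ [i]) (u @ rev [Suc j..<Suc m])"
      using braid_eq.braid_trans[OF eq'] by simp
    then show ?thesis using u 1 i by (metis Suc_le_mono le_Suc_eq)
  next
    case 2
    have "rev [i..<Suc m] = rev [j..<Suc m] @ [i]"
      using 2 i upt_conv_Cons[of i "Suc m"] by (simp del: upt_Suc)
    then have "braid_eq n (xs @ [i]) (u @ rev [i..<Suc m])" using eq' by simp
    then show ?thesis using u i by (metis le_SucI)
  next
    case 3
    have "braid_eq n (rev [j..<Suc m] @ [i]) ([i] @ rev [j..<Suc m])"
      using 3 j by (intro braid_eq_commute_letter run_n i_n) auto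
    then show ?thesis using prepend 3 j i by simp
  next
    \<comment> \<open>Here the run contains \<open>i\<close> followed by \<open>p = i - 1\<close>.
      The appended \<open>i\<close> moves left past the letters below \<open>p\<close>, the braid
      relation turns \<open>i p i\<close> into \<open>p i p\<close>, and the leading
      \<open>p\<close> moves left past the letters above \<open>i\<close>.\<close>
    case (4 p)
    have split: "rev [j..<Suc m] = rev [Suc i..<Suc m] @ [i, p] @ rev [j..<p]"
    proof -
      have "[j..<Suc m] = [j..<p] @ [p..<Suc m]"
        using upt_add_eq_append[of j p "Suc m - p"] 4 i by (simp del: upt_Suc)
      moreover have "[p..<Suc m] = p # i # [Suc i..<Suc m]"
        using 4 i upt_conv_Cons[of p "Suc m"] upt_conv_Cons[of "Suc p" "Suc m"] by (simp del: upt_Suc)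
      ultimately show ?thesis by (simp del: upt_Suc)
    qed
    let ?a = "rev [Suc i..<Suc m]" and ?b = "rev [j..<p]"
    have ab: "?a \<in> lists {1..<n}" "?b \<in> lists {1..<n}" and p: "p \<in> {1..<n}" "Suc p \<in> {1..<n}"
      using run_n[of "Suc i" "Suc m"] run_n[of j p] 4 i j i_n by auto
    have "braid_eq n ((?a @ [i, p]) @ (?b @ [i]) @ []) ((?a @ [i, p]) @ ([i] @ ?b) @ [])"
      using ab p i_n 4(1) by (intro braid_eq_context braid_eq_commute_letter) auto
    also have "braid_eq n \<dots> (?a @ [p, i, p] @ ?b)"
      using braid_eq.braid_sym[OF braid_eq.braid_move[OF ab p]] 4(1) by simp
    also have "?a @ [p, i, p] @ ?b = [] @ (?a @ [p]) @ ([i, p] @ ?b)" by simp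
    also have "braid_eq n \<dots> ([] @ ([p] @ ?a) @ ([i, p] @ ?b))"
      using ab p i_n 4(1) by (intro braid_eq_context braid_eq_commute_letter) auto
    finally have "braid_eq n (rev [j..<Suc m] @ [i]) ([p] @ rev [j..<Suc m])"
      unfolding split by simp
    then show ?thesis using prepend 4 j i by simp
  qed
qed

section \<open>The permutation of a word, and words that act trivially\<close>

definition word_perm :: "nat list \<Rightarrow> nat \<Rightarrow> nat" where
  "word_perm xs x = foldr adj xs x"

lemma word_perm_simps [simp]:
  "word_perm [] x = x" "word_perm (i # xs) x = adj i (word_perm xs x)"
  "word_perm (xs @ ys) x = word_perm xs (word_perm ys x)"
  by (simp_all add: word_perm_def)

lemma adj_braid: "adj i (adj (Suc i) (adj i x)) = adj (Suc i) (adj i (adj (Suc i) x))"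
  unfolding transpose_def by auto

lemma adj_commute: "Suc i < j \<Longrightarrow> adj i (adj j x) = adj j (adj i x)"
  unfolding transpose_def by auto

lemma braid_eq_word_perm: "braid_eq n xs ys \<Longrightarrow> word_perm xs x = word_perm ys x"
proof (induction arbitrary: x rule: braid_eq.induct)
  case (commute_move us vs i j)
  then show ?case by (simp only: word_perm_simps adj_commute[OF commute_move(5)])
qed (simp_all add: adj_braid)

text \<open>The letters act from the right, so \<open>j\<close>, \<open>j + 1\<close>, ...,
  \<open>m\<close> carry the point \<open>j\<close> upwards one step at a time.\<close>

lemma word_perm_run: "j \<le> Suc m \<Longrightarrow> word_perm (rev [j..<Suc m]) j = Suc m"
proof (induction m)
  case 0
  then show ?case by (cases j) auto
next
  case (Suc m)
  then show ?case by (cases "j = Suc (Suc m)") auto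
qed

lemma word_perm_fix: "u \<in> lists {1..<m} \<Longrightarrow> m < x \<Longrightarrow> word_perm u x = x"
  by (induction u) (auto simp: transpose_def)

text \<open>In the normal form the run sends \<open>j\<close> to the point just above the largest
  letter, and \<open>u\<close> fixes that point. For the identity this forces \<open>j\<close> to
  equal it, so the run is empty and the largest letter has disappeared.\<close>

lemma word_perm_id_imp_braid_eq_Nil:
  assumes "xs \<in> lists {1..m}" "m < n" "\<And>x. word_perm xs x = x"
  shows "braid_eq n xs []"
  using assms
proof (induction m arbitrary: xs)
  case 0
  then show ?case by (cases xs) (auto intro: braid_eq.braid_refl)
next
  case (Suc m)
  obtain u j where u: "u \<in> lists {1..<Suc m}" and j: "1 \<le> j" "j \<le> Suc (Suc m)"
    and eq: "braid_eq n xs (u @ rev [j..<Suc (Suc m)])"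
    using braid_eq_normal_form[OF Suc.prems(1) _ Suc.prems(2)] by auto
  have id: "word_perm (u @ rev [j..<Suc (Suc m)]) x = x" for x
    using braid_eq_word_perm[OF eq] Suc.prems(3) by metis
  have "word_perm u (Suc (Suc m)) = j"
    using id[of j] unfolding word_perm_simps word_perm_run[OF j(2)] .
  then have "j = Suc (Suc m)" using word_perm_fix[OF u, of "Suc (Suc m)"] by simp
  then have "u @ rev [j..<Suc (Suc m)] = u" by simp
  then have "braid_eq n xs u" "\<And>x. word_perm u x = x" using eq id by simp_all
  moreover have "u \<in> lists {1..m}" using u by (auto simp: in_lists_conv_set)
  ultimately show ?case using Suc.IH Suc.prems(2) braid_eq.braid_trans by (metis Suc_lessD)
qed

lemma generate_adj: "generate (sym_group n) (adj ` {1..<n}) = carrier (sym_group n)"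
proof
  interpret group "sym_group n" by (rule sym_group_is_group)
  have sub: "adj ` {1..<n} \<subseteq> carrier (sym_group n)"
    using permutes_adj by (auto simp: sym_group_carrier)
  then show "generate (sym_group n) (adj ` {1..<n}) \<subseteq> carrier (sym_group n)" by (rule generate_incl)
  show "carrier (sym_group n) \<subseteq> generate (sym_group n) (adj ` {1..<n})"
  proof
    fix p assume "p \<in> carrier (sym_group n)"
    then have "p permutes {1..n}" by (simp only: sym_group_carrier)
    then show "p \<in> generate (sym_group n) (adj ` {1..<n})"
    proof (induction rule: perm_adj_induct)
      case id
      show ?case using generate.one[of "sym_group n"] by (simp only: sym_group_one)
    next
      case (adj p i)
      then have "adj i \<in> adj ` {1..<n}" by simp
      from generate.eng[OF adj(5) generate.incl[OF this]] show ?case by (simp only: sym_group_mult)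
    qed
  qed
qed

text \<open>Products of two different adjacent transpositions have order 2 or 3; primality reduces
  the computation to one power and nontriviality.\<close>

lemma (in group) ord_eq_prime:
  assumes "x \<in> carrier G" "x \<noteq> \<one>" "Factorial_Ring.prime d" "x [^] (d::nat) = \<one>"
  shows "ord x = d"
proof -
  have "ord x dvd d" using assms pow_eq_id by blast
  moreover have "ord x \<noteq> 1" using assms ord_eq_1 by blast
  ultimately show ?thesis using assms(3) by (metis prime_nat_iff)
qed

text \<open>A word with trivial product corresponds to an index word acting trivially, hence
  equivalent to the empty word by braid moves. It remains to derive each move from insertions and
  deletions of relators.\<close>

lemma coxeter_system_iso_sym_group:
  assumes G: "group G" and iso: "\<phi> \<in> iso (sym_group n) G"
  shows "coxeter_system G ((\<lambda>i. \<phi> (adj i)) ` {1..<n})"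
proof -
  interpret G: group G by (rule G)
  interpret S: group "sym_group n" by (rule sym_group_is_group)
  interpret \<phi>: group_hom "sym_group n" G \<phi>
    using iso by (intro group_hom.intro G S.is_group) (simp add: group_hom_axioms_def iso_def)
  let ?s = "\<lambda>i. \<phi> (adj i)"
  let ?S = "?s ` {1..<n}"
  have adj_in: "adj i \<in> carrier (sym_group n)" if "i \<in> {1..<n}" for i
    using that permutes_adj by (simp add: sym_group_carrier)
  have inj: "\<phi> p = \<phi> q \<longleftrightarrow> p = q" if "p \<in> carrier (sym_group n)" "q \<in> carrier (sym_group n)" for p q
    using iso that by (auto simp: iso_def bij_betw_def inj_on_def)
  have one: "\<phi> id = \<one>\<^bsub>G\<^esub>" using \<phi>.hom_one by (simp only: sym_group_one)
  have mult: "\<phi> p \<otimes>\<^bsub>G\<^esub> \<phi> q = \<phi> (p \<circ> q)"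
    if "p \<in> carrier (sym_group n)" "q \<in> carrier (sym_group n)" for p q
    using \<phi>.hom_mult[OF that] by (simp only: sym_group_mult)
  have mult_in: "p \<circ> q \<in> carrier (sym_group n)"
    if "p \<in> carrier (sym_group n)" "q \<in> carrier (sym_group n)" for p q
    using S.m_closed[OF that] by (simp only: sym_group_mult)
  have id_in: "id \<in> carrier (sym_group n)" using S.one_closed by (simp only: sym_group_one)
  have S_sub: "?S \<subseteq> carrier G" using adj_in by auto
  have sq: "?s i \<otimes>\<^bsub>G\<^esub> ?s i = \<one>\<^bsub>G\<^esub>" if "i \<in> {1..<n}" for i
    using mult[OF adj_in[OF that] adj_in[OF that]] one by simp
  have neq: "?s i \<noteq> \<one>\<^bsub>G\<^esub>" if "i \<in> {1..<n}" for i
  proof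
    assume "?s i = \<one>\<^bsub>G\<^esub>"
    then have "adj i = id" using inj[OF adj_in[OF that] id_in] one by simp
    then have "adj i i = i" by simp
    then show False by simp
  qed
  have gen: "generate G ?S = carrier G"
  proof -
    have "generate G (\<phi> ` adj ` {1..<n}) = \<phi> ` generate (sym_group n) (adj ` {1..<n})"
      using adj_in by (intro \<phi>.generate_img) auto
    then show ?thesis using iso unfolding generate_adj image_image by (simp add: iso_def bij_betw_def)
  qed
  have ord_adj: "G.ord (?s i \<otimes>\<^bsub>G\<^esub> ?s j) = d"
    if ij: "i \<in> {1..<n}" "j \<in> {1..<n}" and d: "Factorial_Ring.prime d"
      and pow: "((adj i \<circ> adj j) ^^ d) = id" and ne: "(adj i \<circ> adj j) \<noteq> id" for i j d
  proof (rule G.ord_eq_prime)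
    have in_c: "adj i \<circ> adj j \<in> carrier (sym_group n)" by (intro mult_in adj_in ij)
    have eq: "?s i \<otimes>\<^bsub>G\<^esub> ?s j = \<phi> (adj i \<circ> adj j)" by (intro mult adj_in ij)
    show "?s i \<otimes>\<^bsub>G\<^esub> ?s j \<in> carrier G" unfolding eq using in_c by simp
    show "?s i \<otimes>\<^bsub>G\<^esub> ?s j \<noteq> \<one>\<^bsub>G\<^esub>" unfolding eq one[symmetric] inj[OF in_c id_in] by (rule ne)
    have "(?s i \<otimes>\<^bsub>G\<^esub> ?s j) [^]\<^bsub>G\<^esub> m = \<phi> ((adj i \<circ> adj j) ^^ m) \<and>
        (adj i \<circ> adj j) ^^ m \<in> carrier (sym_group n)" for m :: nat
    proof (induction m)
      case 0
      show ?case using one id_in by (simp only: funpow.simps(1) G.nat_pow_0 simp_thms)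
    next
      case (Suc m)
      then show ?case unfolding funpow_Suc_right eq G.nat_pow_Suc
        using mult[OF _ in_c] mult_in[OF _ in_c] by metis
    qed
    then show "(?s i \<otimes>\<^bsub>G\<^esub> ?s j) [^]\<^bsub>G\<^esub> d = \<one>\<^bsub>G\<^esub>" using pow one by metis
  qed (rule d)
  have ord1: "G.ord (?s i \<otimes>\<^bsub>G\<^esub> ?s i) = 1" if "i \<in> {1..<n}" for i
    unfolding sq[OF that] by simp
  have ord2: "G.ord (?s i \<otimes>\<^bsub>G\<^esub> ?s j) = 2" if "i \<in> {1..<n}" "j \<in> {1..<n}" "Suc i < j" for i j
  proof (rule ord_adj[OF that(1,2)])
    show "(adj i \<circ> adj j) ^^ 2 = id"
      using adj_commute[OF that(3)] by (simp add: fun_eq_iff numeral_2_eq_2)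
    have "(adj i \<circ> adj j) i \<noteq> i" using that(3) by simp
    then show "adj i \<circ> adj j \<noteq> id" by (metis id_apply)
  qed simp
  have ord3: "G.ord (?s i \<otimes>\<^bsub>G\<^esub> ?s (Suc i)) = 3" if "i \<in> {1..<n}" "Suc i \<in> {1..<n}" for i
  proof (rule ord_adj[OF that])
    have "adj i (adj (Suc i) (adj i (adj (Suc i) (adj i (adj (Suc i) x))))) = x" for x
      using adj_braid[of i "adj (Suc i) (adj i (adj (Suc i) x))"] by simp
    then show "(adj i \<circ> adj (Suc i)) ^^ 3 = id"
      by (simp add: fun_eq_iff numeral_3_eq_3)
    have "(adj i \<circ> adj (Suc i)) i \<noteq> i" by simp
    then show "adj i \<circ> adj (Suc i) \<noteq> id" by (metis id_apply)
  qed simp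
  let ?R = "equivclp (coxeter_step G ?S)"
  have relator: "?R (us @ concat (replicate (G.ord (s \<otimes>\<^bsub>G\<^esub> t)) [s, t]) @ vs) (us @ vs)"
    if "us \<in> lists ?S" "vs \<in> lists ?S" "s \<in> ?S" "t \<in> ?S" for us vs s t
    using that unfolding coxeter_step_def by (intro r_into_equivclp) blast
  \<comment> \<open>For equal generators the product has order 1, so the relator is the
    square.\<close>
  have cancel: "?R (us @ [s, s] @ vs) (us @ vs)"
    if "us \<in> lists ?S" "vs \<in> lists ?S" "s \<in> ?S" for us vs s
  proof -
    have "G.ord (s \<otimes>\<^bsub>G\<^esub> s) = 1" using that(3) ord1 by auto
    then show ?thesis using relator[OF that(1,2,3,3)] by simp
  qed
  have braid_R: "?R (map ?s xs) (map ?s ys)" if "braid_eq n xs ys" for xs ys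
    using that
  proof (induction rule: braid_eq.induct)
    case (braid_refl xs)
    show ?case by (rule equivclp_refl)
  next
    case (braid_sym xs ys)
    from braid_sym.IH show ?case by (rule equivclp_sym)
  next
    case (braid_trans xs ys zs)
    from braid_trans.IH show ?case by (rule equivclp_trans)
  next
    case (square_move us vs i)
    then show ?case using cancel[of "map ?s us" "map ?s vs" "?s i"] by (auto simp: in_lists_conv_set)
  next
    case (braid_move us vs i)
    define s t where "s = ?s i" and "t = ?s (Suc i)"
    define us' vs' where "us' = map ?s us" and "vs' = map ?s vs"
    have st: "s \<in> ?S" "t \<in> ?S" using braid_move unfolding s_def t_def by blast+
    have w: "us' \<in> lists ?S" "vs' \<in> lists ?S"
      using braid_move unfolding us'_def vs'_def by (auto simp: in_lists_conv_set)
    have ord: "G.ord (s \<otimes>\<^bsub>G\<^esub> t) = 3" unfolding s_def t_def using braid_move by (intro ord3)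
    \<comment> \<open>The word \<open>tst\<close> is preceded by the relator \<open>ststst\<close>;
      cancelling squares from the junction outwards then leaves \<open>sts\<close>.\<close>
    have h1: "?R (us' @ [s, t, s, t, s, t] @ [t, s, t] @ vs') (us' @ [t, s, t] @ vs')"
      using relator[of us' "[t, s, t] @ vs'" s t] w st by (simp add: ord numeral_3_eq_3)
    have h2: "?R (us' @ [s, t, s, t, s, t] @ [t, s, t] @ vs') (us' @ [s, t, s, t, s, s, t] @ vs')"
      using cancel[of "us' @ [s, t, s, t, s]" "[s, t] @ vs'" t] w st by simp
    have h3: "?R (us' @ [s, t, s, t, s, s, t] @ vs') (us' @ [s, t, s, t, t] @ vs')"
      using cancel[of "us' @ [s, t, s, t]" "[t] @ vs'" s] w st by simp
    have h4: "?R (us' @ [s, t, s, t, t] @ vs') (us' @ [s, t, s] @ vs')"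
      using cancel[of "us' @ [s, t, s]" "vs'" t] w st by simp
    have "?R (us' @ [s, t, s] @ vs') (us' @ [t, s, t] @ vs')"
      by (rule equivclp_trans[OF equivclp_sym[OF equivclp_trans[OF h2 equivclp_trans[OF h3 h4]]] h1])
    then show ?case by (simp add: s_def t_def us'_def vs'_def)
  next
    case (commute_move us vs i j)
    define s t where "s = ?s i" and "t = ?s j"
    define us' vs' where "us' = map ?s us" and "vs' = map ?s vs"
    have st: "s \<in> ?S" "t \<in> ?S" using commute_move unfolding s_def t_def by blast+
    have w: "us' \<in> lists ?S" "vs' \<in> lists ?S"
      using commute_move unfolding us'_def vs'_def by (auto simp: in_lists_conv_set)
    have ord: "G.ord (s \<otimes>\<^bsub>G\<^esub> t) = 2" unfolding s_def t_def using commute_move by (intro ord2)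
    \<comment> \<open>The same device with the relator \<open>stst\<close> in front of
      \<open>ts\<close>.\<close>
    have h1: "?R (us' @ [s, t, s, t] @ [t, s] @ vs') (us' @ [t, s] @ vs')"
      using relator[of us' "[t, s] @ vs'" s t] w st by (simp add: ord numeral_2_eq_2)
    have h2: "?R (us' @ [s, t, s, t] @ [t, s] @ vs') (us' @ [s, t, s, s] @ vs')"
      using cancel[of "us' @ [s, t, s]" "[s] @ vs'" t] w st by simp
    have h3: "?R (us' @ [s, t, s, s] @ vs') (us' @ [s, t] @ vs')"
      using cancel[of "us' @ [s, t]" "vs'" s] w st by simp
    have "?R (us' @ [s, t] @ vs') (us' @ [t, s] @ vs')"
      by (rule equivclp_trans[OF equivclp_sym[OF equivclp_trans[OF h2 h3]] h1])
    then show ?case by (simp add: s_def t_def us'_def vs'_def)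
  qed
  have word: "foldr (\<lambda>x y. x \<otimes>\<^bsub>G\<^esub> y) (map ?s xs) \<one>\<^bsub>G\<^esub> = \<phi> (word_perm xs) \<and>
      word_perm xs \<in> carrier (sym_group n)" if "xs \<in> lists {1..<n}" for xs
    using that
  proof (induction xs rule: list.induct)
    case Nil
    have "word_perm [] = id" by (simp add: fun_eq_iff)
    moreover have "foldr (\<lambda>x y. x \<otimes>\<^bsub>G\<^esub> y) (map ?s []) \<one>\<^bsub>G\<^esub> = \<one>\<^bsub>G\<^esub>" by simp
    ultimately show ?case using one id_in by metis
  next
    case (Cons i xs)
    then have IH: "foldr (\<lambda>x y. x \<otimes>\<^bsub>G\<^esub> y) (map ?s xs) \<one>\<^bsub>G\<^esub> = \<phi> (word_perm xs)"
      "word_perm xs \<in> carrier (sym_group n)" and i: "i \<in> {1..<n}" by simp_all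
    have "word_perm (i # xs) = adj i \<circ> word_perm xs" by (simp add: fun_eq_iff)
    moreover have "foldr (\<lambda>x y. x \<otimes>\<^bsub>G\<^esub> y) (map ?s (i # xs)) \<one>\<^bsub>G\<^esub>
        = ?s i \<otimes>\<^bsub>G\<^esub> foldr (\<lambda>x y. x \<otimes>\<^bsub>G\<^esub> y) (map ?s xs) \<one>\<^bsub>G\<^esub>" by simp
    ultimately show ?case
      using IH mult[OF adj_in[OF i] IH(2)] mult_in[OF adj_in[OF i] IH(2)] by metis
  qed
  have presentation: "?R ws []"
    if ws: "ws \<in> lists ?S" and prod: "foldr (\<lambda>x y. x \<otimes>\<^bsub>G\<^esub> y) ws \<one>\<^bsub>G\<^esub> = \<one>\<^bsub>G\<^esub>" for ws
  proof -
    obtain xs where xs: "xs \<in> lists {1..<n}" "ws = map ?s xs"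
      using ws unfolding lists_image by blast
    have "word_perm xs = id"
      using word[OF xs(1)] prod xs(2) one inj[OF _ id_in] by metis
    moreover have "xs \<in> lists {1..n - 1}" using xs(1) by (auto simp: in_lists_conv_set)
    \<comment> \<open>For \<open>n = 0\<close> truncated subtraction makes \<open>n - 1 < n\<close>
      false, but then there are no letters at all.\<close>
    moreover have "xs = [] \<or> n - 1 < n" using xs(1) by (cases xs) auto
    ultimately have "braid_eq n xs []"
      using word_perm_id_imp_braid_eq_Nil[of xs "n - 1" n] braid_eq.braid_refl[of n] by auto
    from braid_R[OF this] show ?thesis using xs(2) by simp
  qed
  show ?thesis
    unfolding coxeter_system_def
  proof (intro conjI ballI impI)
    show "group G" by (rule G)
    show "?S \<subseteq> carrier G" by (rule S_sub)
    show "generate G ?S = carrier G" by (rule gen)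
  next
    fix s assume "s \<in> ?S"
    then obtain i where i: "i \<in> {1..<n}" "s = ?s i" by blast
    show "s \<noteq> \<one>\<^bsub>G\<^esub>" "s \<otimes>\<^bsub>G\<^esub> s = \<one>\<^bsub>G\<^esub>" unfolding i(2) by (rule neq[OF i(1)], rule sq[OF i(1)])
  next
    fix ws assume "ws \<in> lists ?S" "foldr (\<lambda>x y. x \<otimes>\<^bsub>G\<^esub> y) ws \<one>\<^bsub>G\<^esub> = \<one>\<^bsub>G\<^esub>"
    then show "?R ws []" by (rule presentation)
  qed
qed

section \<open>The parabolic subgroup as a symmetric group\<close>

text \<open>Composition with the inverse makes this a left action, sending \<open>eps x\<close> to
  \<open>eps (p x)\<close>. The restriction provides the extensionality that elements of
  \<open>BijGroup\<close> carry.\<close>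

definition perm_map :: "nat \<Rightarrow> (nat \<Rightarrow> nat) \<Rightarrow> (nat \<Rightarrow> real) \<Rightarrow> (nat \<Rightarrow> real)" where
  "perm_map n p = (\<lambda>v\<in>rvecs n. v \<circ> inv' p)"

lemma perm_map_apply: "v \<in> rvecs n \<Longrightarrow> perm_map n p v = v \<circ> inv' p"
  by (simp add: perm_map_def)

lemma comp_permutes_rvecs: "v \<in> rvecs n \<Longrightarrow> p permutes {1..n} \<Longrightarrow> v \<circ> p \<in> rvecs n"
  by (simp add: rvecs_def permutes_not_in)

lemma perm_map_rvecs: "v \<in> rvecs n \<Longrightarrow> p permutes {1..n} \<Longrightarrow> perm_map n p v \<in> rvecs n"
  by (simp only: perm_map_apply comp_permutes_rvecs permutes_inv)

lemma perm_map_comp: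
  assumes p: "p permutes {1..n}" and q: "q permutes {1..n}" and v: "v \<in> rvecs n"
  shows "perm_map n (p \<circ> q) v = perm_map n p (perm_map n q v)"
  unfolding perm_map_apply[OF v] perm_map_apply[OF comp_permutes_rvecs[OF v permutes_inv[OF q]]]
    o_inv_distrib[OF permutes_bij[OF p] permutes_bij[OF q]] comp_assoc ..

lemma perm_map_Bij:
  assumes p: "p permutes {1..n}"
  shows "perm_map n p \<in> Bij (rvecs n)"
proof -
  have "bij_betw (perm_map n p) (rvecs n) (rvecs n)"
  proof (rule bij_betw_byWitness[where f' = "perm_map n (inv' p)"])
    show "\<forall>v\<in>rvecs n. perm_map n (inv' p) (perm_map n p v) = v"
      "\<forall>v\<in>rvecs n. perm_map n p (perm_map n (inv' p) v) = v"
      using p permutes_inv[OF p]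
      by (simp_all add: perm_map_comp[symmetric] permutes_inv_o[OF p])
         (simp_all add: perm_map_apply)
    show "perm_map n p ` rvecs n \<subseteq> rvecs n" "perm_map n (inv' p) ` rvecs n \<subseteq> rvecs n"
      using perm_map_rvecs[OF _ p] perm_map_rvecs[OF _ permutes_inv[OF p]] by blast+
  qed
  then show ?thesis by (simp add: Bij_def perm_map_def)
qed

lemma perm_map_mult:
  assumes "p permutes {1..n}" "q permutes {1..n}"
  shows "perm_map n p \<otimes>\<^bsub>BijGroup (rvecs n)\<^esub> perm_map n q = perm_map n (p \<circ> q)"
proof
  fix v
  have "(perm_map n p \<otimes>\<^bsub>BijGroup (rvecs n)\<^esub> perm_map n q) v
      = compose (rvecs n) (perm_map n p) (perm_map n q) v"
    using perm_map_Bij assms by (simp add: BijGroup_def)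
  also have "\<dots> = perm_map n (p \<circ> q) v"
    using perm_map_comp[OF assms, of v] by (cases "v \<in> rvecs n") (simp_all add: compose_def perm_map_def)
  finally show "(perm_map n p \<otimes>\<^bsub>BijGroup (rvecs n)\<^esub> perm_map n q) v = perm_map n (p \<circ> q) v" .
qed

lemma perm_map_hom: "perm_map n \<in> hom (sym_group n) (BijGroup (rvecs n))"
proof (rule homI)
  fix p q assume "p \<in> carrier (sym_group n)" "q \<in> carrier (sym_group n)"
  then have "p permutes {1..n}" "q permutes {1..n}" by (simp_all only: sym_group_carrier)
  then show "perm_map n (p \<otimes>\<^bsub>sym_group n\<^esub> q) = perm_map n p \<otimes>\<^bsub>BijGroup (rvecs n)\<^esub> perm_map n q"
    by (simp only: sym_group_mult perm_map_mult)
next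
  fix p assume "p \<in> carrier (sym_group n)"
  then show "perm_map n p \<in> carrier (BijGroup (rvecs n))"
    using perm_map_Bij by (simp add: sym_group_carrier BijGroup_def)
qed

lemma eps_in_rvecs: "x \<in> {1..n} \<Longrightarrow> eps x \<in> rvecs n"
  by (auto simp: rvecs_def eps_def)

lemma eps_eq_iff [simp]: "eps x = eps y \<longleftrightarrow> x = y"
  by (metis eps_def zero_neq_one)

lemma eps_comp_inv: "p permutes {1..n} \<Longrightarrow> eps x \<circ> inv' p = eps (p x)"
  by (auto simp: fun_eq_iff eps_def permutes_inverses dest: permutes_inv_eq)

lemma perm_map_inj: "inj_on (perm_map n) {p. p permutes {1..n}}"
proof (rule inj_onI)
  fix p q assume "p \<in> {p. p permutes {1..n}}" "q \<in> {p. p permutes {1..n}}" and eq: "perm_map n p = perm_map n q"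
  then have p: "p permutes {1..n}" and q: "q permutes {1..n}" by simp_all
  show "p = q"
  proof
    fix x
    show "p x = q x"
    proof (cases "x \<in> {1..n}")
      case True
      have "perm_map n p (eps x) = perm_map n q (eps x)" using eq by simp
      then show ?thesis
        unfolding perm_map_apply[OF eps_in_rvecs[OF True]] eps_comp_inv[OF p] eps_comp_inv[OF q] by simp
    next
      case False
      then show ?thesis using permutes_not_in[OF p False] permutes_not_in[OF q False] by simp
    qed
  qed
qed

lemma dotp_eps_diff: "1 \<le> i \<Longrightarrow> i < n \<Longrightarrow> dotp n (eps i - eps (Suc i)) v = v i - v (Suc i)"
  by (simp add: dotp_def eps_def left_diff_distrib sum_subtractf if_distrib[of "\<lambda>x. x * _"] cong: if_cong)

lemma simple_refl_eq_perm_map: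
  assumes i: "1 \<le> i" "i < n"
  shows "simple_refl n i = perm_map n (adj i)"
proof
  fix v
  show "simple_refl n i v = perm_map n (adj i) v"
  proof (cases "v \<in> rvecs n")
    case True
    have "(v - (\<lambda>m. (v i - v (Suc i)) * (eps i - eps (Suc i)) m)) m = v (adj i m)" for m
      by (auto simp: eps_def transpose_def)
    then show ?thesis
      using i True by (simp add: simple_refl_def simple_root_def root_refl_def dotp_eps_diff perm_map_def fun_eq_iff)
  next
    case False
    then show ?thesis by (simp add: simple_refl_def root_refl_def perm_map_def)
  qed
qed

text \<open>The last simple reflection sends \<open>eps n\<close> to \<open>- eps (n - 1)\<close>,
  whereas a coordinate permutation creates no negative entry. Hence removing this map from the
  generating set removes none of the adjacent transpositions.\<close>

lemma simple_refl_last_neq: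
  assumes n: "2 \<le> n" and p: "p permutes {1..n}"
  shows "simple_refl n n \<noteq> perm_map n p"
proof
  assume eq: "simple_refl n n = perm_map n p"
  have v: "eps n \<in> rvecs n" using n by (intro eps_in_rvecs) simp
  have "dotp n (eps (n - 1) + eps n) (eps n) = 1"
    using n by (simp add: dotp_def eps_def distrib_right sum.distrib if_distrib[of "\<lambda>x. x * _"] cong: if_cong)
  then have "simple_refl n n (eps n) (n - 1) = - 1"
    using n v by (simp add: simple_refl_def simple_root_def root_refl_def eps_def)
  moreover have "perm_map n p (eps n) (n - 1) \<ge> 0"
    unfolding perm_map_apply[OF v] by (simp add: eps_def)
  ultimately show False unfolding eq by simp
qed

lemma simple_refls_minus_last:
  assumes "2 \<le> n"
  shows "simple_refls n - {simple_refl n n} = perm_map n ` adj ` {1..<n}"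
proof -
  have "{1..n} = insert n {1..<n}" using assms by auto
  then have "simple_refls n = insert (simple_refl n n) (perm_map n ` adj ` {1..<n})"
    unfolding simple_refls_def by (simp add: image_image simple_refl_eq_perm_map)
  moreover have "simple_refl n n \<notin> perm_map n ` adj ` {1..<n}"
  proof
    assume "simple_refl n n \<in> perm_map n ` adj ` {1..<n}"
    then obtain i where "1 \<le> i" "i < n" "simple_refl n n = perm_map n (adj i)" by auto
    then show False using simple_refl_last_neq[OF assms permutes_adj[of i n]] by simp
  qed
  ultimately show ?thesis by blast
qed

text \<open>\<open>subgroup_generated\<close> occurs twice and intersects its generators with the
  carrier. So the generated group is first computed among all bijections, which puts
  \<open>I\<close> inside the Weyl group, and then again within the Weyl group.\<close>

lemma perm_map_iso_parabolic:
  assumes n: "2 \<le> n" and I: "I = simple_refls n - {simple_refl n n}"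
  shows "perm_map n \<in> iso (sym_group n) (parabolic n I)"
proof -
  let ?B = "BijGroup (rvecs n)" and ?C = "carrier (sym_group n)"
  interpret B: group ?B by (rule group_BijGroup)
  interpret S: group "sym_group n" by (rule sym_group_is_group)
  interpret hB: group_hom "sym_group n" ?B "perm_map n"
    by (intro group_hom.intro B.is_group S.is_group) (simp add: group_hom_axioms_def perm_map_hom)
  interpret W: group "weyl n" unfolding weyl_def by (rule B.group_subgroup_generated)
  have I_eq: "I = perm_map n ` adj ` {1..<n}" unfolding I by (rule simple_refls_minus_last[OF n])
  have adj_sub: "adj ` {1..<n} \<subseteq> ?C" using permutes_adj by (auto simp: sym_group_carrier)
  have I_sub: "I \<subseteq> carrier ?B \<inter> simple_refls n"
    using hB.hom_closed adj_sub I unfolding I_eq by blast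
  have "perm_map n ` ?C = generate ?B I"
    using hB.generate_img[OF adj_sub] unfolding generate_adj I_eq by simp
  also have "\<dots> \<subseteq> carrier (weyl n)"
    unfolding weyl_def carrier_subgroup_generated by (rule B.mono_generate[OF I_sub])
  finally have img: "perm_map n ` ?C \<subseteq> carrier (weyl n)" .
  interpret hW: group_hom "sym_group n" "weyl n" "perm_map n"
    using img perm_map_hom[of n]
    by (intro group_hom.intro W.is_group S.is_group) (auto simp: group_hom_axioms_def hom_def weyl_def)
  have "I \<subseteq> carrier (weyl n)" using img adj_sub unfolding I_eq by blast
  then have "carrier (parabolic n I) = generate (weyl n) I"
    unfolding parabolic_def carrier_subgroup_generated by (simp add: Int_absorb1)
  then have carrier: "carrier (parabolic n I) = perm_map n ` ?C"
    using hW.generate_img[OF adj_sub] unfolding generate_adj I_eq by simp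
  have "perm_map n \<in> hom (sym_group n) (parabolic n I)"
    using perm_map_hom[of n] carrier by (auto simp: hom_def parabolic_def weyl_def)
  then show ?thesis
    using carrier perm_map_inj[of n] by (simp add: iso_def bij_betw_def sym_group_def)
qed

section \<open>Maximal orthogonal sets of roots as matchings\<close>

text \<open>The indicator vector of the edge \<open>{i, j}\<close> is the root \<open>\<epsilon>\<^sub>i + \<epsilon>\<^sub>j\<close>.\<close>

definition edge_root :: "nat set \<Rightarrow> nat \<Rightarrow> real" where
  "edge_root e = (\<lambda>m. if m \<in> e then 1 else 0)"

definition edges :: "nat \<Rightarrow> nat set set" where
  "edges n = {e. e \<subseteq> {1..n} \<and> card e = 2}"

lemma sum_root_eq_edge_root: "i \<noteq> j \<Longrightarrow> sum_root i j = edge_root {i, j}"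
  by (auto simp: sum_root_def edge_root_def eps_def fun_eq_iff)

lemma edge_root_eq_iff [simp]: "edge_root e = edge_root f \<longleftrightarrow> e = f"
  by (auto simp: edge_root_def fun_eq_iff split: if_splits)

lemma edges_cases:
  assumes "e \<in> edges n"
  obtains i j where "e = {i, j}" "1 \<le> i" "i < j" "j \<le> n"
proof -
  have "card e = 2" "e \<subseteq> {1..n}" using assms by (auto simp: edges_def)
  then obtain x y where xy: "e = {x, y}" "x \<noteq> y" "x \<in> {1..n}" "y \<in> {1..n}" by (auto simp: card_2_iff)
  show thesis
  proof (cases "x < y")
    case True
    then show ?thesis using that[of x y] xy by simp
  next
    case False
    then show ?thesis using that[of y x] xy by (simp add: insert_commute)
  qed
qed

lemma pair_in_edges: "1 \<le> i \<Longrightarrow> i < j \<Longrightarrow> j \<le> n \<Longrightarrow> {i, j} \<in> edges n"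
  by (auto simp: edges_def)

lemma sum_roots_eq: "{sum_root i j | i j. 1 \<le> i \<and> i < j \<and> j \<le> n} = edge_root ` edges n"
proof
  show "{sum_root i j | i j. 1 \<le> i \<and> i < j \<and> j \<le> n} \<subseteq> edge_root ` edges n"
  proof
    fix v assume "v \<in> {sum_root i j | i j. 1 \<le> i \<and> i < j \<and> j \<le> n}"
    then obtain i j where v: "v = sum_root i j" "1 \<le> i" "i < j" "j \<le> n" by blast
    then have "v = edge_root {i, j}" by (simp add: sum_root_eq_edge_root)
    then show "v \<in> edge_root ` edges n" using pair_in_edges[OF v(2-4)] by blast
  qed
  show "edge_root ` edges n \<subseteq> {sum_root i j | i j. 1 \<le> i \<and> i < j \<and> j \<le> n}"
  proof (rule image_subsetI)
    fix e assume "e \<in> edges n"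
    then obtain i j where ij: "e = {i, j}" "1 \<le> i" "i < j" "j \<le> n" by (rule edges_cases)
    then have "edge_root e = sum_root i j" by (simp add: sum_root_eq_edge_root)
    then show "edge_root e \<in> {sum_root i j | i j. 1 \<le> i \<and> i < j \<and> j \<le> n}" using ij by blast
  qed
qed

lemma edge_root_in_pos_roots:
  assumes "e \<in> edges n"
  shows "edge_root e \<in> pos_roots n"
proof -
  obtain i j where ij: "e = {i, j}" "1 \<le> i" "i < j" "j \<le> n" using assms by (rule edges_cases)
  then have "edge_root e = eps i + eps j" by (simp flip: sum_root_eq_edge_root add: sum_root_def)
  then show ?thesis unfolding pos_roots_def using ij by blast
qed

lemma edge_root_in_rvecs: "e \<subseteq> {1..n} \<Longrightarrow> edge_root e \<in> rvecs n"
  by (auto simp: edge_root_def rvecs_def)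

lemma dotp_edge_root:
  assumes "e \<subseteq> {1..n}"
  shows "dotp n (edge_root e) (edge_root f) = card (e \<inter> f)"
proof -
  have "dotp n (edge_root e) (edge_root f) = (\<Sum>m\<in>{1..n}. if m \<in> e \<inter> f then 1 else 0)"
    unfolding dotp_def edge_root_def by (rule sum.cong) auto
  also have "\<dots> = (\<Sum>m\<in>{1..n} \<inter> (e \<inter> f). 1)" by (rule sum.inter_restrict[symmetric]) simp
  also have "{1..n} \<inter> (e \<inter> f) = e \<inter> f" using assms by blast
  finally show ?thesis by simp
qed

text \<open>The inner product of two indicator vectors counts common points, so it vanishes exactly
  for disjoint edges.\<close>

lemma orth_set_edge_root:
  assumes "P \<subseteq> edges n"
  shows "orth_set n (edge_root ` P) \<longleftrightarrow> disjoint P"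
proof -
  have "dotp n (edge_root e) (edge_root f) = 0 \<longleftrightarrow> e \<inter> f = {}" if "e \<in> P" for e f
  proof -
    have "e \<subseteq> {1..n}" using that assms by (auto simp: edges_def)
    moreover from this have "finite (e \<inter> f)" by (auto intro: finite_subset)
    ultimately show ?thesis by (simp add: dotp_edge_root)
  qed
  then show ?thesis
    unfolding orth_set_def pairwise_image by (auto simp: pairwise_def disjnt_def)
qed

lemma card_disjoint_edges:
  assumes "P \<subseteq> edges n" "disjoint P"
  shows "card (\<Union> P) = 2 * card P"
proof -
  have "card (\<Union> P) = (\<Sum>e\<in>P. card e)"
    using assms by (intro card_Union_disjoint) (auto simp: edges_def intro: finite_subset)
  also have "\<dots> = (\<Sum>e\<in>P. 2)" using assms(1) by (intro sum.cong) (auto simp: edges_def)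
  finally show ?thesis by simp
qed

lemma card_disjoint_edges_le:
  assumes "P \<subseteq> edges (2 * k)" "disjoint P"
  shows "card P \<le> k"
proof -
  have "\<Union> P \<subseteq> {1..2 * k}" using assms(1) by (auto simp: edges_def)
  then have "card (\<Union> P) \<le> 2 * k" using card_mono[of "{1..2 * k}" "\<Union> P"] by simp
  then show ?thesis using card_disjoint_edges[OF assms] by simp
qed

text \<open>Since \<open>k\<close> disjoint edges already fill \<open>2 * k\<close> points, covering
  can be expressed by a cardinality, which is the form in which \<open>Omega\<close> supplies
  it.\<close>

lemma perfect_matchings_iff:
  "P \<in> perfect_matchings (2 * k) \<longleftrightarrow> P \<subseteq> edges (2 * k) \<and> disjoint P \<and> card P = k"
proof
  assume P: "P \<in> perfect_matchings (2 * k)"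
  then show "P \<subseteq> edges (2 * k) \<and> disjoint P \<and> card P = k"
    using card_perfect_matching[OF P] by (auto simp: perfect_matchings_def partition_on_def edges_def)
next
  assume P: "P \<subseteq> edges (2 * k) \<and> disjoint P \<and> card P = k"
  then have "\<Union> P \<subseteq> {1..2 * k}" by (auto simp: edges_def)
  moreover have "card (\<Union> P) = card {1..2 * k}" using card_disjoint_edges[of P "2 * k"] P by simp
  ultimately have "\<Union> P = {1..2 * k}" by (intro card_subset_eq) simp_all
  then show "P \<in> perfect_matchings (2 * k)"
    using P by (auto simp: perfect_matchings_def partition_on_def edges_def)
qed

lemma perfect_matchings_nonempty: "perfect_matchings (2 * k) \<noteq> {}"
proof -
  \<comment> \<open>The identity lists the pairs \<open>{1, 2}\<close>, \<open>{3, 4}\<close>, and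
    so on. The existence of a matching shows that the bound \<open>k\<close> on orthogonal sets is
    attained.\<close>
  have "id \<in> pf_perms k" using permutes_id[of "{1..2 * k}"] by (auto simp: pf_perms_def)
  then show ?thesis using matching_of_in_perfect_matchings by blast
qed

lemma kappa_edge_roots: "kappa (2 * k) (edge_root ` edges (2 * k)) = k"
  unfolding kappa_def
proof (rule Max_eqI)
  have "finite (edges (2 * k))" by (rule finite_subset[of _ "Pow {1..2 * k}"]) (auto simp: edges_def)
  then have "finite {R. R \<subseteq> edge_root ` edges (2 * k) \<and> orth_set (2 * k) R}" by simp
  then show "finite (card ` {R. R \<subseteq> edge_root ` edges (2 * k) \<and> orth_set (2 * k) R})" by simp
next
  fix c assume "c \<in> card ` {R. R \<subseteq> edge_root ` edges (2 * k) \<and> orth_set (2 * k) R}"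
  then obtain R where R: "c = card R" "R \<subseteq> edge_root ` edges (2 * k)" "orth_set (2 * k) R" by blast
  from R(2) obtain P where P: "P \<subseteq> edges (2 * k)" "R = edge_root ` P" by (rule subset_imageE)
  then show "c \<le> k"
    using R card_disjoint_edges_le[OF P(1)] orth_set_edge_root[OF P(1)]
    by (simp add: card_image inj_on_def)
next
  obtain M where M: "M \<in> perfect_matchings (2 * k)" using perfect_matchings_nonempty by blast
  then have "M \<subseteq> edges (2 * k)" "disjoint M" "card M = k" unfolding perfect_matchings_iff by simp_all
  moreover from this have "orth_set (2 * k) (edge_root ` M)" using orth_set_edge_root by blast
  moreover have "card (edge_root ` M) = card M" by (simp add: card_image inj_on_def)
  ultimately show "k \<in> card ` {R. R \<subseteq> edge_root ` edges (2 * k) \<and> orth_set (2 * k) R}"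
    by (metis (mono_tags, lifting) imageI image_mono mem_Collect_eq)
qed

lemma Omega_edge_roots:
  "Omega (2 * k) (edge_root ` edges (2 * k)) = (\<lambda>M. edge_root ` M) ` perfect_matchings (2 * k)"
proof
  show "Omega (2 * k) (edge_root ` edges (2 * k)) \<subseteq> (\<lambda>M. edge_root ` M) ` perfect_matchings (2 * k)"
  proof
    fix R assume "R \<in> Omega (2 * k) (edge_root ` edges (2 * k))"
    then have R: "R \<subseteq> edge_root ` edges (2 * k)" "orth_set (2 * k) R" "card R = k"
      by (auto simp: Omega_def kappa_edge_roots)
    from R(1) obtain P where P: "P \<subseteq> edges (2 * k)" "R = edge_root ` P" by (rule subset_imageE)
    then have "disjoint P" "card P = k"
      using R orth_set_edge_root[OF P(1)] by (simp_all add: card_image inj_on_def)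
    then show "R \<in> (\<lambda>M. edge_root ` M) ` perfect_matchings (2 * k)"
      using P perfect_matchings_iff by blast
  qed
  show "(\<lambda>M. edge_root ` M) ` perfect_matchings (2 * k) \<subseteq> Omega (2 * k) (edge_root ` edges (2 * k))"
  proof (rule image_subsetI)
    fix M assume "M \<in> perfect_matchings (2 * k)"
    then have M: "M \<subseteq> edges (2 * k)" "disjoint M" "card M = k" unfolding perfect_matchings_iff by simp_all
    have "card (edge_root ` M) = k" using M(3) by (simp add: card_image inj_on_def)
    then show "edge_root ` M \<in> Omega (2 * k) (edge_root ` edges (2 * k))"
      using M orth_set_edge_root[OF M(1)] by (auto simp: Omega_def kappa_edge_roots)
  qed
qed

lemma inj_edge_root_image: "inj (\<lambda>M. edge_root ` M)"
  by (intro injI) (simp add: inj_image_eq_iff inj_def)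

lemma matching_roots_eq:
  assumes "M \<in> perfect_matchings (2 * k)"
  shows "matching_roots k M = edge_root ` M"
proof -
  have "matching_roots k M = (\<lambda>t. edge_root {fst_pt M t, snd_pt M t}) ` {1..k}"
    unfolding matching_roots_def
    by (rule image_cong[OF refl]) (rule sum_root_eq_edge_root[OF less_imp_neq[OF fst_snd_pt(2)[OF assms]]])
  also have "\<dots> = edge_root ` (\<lambda>t. {fst_pt M t, snd_pt M t}) ` {1..k}" by (simp only: image_image)
  also have "\<dots> = edge_root ` M" by (simp only: perfect_matching_eq_fst_snd_image[OF assms, symmetric])
  finally show ?thesis .
qed

section \<open>Reflections of edge roots and the residual set\<close>

lemma eps_diff_pos_iff:
  assumes "a \<noteq> b" "a \<in> {1..n}" "b \<in> {1..n}"
  shows "eps a - eps b \<in> pos_roots n \<longleftrightarrow> a < b"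
proof
  assume "eps a - eps b \<in> pos_roots n"
  then obtain i j where ij: "i < j" "eps a - eps b = eps i + eps j \<or> eps a - eps b = eps i - eps j"
    by (auto simp: pos_roots_def)
  from ij(2) show "a < b"
  proof
    assume eq: "eps a - eps b = eps i + eps j"
    have "(eps a - eps b) b = - 1" using assms(1) by (simp add: eps_def)
    moreover have "(eps i + eps j) b \<ge> 0" by (simp add: eps_def)
    ultimately show ?thesis using eq by simp
  next
    assume eq: "eps a - eps b = eps i - eps j"
    have "(eps a - eps b) i = 1" using eq ij(1) by (simp add: eps_def)
    then have "i = a" by (auto simp: eps_def split: if_splits)
    moreover have "(eps a - eps b) j = - 1" using eq ij(1) by (simp add: eps_def)
    then have "j = b" by (auto simp: eps_def split: if_splits)
    ultimately show ?thesis using ij(1) by simp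
  qed
next
  assume "a < b"
  then show "eps a - eps b \<in> pos_roots n" using assms unfolding pos_roots_def by auto
qed

lemma root_refl_edge_root:
  assumes "e \<subseteq> {1..n}" "f \<subseteq> {1..n}"
  shows "root_refl n (edge_root e) (edge_root f) = edge_root f - (\<lambda>m. card (e \<inter> f) * edge_root e m)"
  using assms by (simp add: root_refl_def edge_root_in_rvecs dotp_edge_root)

lemma root_refl_adjacent_edges:
  assumes "i \<in> {1..n}" "j \<in> {1..n}" "a \<in> {1..n}" "i \<noteq> j" "i \<noteq> a" "j \<noteq> a"
  shows "root_refl n (edge_root {i, a}) (edge_root {i, j}) = eps j - eps a"
proof -
  have "{i, a} \<inter> {i, j} = {i}" using assms by auto
  moreover have "edge_root {i, j} - edge_root {i, a} = eps j - eps a"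
    using assms by (auto simp: edge_root_def eps_def fun_eq_iff)
  ultimately show ?thesis using assms by (subst root_refl_edge_root) (auto simp: fun_diff_def)
qed

text \<open>Edges disjoint from \<open>{i, j}\<close> fix its root, and the edge
  \<open>{i, j}\<close> itself would negate it. Otherwise the edges at \<open>i\<close> and at
  \<open>j\<close> produce \<open>eps j - eps (tau k M i)\<close> and
  \<open>eps i - eps (tau k M j)\<close>, whose signs are the two diagram conditions.\<close>

lemma edge_root_in_Res_iff:
  assumes M: "M \<in> perfect_matchings (2 * k)" and ij: "1 \<le> i" "i < j" "j \<le> 2 * k"
  shows "edge_root {i, j} \<in> Res (2 * k) (edge_root ` edges (2 * k)) (edge_root ` M)
           \<longleftrightarrow> (i, j) \<in> diagram {1..2 * k} (tau k M)"
proof -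
  let ?A = "{1..2 * k}" and ?\<tau> = "tau k M" and ?f = "edge_root {i, j}"
  let ?pos = "\<lambda>e. root_refl (2 * k) (edge_root e) ?f \<in> pos_roots (2 * k)"
  have t: "?\<tau> \<in> fpf ?A" by (rule tau_in_fpf[OF M])
  have A: "i \<in> ?A" "j \<in> ?A" using ij by auto
  have \<tau>A: "?\<tau> i \<in> ?A" "?\<tau> j \<in> ?A" using A unfolding fpf_in_iff[OF t] by simp_all
  have neq: "?\<tau> i \<noteq> i" "?\<tau> j \<noteq> j" using fpf_neq[OF t] A by blast+
  have edge: "{i, ?\<tau> i} \<in> M" "{j, ?\<tau> j} \<in> M" using perfect_matching_edge_iff[OF M] A by blast+
  have "?f \<in> edge_root ` edges (2 * k)" using pair_in_edges[OF ij] by blast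
  then have "?f \<in> Res (2 * k) (edge_root ` edges (2 * k)) (edge_root ` M) \<longleftrightarrow> (\<forall>e\<in>M. ?pos e)"
    by (simp add: Res_def)
  also have "\<dots> \<longleftrightarrow> j < ?\<tau> i \<and> i < ?\<tau> j"
  proof (cases "?\<tau> i = j")
    case True
    have "- ?f \<notin> pos_roots (2 * k)"
    proof
      assume "- ?f \<in> pos_roots (2 * k)"
      then obtain a b where "a < b" "- ?f = eps a + eps b \<or> - ?f = eps a - eps b"
        by (auto simp: pos_roots_def)
      moreover from this have "(eps a + eps b) a = 1" "(eps a - eps b) a = 1" by (simp_all add: eps_def)
      ultimately have "(- ?f) a = 1" by metis
      moreover have "(- ?f) a \<le> 0" by (simp add: edge_root_def)
      ultimately show False by linarith
    qed
    moreover have "root_refl (2 * k) ?f ?f = - ?f"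
      using A ij by (subst root_refl_edge_root) (auto simp: fun_eq_iff)
    ultimately have "\<not> ?pos {i, j}" by simp
    then show ?thesis using True edge(1) by auto
  next
    case False
    then have "?\<tau> j \<noteq> i" using fpf_involution[OF t] by metis
    have pos_i: "?pos {i, ?\<tau> i} \<longleftrightarrow> j < ?\<tau> i"
      using root_refl_adjacent_edges[OF A \<tau>A(1)] eps_diff_pos_iff[of j "?\<tau> i"] A \<tau>A ij neq False by simp
    have pos_j: "?pos {j, ?\<tau> j} \<longleftrightarrow> i < ?\<tau> j"
      using root_refl_adjacent_edges[OF A(2,1) \<tau>A(2)] eps_diff_pos_iff[of i "?\<tau> j"] A \<tau>A ij neq
        \<open>?\<tau> j \<noteq> i\<close> by (simp add: insert_commute)
    have rest: "?pos e" if e: "e \<in> M" "i \<notin> e" "j \<notin> e" for e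
    proof -
      have "e \<subseteq> ?A" using e(1) M by (auto simp: perfect_matchings_def partition_on_def)
      moreover have "e \<inter> {i, j} = {}" using e by simp
      ultimately have "root_refl (2 * k) (edge_root e) ?f = ?f"
        using A by (subst root_refl_edge_root) (auto simp: fun_eq_iff)
      then show ?thesis using edge_root_in_pos_roots[OF pair_in_edges[OF ij]] by simp
    qed
    have "e = {i, ?\<tau> i} \<or> e = {j, ?\<tau> j} \<or> i \<notin> e \<and> j \<notin> e" if "e \<in> M" for e
      using perfect_matchings_unique[OF M that] edge by blast
    then show ?thesis using pos_i pos_j rest edge by metis
  qed
  also have "\<dots> \<longleftrightarrow> (i, j) \<in> diagram ?A ?\<tau>" using A ij by (simp add: diagram_def)
  finally show ?thesis .
qed

lemma Res_edge_roots:
  assumes M: "M \<in> perfect_matchings (2 * k)"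
  shows "Res (2 * k) (edge_root ` edges (2 * k)) (edge_root ` M)
           = (\<lambda>(i, j). edge_root {i, j}) ` diagram {1..2 * k} (tau k M)" (is "?L = ?R")
proof
  show "?L \<subseteq> ?R"
  proof
    fix v assume v: "v \<in> ?L"
    then obtain e where "e \<in> edges (2 * k)" "v = edge_root e" by (auto simp: Res_def)
    then obtain i j where "v = edge_root {i, j}" "1 \<le> i" "i < j" "j \<le> 2 * k" using edges_cases by metis
    then show "v \<in> ?R" using v edge_root_in_Res_iff[OF M, of i j] by force
  qed
  show "?R \<subseteq> ?L"
  proof (rule image_subsetI, unfold split_paired_all case_prod_conv)
    fix i j assume "(i, j) \<in> diagram {1..2 * k} (tau k M)"
    moreover from this have "1 \<le> i" "i < j" "j \<le> 2 * k" by (auto simp: diagram_def)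
    ultimately show "edge_root {i, j} \<in> ?L" using edge_root_in_Res_iff[OF M, of i j] by simp
  qed
qed

lemma rho_edge_roots:
  assumes M: "M \<in> perfect_matchings (2 * k)"
  shows "rho (2 * k) (edge_root ` edges (2 * k)) (edge_root ` M) = card (diagram {1..2 * k} (tau k M))"
proof -
  have "inj_on (\<lambda>(i, j). edge_root {i, j}) (diagram {1..2 * k} (tau k M))"
    by (rule inj_onI) (auto simp: diagram_def doubleton_eq_iff)
  then show ?thesis unfolding rho_def Res_edge_roots[OF M] by (rule card_image)
qed

section \<open>The action on matchings\<close>

text \<open>The partner of \<open>x\<close> in the relabelled matching is found by going back along
  \<open>p\<close>, taking the partner there and returning.\<close>

lemma image_perfect_matching:
  assumes M: "M \<in> perfect_matchings (2 * k)" and p: "p permutes {1..2 * k}"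
  shows "(`) p ` M \<in> perfect_matchings (2 * k)"
    "tau k ((`) p ` M) = p \<circ> tau k M \<circ> inv' p"
proof -
  let ?A = "{1..2 * k}"
  have inj: "inj p" by (rule permutes_inj[OF p])
  note M' = M[unfolded perfect_matchings_iff]
  have "(`) p ` M \<subseteq> edges (2 * k)"
  proof (rule image_subsetI)
    fix e assume "e \<in> M"
    then have e: "e \<subseteq> ?A" "card e = 2" using M' by (auto simp: edges_def)
    then have "p ` e \<subseteq> ?A" using permutes_image[OF p] by blast
    moreover have "card (p ` e) = 2" using e(2) inj by (simp add: card_image inj_on_subset)
    ultimately show "p ` e \<in> edges (2 * k)" by (simp add: edges_def)
  qed
  moreover have "disjoint ((`) p ` M)"
  proof (rule disjointI)
    fix e f assume "e \<in> (`) p ` M" "f \<in> (`) p ` M" "e \<noteq> f"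
    then obtain e' f' where "e = p ` e'" "f = p ` f'" "e' \<in> M" "f' \<in> M" "e' \<noteq> f'" by blast
    then show "e \<inter> f = {}" using M' inj by (metis disjointD image_Int image_empty)
  qed
  moreover have "card ((`) p ` M) = k"
    using M' inj by (simp add: card_image inj_on_def inj_image_eq_iff)
  ultimately show pM: "(`) p ` M \<in> perfect_matchings (2 * k)" unfolding perfect_matchings_iff by blast
  show "tau k ((`) p ` M) = p \<circ> tau k M \<circ> inv' p"
  proof
    fix x
    show "tau k ((`) p ` M) x = (p \<circ> tau k M \<circ> inv' p) x"
    proof (cases "x \<in> ?A")
      case True
      then have "inv' p x \<in> ?A" unfolding permutes_in_image[OF permutes_inv[OF p]] .
      then have "{inv' p x, tau k M (inv' p x)} \<in> M" using perfect_matching_edge_iff[OF M] by blast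
      then have "p ` {inv' p x, tau k M (inv' p x)} \<in> (`) p ` M" by blast
      then have "{x, p (tau k M (inv' p x))} \<in> (`) p ` M" by (simp add: permutes_inverses[OF p])
      then show ?thesis using perfect_matching_edge_iff[OF pM True] by simp
    next
      case False
      have "tau k ((`) p ` M) x = x"
        by (rule permutes_not_in[OF fpf_permutes[OF tau_in_fpf[OF pM]] False])
      moreover have "inv' p x = x" "tau k M x = x" "p x = x"
        using permutes_not_in[OF permutes_inv[OF p] False] permutes_not_in[OF p False]
          permutes_not_in[OF fpf_permutes[OF tau_in_fpf[OF M]] False] by simp_all
      ultimately show ?thesis by simp
    qed
  qed
qed

lemma perm_map_edge_root:
  assumes "e \<subseteq> {1..n}" "p permutes {1..n}"
  shows "perm_map n p (edge_root e) = edge_root (p ` e)"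
proof -
  have "inv' p m \<in> e \<longleftrightarrow> m \<in> p ` e" for m
    using permutes_inverses[OF assms(2)] by (metis image_iff)
  then show ?thesis
    unfolding perm_map_apply[OF edge_root_in_rvecs[OF assms(1)]] by (simp add: edge_root_def fun_eq_iff)
qed

text \<open>A coordinate permutation sends a sum of two unit vectors to another such sum, a positive
  root, so \<open>abs_root\<close> changes nothing here.\<close>

lemma std_action_perm_map:
  assumes M: "M \<in> perfect_matchings (2 * k)" and p: "p permutes {1..2 * k}"
    and X: "edge_root ` M \<in> X"
  shows "std_action (2 * k) X (perm_map (2 * k) p) (edge_root ` M) = edge_root ` (`) p ` M"
proof -
  have "abs_root (2 * k) (perm_map (2 * k) p (edge_root e)) = edge_root (p ` e)" if e: "e \<in> M" for e
  proof -
    have "e \<subseteq> {1..2 * k}" using e M by (auto simp: perfect_matchings_iff edges_def)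
    moreover have "p ` e \<in> edges (2 * k)"
      using image_perfect_matching(1)[OF M p] e by (auto simp: perfect_matchings_iff)
    ultimately show ?thesis
      using edge_root_in_pos_roots by (simp add: perm_map_edge_root[OF _ p] abs_root_def)
  qed
  then show ?thesis using X by (simp add: std_action_def image_image)
qed

lemma qp_triple_sum_roots:
  assumes k: "1 \<le> k" and I: "I = simple_refls (2 * k) - {simple_refl (2 * k) (2 * k)}"
  shows "qp_triple (2 * k) I (edge_root ` edges (2 * k))"
proof -
  let ?n = "2 * k" and ?A = "{1..2 * k}"
  define U where "U = edge_root ` edges ?n"
  define X where "X = Omega ?n U"
  define act where "act = std_action ?n X"
  define lev where "lev = (\<lambda>R. int (rho ?n U R))"
  let ?G = "parabolic ?n I"
  have n2: "2 \<le> ?n" using k by simp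
  have iso: "perm_map ?n \<in> iso (sym_group ?n) ?G" by (rule perm_map_iso_parabolic[OF n2 I])
  interpret B: group "BijGroup (rvecs ?n)" by (rule group_BijGroup)
  interpret W: group "weyl ?n" unfolding weyl_def by (rule B.group_subgroup_generated)
  interpret P: group ?G unfolding parabolic_def by (rule W.group_subgroup_generated)
  have I_eq: "I = (\<lambda>i. perm_map ?n (adj i)) ` {1..<?n}"
    unfolding I simple_refls_minus_last[OF n2] image_image ..
  have cox: "coxeter_system ?G I"
    unfolding I_eq by (rule coxeter_system_iso_sym_group[OF _ iso[unfolded I_eq]])
      (use P.is_group in \<open>simp only: I_eq\<close>)
  have carrier: "carrier ?G = perm_map ?n ` {p. p permutes ?A}"
    using iso by (simp add: iso_def bij_betw_def sym_group_def)
  have mult: "perm_map ?n p \<otimes>\<^bsub>?G\<^esub> perm_map ?n q = perm_map ?n (p \<circ> q)"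
    if "p permutes ?A" "q permutes ?A" for p q
    using perm_map_mult[OF that] by (simp add: parabolic_def weyl_def)
  have X_eq: "X = (\<lambda>M. edge_root ` M) ` perfect_matchings ?n"
    unfolding X_def U_def by (rule Omega_edge_roots)
  have act: "act (perm_map ?n p) (edge_root ` M) = edge_root ` (`) p ` M"
    if "M \<in> perfect_matchings ?n" "p permutes ?A" for M p
    unfolding act_def using that by (intro std_action_perm_map) (auto simp: X_eq)
  have act_X: "act (perm_map ?n p) R \<in> X" if "p permutes ?A" "R \<in> X" for p R
    using that act image_perfect_matching(1) unfolding X_eq by blast
  have act_comp: "act (perm_map ?n p) (act (perm_map ?n q) R) = act (perm_map ?n (p \<circ> q)) R"
    if p: "p permutes ?A" and q: "q permutes ?A" and R: "R \<in> X" for p q R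
  proof -
    obtain M where M: "M \<in> perfect_matchings ?n" "R = edge_root ` M" using R unfolding X_eq by blast
    show ?thesis
      unfolding M(2) act[OF M(1) q] act[OF image_perfect_matching(1)[OF M(1) q] p]
        act[OF M(1) permutes_compose[OF q p]]
      by (simp only: image_image comp_def)
  qed
  have act_id: "act (perm_map ?n id) R = R" if R: "R \<in> X" for R
  proof -
    obtain M where M: "M \<in> perfect_matchings ?n" "R = edge_root ` M" using R unfolding X_eq by blast
    show ?thesis unfolding M(2) act[OF M(1) permutes_id] by simp
  qed
  have act_Bij: "act (perm_map ?n p) \<in> Bij X" if p: "p permutes ?A" for p
  proof -
    have "bij_betw (act (perm_map ?n p)) X X"
    proof (rule bij_betw_byWitness[where f' = "act (perm_map ?n (inv' p))"])
      show "\<forall>R\<in>X. act (perm_map ?n (inv' p)) (act (perm_map ?n p) R) = R"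
        "\<forall>R\<in>X. act (perm_map ?n p) (act (perm_map ?n (inv' p)) R) = R"
        using act_comp[OF permutes_inv[OF p] p] act_comp[OF p permutes_inv[OF p]] act_id
        unfolding permutes_inv_o[OF p] by blast+
      show "act (perm_map ?n p) ` X \<subseteq> X" "act (perm_map ?n (inv' p)) ` X \<subseteq> X"
        using act_X[OF p] act_X[OF permutes_inv[OF p]] by blast+
    qed
    then show ?thesis by (simp add: Bij_def act_def std_action_def)
  qed
  have action: "group_action ?G X act"
  proof (intro group_action.intro group_hom.intro P.is_group group_BijGroup group_hom_axioms.intro homI)
    fix w assume "w \<in> carrier ?G"
    then show "act w \<in> carrier (BijGroup X)" using act_Bij unfolding carrier by (auto simp: BijGroup_def)
  next
    fix v w assume "v \<in> carrier ?G" "w \<in> carrier ?G"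
    then obtain p q where pq: "v = perm_map ?n p" "p permutes ?A" "w = perm_map ?n q" "q permutes ?A"
      unfolding carrier by blast
    have "act (perm_map ?n (p \<circ> q)) = compose X (act (perm_map ?n p)) (act (perm_map ?n q))"
    proof
      fix R
      show "act (perm_map ?n (p \<circ> q)) R = compose X (act (perm_map ?n p)) (act (perm_map ?n q)) R"
      proof (cases "R \<in> X")
        case True
        then show ?thesis using act_comp[OF pq(2,4) True] by (simp add: compose_def)
      next
        case False
        then show ?thesis by (simp add: compose_def act_def std_action_def)
      qed
    qed
    then show "act (v \<otimes>\<^bsub>?G\<^esub> w) = act v \<otimes>\<^bsub>BijGroup X\<^esub> act w"
      using act_Bij[OF pq(2)] act_Bij[OF pq(4)] unfolding pq(1,3) mult[OF pq(2,4)]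
      by (simp add: BijGroup_def)
  qed
  have lev: "lev (edge_root ` M) = int (card (diagram ?A (tau k M)))" if "M \<in> perfect_matchings ?n" for M
    unfolding lev_def U_def using rho_edge_roots[OF that] by simp
  \<comment> \<open>Restates the action of a reflection as conjugation of the involution, the
    setting of the level comparisons; \<open>tau_inj\<close> leads back to matchings.\<close>
  have act_transpose: "\<exists>M'\<in>perfect_matchings ?n. act (perm_map ?n (transpose a b)) (edge_root ` M) = edge_root ` M' \<and>
      tau k M' = conj_transpose a b (tau k M)"
    if M: "M \<in> perfect_matchings ?n" and ab: "a \<in> ?A" "b \<in> ?A" for M a b
  proof -
    have p: "transpose a b permutes ?A" by (rule permutes_swap_id[OF ab])
    show ?thesis
      using act[OF M p] image_perfect_matching[OF M p] by (metis inv_transpose_eq)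
  qed
  have tau_inj: "M = M'"
    if "M \<in> perfect_matchings ?n" "M' \<in> perfect_matchings ?n" "tau k M = tau k M'" for M M'
    using bij_betw_tau[of k] that by (auto simp: bij_betw_def inj_on_def)
  \<comment> \<open>Conjugates of adjacent transpositions are transpositions. The two points are put
    in increasing order, as the level comparisons require.\<close>
  have refl_cases: "\<exists>a b. 1 \<le> a \<and> a < b \<and> b \<le> ?n \<and> r = perm_map ?n (transpose a b)"
    if r: "r \<in> reflections ?G I" for r
  proof -
    obtain w s where ws: "r = w \<otimes>\<^bsub>?G\<^esub> s \<otimes>\<^bsub>?G\<^esub> inv\<^bsub>?G\<^esub> w" "w \<in> carrier ?G" "s \<in> I"
      using r by (auto simp: reflections_def)
    obtain p where p: "w = perm_map ?n p" "p permutes ?A" using ws(2) unfolding carrier by blast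
    obtain i where i: "1 \<le> i" "i < ?n" "s = perm_map ?n (adj i)" using ws(3) unfolding I_eq by auto
    have perm_i: "adj i permutes ?A" by (rule permutes_adj[OF i(1,2)])
    have "perm_map ?n id = \<one>\<^bsub>?G\<^esub>"
      using group_hom.hom_one[of "sym_group ?n" ?G "perm_map ?n"] iso P.is_group sym_group_is_group
      by (simp add: group_hom_def group_hom_axioms_def iso_def sym_group_one)
    then have "inv\<^bsub>?G\<^esub> w = perm_map ?n (inv' p)"
      using mult[OF permutes_inv[OF p(2)] p(2)] permutes_inv[OF p(2)] p
      by (intro P.inv_equality) (auto simp: carrier permutes_inv_o[OF p(2)])
    then have "r = perm_map ?n (p \<circ> adj i \<circ> inv' p)"
      unfolding ws(1) p(1) i(3)
      using mult[OF p(2) perm_i] mult[OF permutes_compose[OF perm_i p(2)] permutes_inv[OF p(2)]] by simp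
    also have "p \<circ> adj i \<circ> inv' p = transpose (p i) (p (Suc i))"
    proof
      fix x
      have "x = p (inv' p x)" by (simp add: permutes_inverses[OF p(2)])
      moreover have "p (adj i y) = transpose (p i) (p (Suc i)) (p y)" for y
        using permutes_inj[OF p(2)] by (simp add: transpose_def inj_eq)
      ultimately show "(p \<circ> adj i \<circ> inv' p) x = transpose (p i) (p (Suc i)) x"
        unfolding comp_apply by metis
    qed
    finally have r_eq: "r = perm_map ?n (transpose (p i) (p (Suc i)))" .
    have in_A: "p i \<in> ?A" "p (Suc i) \<in> ?A" unfolding permutes_in_image[OF p(2)] using i by auto
    have "p i \<noteq> p (Suc i)" using permutes_inj[OF p(2)] by (simp add: inj_eq)
    then consider "p i < p (Suc i)" | "p (Suc i) < p i" by linarith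
    then show ?thesis
    proof cases
      case 1
      then show ?thesis using r_eq in_A by (intro exI[of _ "p i"] exI[of _ "p (Suc i)"]) simp
    next
      case 2
      then show ?thesis using r_eq in_A
        by (intro exI[of _ "p (Suc i)"] exI[of _ "p i"]) (simp add: transpose_commute)
    qed
  qed
  have scaled: "scaled_set ?G I X act lev"
    unfolding scaled_set_def
  proof (intro conjI ballI cox action)
    fix s R assume "s \<in> I" "R \<in> X"
    then obtain i M where i: "1 \<le> i" "i < ?n" "s = perm_map ?n (adj i)"
      and M: "M \<in> perfect_matchings ?n" "R = edge_root ` M" unfolding I_eq X_eq by auto
    obtain M' where M': "M' \<in> perfect_matchings ?n" "act s R = edge_root ` M'"
      "tau k M' = conj_transpose i (Suc i) (tau k M)"
      using act_transpose[OF M(1), of i "Suc i"] i M(2) by auto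
    show "\<bar>lev (act s R) - lev R\<bar> \<le> 1"
      unfolding M(2) M'(2)[unfolded M(2)] lev[OF M'(1)] lev[OF M(1)] M'(3)
      by (rule card_diagram_adj_bound[OF tau_in_fpf[OF M(1)] i(1,2)])
  qed
  have "quasiparabolic ?G I X act lev"
    unfolding quasiparabolic_def
  proof (intro conjI ballI impI scaled)
    fix r R assume r: "r \<in> reflections ?G I" and R: "R \<in> X" and eq: "lev (act r R) = lev R"
    obtain a b where ab: "1 \<le> a" "a < b" "b \<le> ?n" "r = perm_map ?n (transpose a b)"
      using refl_cases[OF r] by blast
    then have ab_in: "a \<in> ?A" "b \<in> ?A" by auto
    obtain M where M: "M \<in> perfect_matchings ?n" "R = edge_root ` M" using R unfolding X_eq by blast
    obtain M' where M': "M' \<in> perfect_matchings ?n" "act r R = edge_root ` M'"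
      "tau k M' = conj_transpose a b (tau k M)"
      using act_transpose[OF M(1) ab_in] M(2) ab(4) by blast
    have "conj_transpose a b (tau k M) = tau k M"
      using eq unfolding M(2) M'(2)[unfolded M(2)] lev[OF M'(1)] lev[OF M(1)] M'(3) of_nat_eq_iff
      by (rule card_diagram_conj_eq_imp[OF tau_in_fpf[OF M(1)] ab(1-3)])
    then have "M' = M" using M'(3) by (intro tau_inj M' M) simp
    then show "act r R = R" using M'(2) M(2) by simp
  next
    fix r s R assume r: "r \<in> reflections ?G I" and s: "s \<in> I" and R: "R \<in> X"
      and up_down: "lev R < lev (act r R) \<and> lev (act s (act r R)) < lev (act s R)"
    obtain a b where ab: "1 \<le> a" "a < b" "b \<le> ?n" "r = perm_map ?n (transpose a b)"
      using refl_cases[OF r] by blast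
    then have ab_in: "a \<in> ?A" "b \<in> ?A" by auto
    obtain i where i: "1 \<le> i" "i < ?n" "s = perm_map ?n (adj i)" using s unfolding I_eq by auto
    then have i_in: "i \<in> ?A" "Suc i \<in> ?A" by auto
    obtain M where M: "M \<in> perfect_matchings ?n" "R = edge_root ` M" using R unfolding X_eq by blast
    obtain Mr where Mr: "Mr \<in> perfect_matchings ?n" "act r R = edge_root ` Mr"
      "tau k Mr = conj_transpose a b (tau k M)"
      using act_transpose[OF M(1) ab_in] M(2) ab(4) by blast
    obtain Ms where Ms: "Ms \<in> perfect_matchings ?n" "act s R = edge_root ` Ms"
      "tau k Ms = conj_transpose i (Suc i) (tau k M)"
      using act_transpose[OF M(1) i_in] M(2) i(3) by blast
    obtain Msr where Msr: "Msr \<in> perfect_matchings ?n" "act s (act r R) = edge_root ` Msr"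
      "tau k Msr = conj_transpose i (Suc i) (tau k Mr)"
      using act_transpose[OF Mr(1) i_in] Mr(2) i(3) by auto
    have "conj_transpose a b (tau k M) = conj_transpose i (Suc i) (tau k M)"
    proof (rule card_diagram_conj_reversed_imp_eq[OF tau_in_fpf[OF M(1)] ab(1-3) i(1,2)])
      show "card (diagram ?A (tau k M)) < card (diagram ?A (conj_transpose a b (tau k M)))"
        using conjunct1[OF up_down] unfolding M(2) Mr(2)[unfolded M(2)] lev[OF Mr(1)] lev[OF M(1)] Mr(3) of_nat_less_iff .
      show "card (diagram ?A (conj_transpose i (Suc i) (conj_transpose a b (tau k M))))
          < card (diagram ?A (conj_transpose i (Suc i) (tau k M)))"
        using conjunct2[OF up_down]
        unfolding Msr(2) Ms(2) lev[OF Msr(1)] lev[OF Ms(1)] Msr(3) Ms(3) Mr(3) of_nat_less_iff .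
    qed
    then have "Mr = Ms" using Mr(3) Ms(3) by (intro tau_inj Mr Ms) simp
    then show "act r R = act s R" using Mr(2) Ms(2) by simp
  qed
  moreover have "U \<subseteq> pos_roots ?n" unfolding U_def using edge_root_in_pos_roots by blast
  moreover have "I \<subseteq> simple_refls ?n" unfolding I by blast
  ultimately show ?thesis unfolding qp_triple_def U_def X_def act_def lev_def by blast
qed

section \<open>Uniqueness of the degrees\<close>

text \<open>Evaluation of integer polynomials at the primitive root of unity \<open>e\<^bsup>2\<pi>i/m\<^esup>\<close>, which is a root of
  \<open>[m]\<^sub>q\<close> but of no \<open>[d]\<^sub>q\<close> with \<open>d < m\<close>. It detects the largest degree.\<close>

definition eval_root :: "nat \<Rightarrow> int poly \<Rightarrow> complex" where
  "eval_root m p = poly (map_poly of_int p) (cis (2 * pi / real m))"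

lemma eval_root_mult: "eval_root m (p * q) = eval_root m p * eval_root m q"
proof -
  have "map_poly of_int (p * q) = (map_poly of_int p * map_poly of_int q :: complex poly)"
    by (rule poly_eqI) (simp add: coeff_map_poly coeff_mult)
  then show ?thesis by (simp add: eval_root_def)
qed

lemma eval_root_add: "eval_root m (p + q) = eval_root m p + eval_root m q"
proof -
  have "map_poly of_int (p + q) = (map_poly of_int p + map_poly of_int q :: complex poly)"
    by (rule poly_eqI) (simp add: coeff_map_poly)
  then show ?thesis by (simp add: eval_root_def)
qed

lemma eval_root_simps [simp]:
  "eval_root m 0 = 0" "eval_root m 1 = 1" "eval_root m [:0, 1:] = cis (2 * pi / real m)"
  by (simp_all add: eval_root_def map_poly_pCons)

lemma eval_root_qint: "eval_root m (qint d) = (\<Sum>i<d. cis (2 * pi / real m) ^ i)"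
proof -
  have "eval_root m ([:0, 1:] ^ i) = cis (2 * pi / real m) ^ i" for i
    by (induction i) (simp_all add: eval_root_mult del: mult_pCons_left)
  then show ?thesis
    unfolding qint_def by (induction d) (simp_all add: eval_root_add)
qed

text \<open>From \<open>(z - 1) [d] = z^d - 1\<close> and \<open>z \<noteq> 1\<close>, vanishing
  means \<open>z^d = 1\<close>, and \<open>z\<close> has order exactly \<open>m\<close>.\<close>

lemma eval_root_qint_eq_0_iff:
  assumes "2 \<le> m" "1 \<le> d" "d \<le> m"
  shows "eval_root m (qint d) = 0 \<longleftrightarrow> d = m"
proof -
  define z where "z = cis (2 * pi / real m)"
  have inj: "inj_on (\<lambda>k. cis (2 * pi * real k / real m)) {..<m}"
    using bij_betw_roots_unity[of m] assms(1) by (simp add: bij_betw_def)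
  have pow: "z ^ k = cis (2 * pi * real k / real m)" for k
    by (simp add: z_def DeMoivre mult_ac)
  have neq: "z ^ k \<noteq> 1" if "1 \<le> k" "k < m" for k
    using inj_onD[OF inj, of k 0] pow[of k] that by auto
  have one: "z ^ m = 1" using pow[of m] assms(1) by simp
  have "z \<noteq> 1" using neq[of 1] assms(1) by simp
  moreover have "z ^ d - 1 = (z - 1) * (\<Sum>i<d. z ^ i)" by (rule power_diff_1_eq)
  ultimately have "(\<Sum>i<d. z ^ i) = 0 \<longleftrightarrow> z ^ d = 1" by auto
  also have "\<dots> \<longleftrightarrow> d = m" using neq[of d] one assms by (cases "d = m") auto
  finally show ?thesis by (simp add: eval_root_qint z_def)
qed

lemma eval_root_prod_qint_eq_0_iff:
  assumes "2 \<le> m" "\<forall>d\<in>#D. 2 \<le> d \<and> d \<le> m"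
  shows "eval_root m (\<Prod>d\<in>#D. qint d) = 0 \<longleftrightarrow> m \<in># D"
  using assms(2)
proof (induction D)
  case (add d D)
  then show ?case using eval_root_qint_eq_0_iff[of m d] assms(1) by (auto simp: eval_root_mult)
qed simp

text \<open>Taking the maximum over both multisets at once makes the root criterion available for
  each of them, so the maximum lies in both. Its factor is nonzero, having the value
  \<open>m\<close> at 1, and cancels.\<close>

lemma prod_qint_unique:
  assumes "\<forall>d\<in>#D. 2 \<le> d" "\<forall>d\<in>#E. 2 \<le> d" "(\<Prod>d\<in>#D. qint d) = (\<Prod>d\<in>#E. qint d)"
  shows "D = E"
  using assms
proof (induction "size D" arbitrary: D E rule: less_induct)
  case less
  show ?case
  proof (cases "D = {#} \<and> E = {#}")
    case False
    define m where "m = Max (set_mset (D + E))"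
    have ne: "set_mset (D + E) \<noteq> {}" using False by auto
    have m_in: "m \<in> set_mset (D + E)" unfolding m_def using ne by (intro Max_in) simp_all
    have m_ge: "d \<le> m" if "d \<in> set_mset (D + E)" for d unfolding m_def using that by (intro Max_ge) simp_all
    have m2: "2 \<le> m" using m_in less.prems by auto
    have "m \<in># D \<longleftrightarrow> m \<in># E"
      using eval_root_prod_qint_eq_0_iff[OF m2, of D] eval_root_prod_qint_eq_0_iff[OF m2, of E]
        m_ge less.prems by auto
    then have "m \<in># D" "m \<in># E" using m_in by auto
    then obtain D' E' where DE: "D = add_mset m D'" "E = add_mset m E'" by (metis multi_member_split)
    have "poly (qint m) 1 = int m" by (simp add: qint_def poly_sum)
    then have "qint m \<noteq> 0" using m2 by auto
    then have "(\<Prod>d\<in>#D'. qint d) = (\<Prod>d\<in>#E'. qint d)" using less.prems(3) DE by simp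
    then have "D' = E'" using less.prems DE by (intro less.hyps) simp_all
    then show ?thesis using DE by simp
  qed simp
qed

section \<open>The polynomials as sums over matchings\<close>

definition matching_monomial :: "nat \<Rightarrow> nat set set \<Rightarrow> (nat \<Rightarrow> real) \<Rightarrow>\<^sub>0 nat" where
  "matching_monomial k M = (\<Sum>t=1..k. Poly_Mapping.single (sum_root (fst_pt M t) (snd_pt M t)) 1)"

lemma prod_xvar_eq_single:
  "(\<Prod>t=1..k. xvar (sum_root (fst_pt M t) (snd_pt M t)) :: ((nat \<Rightarrow> real) \<Rightarrow>\<^sub>0 nat) \<Rightarrow>\<^sub>0 'c::comm_semiring_1)
     = Poly_Mapping.single (matching_monomial k M) 1"
proof -
  have "(\<Prod>t\<in>A. xvar (f t) :: ((nat \<Rightarrow> real) \<Rightarrow>\<^sub>0 nat) \<Rightarrow>\<^sub>0 'c)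
      = Poly_Mapping.single (\<Sum>t\<in>A. Poly_Mapping.single (f t) 1) 1"
    if "finite A" for A :: "nat set" and f :: "nat \<Rightarrow> nat \<Rightarrow> real"
    using that by (induction A rule: finite_induct) (simp_all add: xvar_def mult_single)
  then show ?thesis unfolding matching_monomial_def by simp
qed

lemma power_single_0: "Poly_Mapping.single (0 :: 'x \<Rightarrow>\<^sub>0 nat) c ^ m = Poly_Mapping.single 0 (c ^ m)"
  for c :: "'c::comm_semiring_1"
  by (induction m) (simp_all add: mult_single)

text \<open>Turns the product over the set of roots in \<open>QHf\<close> into a product over block
  indices without losing factors.\<close>

lemma inj_on_matching_roots:
  assumes M: "M \<in> perfect_matchings (2 * k)"
  shows "inj_on (\<lambda>t. sum_root (fst_pt M t) (snd_pt M t)) {1..k}"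
proof (rule eq_card_imp_inj_on)
  have "card (matching_roots k M) = card M"
    unfolding matching_roots_eq[OF M] by (simp add: card_image inj_on_def)
  then show "card ((\<lambda>t. sum_root (fst_pt M t) (snd_pt M t)) ` {1..k}) = card {1..k}"
    using card_perfect_matching[OF M] by (simp add: matching_roots_def)
qed simp

lemma Omega_sum_roots: "Omega (2 * k) (edge_root ` edges (2 * k)) = matching_roots k ` perfect_matchings (2 * k)"
  unfolding Omega_edge_roots by (rule image_cong) (simp_all add: matching_roots_eq)

lemma inj_on_matching_roots_fun: "inj_on (matching_roots k) (perfect_matchings (2 * k))"
proof (rule inj_onI)
  fix M M' assume "M \<in> perfect_matchings (2 * k)" "M' \<in> perfect_matchings (2 * k)"
    "matching_roots k M = matching_roots k M'"
  then have "edge_root ` M = edge_root ` M'" by (simp add: matching_roots_eq)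
  then show "M = M'" using inj_edge_root_image by (simp add: inj_eq)
qed

lemma rho_matching_roots:
  assumes M: "M \<in> perfect_matchings (2 * k)"
  shows "rho (2 * k) (edge_root ` edges (2 * k)) (matching_roots k M) = perm_length (2 * k) (sigma k M)"
  unfolding matching_roots_eq[OF M] rho_edge_roots[OF M] perm_length_sigma[OF M] ..

lemma QHf_eq_sum_matchings:
  "QHf (2 * k) (edge_root ` edges (2 * k)) =
     (\<Sum>M\<in>perfect_matchings (2 * k). qvar ^ perm_length (2 * k) (sigma k M) *
        (\<Prod>t=1..k. xvar (sum_root (fst_pt M t) (snd_pt M t))))"
proof -
  have "(\<Prod>\<beta>\<in>matching_roots k M. xvar \<beta>) = (\<Prod>t=1..k. xvar (sum_root (fst_pt M t) (snd_pt M t)) :: _ \<Rightarrow>\<^sub>0 int poly)"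
    if "M \<in> perfect_matchings (2 * k)" for M
    unfolding matching_roots_def prod.reindex[OF inj_on_matching_roots[OF that]] comp_def ..
  then show ?thesis
    unfolding QHf_def Omega_sum_roots sum.reindex[OF inj_on_matching_roots_fun]
    by (intro sum.cong) (simp_all add: rho_matching_roots)
qed

text \<open>All powers of \<open>q\<close> are collected in coefficients, where the substitutions
  for \<open>q\<close> act.\<close>

lemma QHf_eq_sum_single:
  "QHf (2 * k) (edge_root ` edges (2 * k)) =
     (\<Sum>M\<in>perfect_matchings (2 * k).
        Poly_Mapping.single (matching_monomial k M) ([:0, 1:] ^ perm_length (2 * k) (sigma k M)))"
  unfolding QHf_eq_sum_matchings prod_xvar_eq_single
  by (simp add: qvar_def power_single_0 mult_single)

text \<open>Additivity of \<open>f\<close> lets the coefficient map pass through the sum even where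
  several summands share a monomial; \<open>f 0 = 0\<close> keeps absent monomials absent.\<close>

lemma map_sum_single:
  fixes f :: "'b::comm_monoid_add \<Rightarrow> 'c::comm_monoid_add" and g :: "'i \<Rightarrow> 'e"
  assumes "f 0 = 0" "\<And>x y. f (x + y) = f x + f y"
  shows "Poly_Mapping.map f (\<Sum>i\<in>A. Poly_Mapping.single (g i) (h i))
           = (\<Sum>i\<in>A. Poly_Mapping.single (g i) (f (h i)))"
proof (rule poly_mapping_eqI)
  fix j
  have lookup: "Poly_Mapping.lookup (Poly_Mapping.map f p) j = f (Poly_Mapping.lookup p j)"
    for p :: "'e \<Rightarrow>\<^sub>0 'b"
    using assms(1) by (simp add: Poly_Mapping.map.rep_eq when_def)
  have "f (\<Sum>i\<in>A. u i) = (\<Sum>i\<in>A. f (u i))" for u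
    using assms by (induction A rule: infinite_finite_induct) simp_all
  then show "Poly_Mapping.lookup (Poly_Mapping.map f (\<Sum>i\<in>A. Poly_Mapping.single (g i) (h i))) j
      = Poly_Mapping.lookup (\<Sum>i\<in>A. Poly_Mapping.single (g i) (f (h i))) j"
    unfolding lookup lookup_sum lookup_single using assms(1) by (simp add: when_def if_distrib cong: if_cong)
qed

section \<open>The specializations of \<open>q\<close> and the matrix functions\<close>

lemma QPf_eq_sum_matchings:
  "QPf (2 * k) (edge_root ` edges (2 * k)) =
     (\<Sum>M\<in>perfect_matchings (2 * k). (- qvar) ^ perm_length (2 * k) (sigma k M) *
        (\<Prod>t=1..k. xvar (sum_root (fst_pt M t) (snd_pt M t))))"
proof -
  have "pcompose ([:0, 1:] ^ m) [:0, - 1:] = ([:0, - 1:] :: int poly) ^ m" for m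
    by (induction m) (simp_all add: pcompose_mult pcompose_1 pcompose_pCons del: mult_pCons_left)
  moreover have "(- qvar) ^ m = Poly_Mapping.single (0 :: (nat \<Rightarrow> real) \<Rightarrow>\<^sub>0 nat) ([:0, - 1:] ^ m)" for m
    by (simp add: qvar_def power_single_0 flip: single_uminus)
  ultimately show ?thesis
    unfolding QPf_def QHf_eq_sum_single prod_xvar_eq_single
    by (simp add: map_sum_single pcompose_add mult_single)
qed

lemma Hf_eq_sum_matchings:
  "Hf (2 * k) (edge_root ` edges (2 * k)) =
     (\<Sum>M\<in>perfect_matchings (2 * k). \<Prod>t=1..k. xvar (sum_root (fst_pt M t) (snd_pt M t)))"
  unfolding Hf_def QHf_eq_sum_single prod_xvar_eq_single by (simp add: map_sum_single)

text \<open>At \<open>q = -1\<close> the weight becomes the sign, because the parity of a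
  permutation is the parity of its number of inversions.\<close>

lemma Pf_eq_sum_matchings:
  "Pf (2 * k) (edge_root ` edges (2 * k)) =
     (\<Sum>M\<in>perfect_matchings (2 * k). of_int (sign (sigma k M)) *
        (\<Prod>t=1..k. xvar (sum_root (fst_pt M t) (snd_pt M t))))"
proof -
  have "of_int (sign (sigma k M)) * Poly_Mapping.single (matching_monomial k M) 1
      = Poly_Mapping.single (matching_monomial k M) ((- 1 :: int) ^ perm_length (2 * k) (sigma k M))"
    if "M \<in> perfect_matchings (2 * k)" for M
    unfolding sign_eq_perm_length[OF pf_perms_permutes[OF sigma_in_pf_perms[OF that]]]
    by (cases "even (perm_length (2 * k) (sigma k M))") (simp_all add: single_uminus)
  then show ?thesis
    unfolding Pf_def QHf_eq_sum_single prod_xvar_eq_single by (simp add: map_sum_single)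
qed

lemma sum_matchings_eq_q_hafnian:
  "(\<Sum>M\<in>perfect_matchings (2 * k). q ^ perm_length (2 * k) (sigma k M) *
      (\<Prod>t=1..k. a (fst_pt M t) (snd_pt M t))) = q_hafnian k q a"
  unfolding q_hafnian_def sum.reindex_bij_betw[OF bij_betw_sigma, symmetric]
  by (intro sum.cong prod.cong refl arg_cong2[where f = "(*)"]) (simp_all only: sigma_odd_even)

lemma sum_matchings_eq_q_pfaffian:
  "(\<Sum>M\<in>perfect_matchings (2 * k). (- q) ^ perm_length (2 * k) (sigma k M) *
      (\<Prod>t=1..k. a (fst_pt M t) (snd_pt M t))) = q_pfaffian k q a"
  unfolding sum_matchings_eq_q_hafnian by (simp only: q_hafnian_def q_pfaffian_def)

text \<open>Every pair is listed with its smaller point first, so the products read only entries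
  above the diagonal. This covers all matrices with the prescribed upper entries at once.\<close>

lemma prod_matching_cong:
  assumes M: "M \<in> perfect_matchings (2 * k)"
    and a: "\<And>i j. 1 \<le> i \<Longrightarrow> i < j \<Longrightarrow> j \<le> 2 * k \<Longrightarrow> a i j = b i j"
  shows "(\<Prod>t=1..k. a (fst_pt M t) (snd_pt M t)) = (\<Prod>t=1..k. b (fst_pt M t) (snd_pt M t))"
proof (rule prod.cong[OF refl])
  fix t assume t: "t \<in> {1..k}"
  have "{fst_pt M t, snd_pt M t} \<subseteq> {1..2 * k}"
    using fst_snd_pt(1)[OF M t] M by (auto simp: perfect_matchings_def partition_on_def)
  then show "a (fst_pt M t) (snd_pt M t) = b (fst_pt M t) (snd_pt M t)"
    using fst_snd_pt(2)[OF M t] by (intro a) simp_all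
qed

text \<open>The recursion also yields a factor for \<open>i = 1\<close>, which is
  \<open>[1] = 1\<close>; it is split off since degrees are at least 2.\<close>

lemma PS_eq_prod_qint:
  assumes "1 \<le> k"
  shows "PS (2 * k) (edge_root ` edges (2 * k)) = (\<Prod>i=2..k. qint (2 * i - 1))"
proof -
  have "PS (2 * k) (edge_root ` edges (2 * k))
      = (\<Sum>M\<in>perfect_matchings (2 * k). [:0, 1:] ^ card (diagram {1..2 * k} (tau k M)))"
    unfolding PS_def Omega_sum_roots sum.reindex[OF inj_on_matching_roots_fun]
    by (intro sum.cong) (simp_all add: rho_matching_roots perm_length_sigma)
  also have "\<dots> = (\<Sum>\<tau>\<in>fpf {1..2 * k}. [:0, 1:] ^ card (diagram {1..2 * k} \<tau>))"
    by (rule sum.reindex_bij_betw[OF bij_betw_tau])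
  also have "\<dots> = (\<Prod>i=1..k. qint (2 * i - 1))"
    unfolding qint_def by (rule sum_power_card_diagram) simp_all
  also have "\<dots> = qint 1 * (\<Prod>i=2..k. qint (2 * i - 1))"
    using assms by (simp add: prod.atLeast_Suc_atMost numeral_2_eq_2)
  also have "qint 1 = 1" by (simp add: qint_def)
  finally show ?thesis by simp
qed

lemma has_degrees_iff:
  assumes "1 \<le> k"
  shows "has_degrees (2 * k) (edge_root ` edges (2 * k)) D
           \<longleftrightarrow> D = image_mset (\<lambda>i. 2 * i - 1) (mset_set {2..k})"
proof -
  let ?D = "image_mset (\<lambda>i. 2 * i - 1) (mset_set {2..k})"
  have ge: "\<forall>d\<in>#?D. 2 \<le> d" by auto
  have prod: "PS (2 * k) (edge_root ` edges (2 * k)) = (\<Prod>d\<in>#?D. qint d)"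
    unfolding PS_eq_prod_qint[OF assms] by (simp add: prod_unfold_prod_mset image_mset.compositionality comp_def)
  show ?thesis
  proof
    assume deg: "has_degrees (2 * k) (edge_root ` edges (2 * k)) D"
    then have D_ge: "\<forall>d\<in>#D. 2 \<le> d" unfolding has_degrees_def by (rule conjunct1)
    from deg have "(\<Prod>d\<in>#?D. qint d) = (\<Prod>d\<in>#D. qint d)"
      unfolding has_degrees_def prod by (rule conjunct2)
    from prod_qint_unique[OF D_ge ge this[symmetric]] show "D = ?D" .
  next
    assume D: "D = ?D"
    show "has_degrees (2 * k) (edge_root ` edges (2 * k)) D"
      unfolding D has_degrees_def by (intro conjI ge prod)
  qed
qed

theorem theorem3p10:
  fixes k n :: nat
    and I :: "((nat \<Rightarrow> real) \<Rightarrow> (nat \<Rightarrow> real)) set"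
    and U :: "(nat \<Rightarrow> real) set"
  assumes "k \<ge> 2"
    and "n = 2 * k"
    and "I = simple_refls n - {simple_refl n n}"
    and "U = {sum_root i j | i j. 1 \<le> i \<and> i < j \<and> j \<le> n}"
  shows
    \<comment> \<open>the identification of \<open>W\<^sub>I\<close> with the symmetric group, permuting coordinates\<close>
    "(\<lambda>p. \<lambda>v\<in>rvecs n. v \<circ> Hilbert_Choice.inv p) \<in> iso (sym_group n) (parabolic n I)
     \<and>
     \<comment> \<open>(i)\<close>
     qp_triple n I U
     \<and>
     \<comment> \<open>(ii)\<close>
     (card (Omega n U) = (\<Prod>i=1..k. 2 * i - 1) \<and>
      Omega n U = matching_roots k ` perfect_matchings n)
     \<and>
     \<comment> \<open>(iii)\<close>
     (\<forall>M\<in>perfect_matchings n.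
        Res n U (matching_roots k M) =
          {sum_root i j | i j. 1 \<le> i \<and> i < j \<and> j \<le> n \<and> tau k M i > j \<and> tau k M j > i})
     \<and>
     \<comment> \<open>(iv)\<close>
     (\<forall>M\<in>perfect_matchings n.
        {(i, j). i \<in> {1..n} \<and> j \<in> {1..n} \<and> j < i \<and> sum_root j i \<in> Res n U (matching_roots k M)}
          = {(i, j). (j, i) \<in> matching_diagram k M} \<and>
        {(i, j). (j, i) \<in> matching_diagram k M} = rothe_FPF n (tau k M))
     \<and>
     \<comment> \<open>(v)\<close>
     (\<forall>M\<in>perfect_matchings n.
        rho n U (matching_roots k M) = perm_length n (sigma k M) \<and>
        real (perm_length n (sigma k M)) = (real (perm_length n (tau k M)) - real k) / 2)
     \<and>
     \<comment> \<open>(vi)\<close>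
     (QHf n U = (\<Sum>M\<in>perfect_matchings n. qvar ^ perm_length n (sigma k M) *
                   (\<Prod>t=1..k. xvar (sum_root (fst_pt M t) (snd_pt M t)))) \<and>
      QHf n U = q_hafnian k qvar (\<lambda>i j. xvar (sum_root i j)) \<and>
      QPf n U = (\<Sum>M\<in>perfect_matchings n. (- qvar) ^ perm_length n (sigma k M) *
                   (\<Prod>t=1..k. xvar (sum_root (fst_pt M t) (snd_pt M t)))) \<and>
      QPf n U = q_pfaffian k qvar (\<lambda>i j. xvar (sum_root i j)))
     \<and>
     \<comment> \<open>(vii)\<close>
     ((\<exists>a. symmetric_mat n a \<and> (\<forall>i j. 1 \<le> i \<and> i < j \<and> j \<le> n \<longrightarrow> a i j = xvar (sum_root i j)) \<and>
           Hf n U = hafnian k a) \<and>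
      (\<forall>a. symmetric_mat n a \<and> (\<forall>i j. 1 \<le> i \<and> i < j \<and> j \<le> n \<longrightarrow> a i j = xvar (sum_root i j)) \<longrightarrow>
           Hf n U = hafnian k a) \<and>
      (\<exists>a. skew_symmetric_mat n a \<and> (\<forall>i j. 1 \<le> i \<and> i < j \<and> j \<le> n \<longrightarrow> a i j = xvar (sum_root i j)) \<and>
           Pf n U = pfaffian k a) \<and>
      (\<forall>a. skew_symmetric_mat n a \<and> (\<forall>i j. 1 \<le> i \<and> i < j \<and> j \<le> n \<longrightarrow> a i j = xvar (sum_root i j)) \<longrightarrow>
           Pf n U = pfaffian k a))
     \<and>
     \<comment> \<open>(viii)\<close>
     (PS n U = (\<Prod>i=2..k. qint (2 * i - 1)) \<and>
      (\<forall>D. has_degrees n U D \<longleftrightarrow> D = image_mset (\<lambda>i. 2 * i - 1) (mset_set {2..k})))"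
proof -
  have k: "1 \<le> k" and n2: "2 \<le> 2 * k" using assms(1) by simp_all
  have U: "U = edge_root ` edges (2 * k)" unfolding assms(2,4) by (rule sum_roots_eq)
  note I = assms(3)[unfolded assms(2)]
  define x :: "nat \<Rightarrow> nat \<Rightarrow> ((nat \<Rightarrow> real) \<Rightarrow>\<^sub>0 nat) \<Rightarrow>\<^sub>0 int"
    where "x = (\<lambda>i j. xvar (sum_root i j))"
  have Res_iff: "sum_root i j \<in> Res n U (matching_roots k M) \<longleftrightarrow> (i, j) \<in> matching_diagram k M"
    if M: "M \<in> perfect_matchings n" and ij: "1 \<le> i" "i < j" "j \<le> n" for M i j
    unfolding U assms(2) matching_roots_eq[OF M[unfolded assms(2)]] sum_root_eq_edge_root[OF less_imp_neq[OF ij(2)]]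
      edge_root_in_Res_iff[OF M[unfolded assms(2)] ij(1,2) ij(3)[unfolded assms(2)]]
    using ij assms(2) by (auto simp: diagram_def matching_diagram_def)
  have hafnian: "Hf n U = hafnian k a"
    if "\<forall>i j. 1 \<le> i \<and> i < j \<and> j \<le> n \<longrightarrow> a i j = xvar (sum_root i j)" for a
    unfolding assms(2) U Hf_eq_sum_matchings hafnian_def
    using that by (intro sum.cong refl prod_matching_cong[symmetric]) (simp_all add: assms(2))
  have pfaffian: "Pf n U = pfaffian k a"
    if "\<forall>i j. 1 \<le> i \<and> i < j \<and> j \<le> n \<longrightarrow> a i j = xvar (sum_root i j)" for a
    unfolding assms(2) U Pf_eq_sum_matchings pfaffian_def
    using that
    by (intro sum.cong refl arg_cong2[where f = "(*)"] prod_matching_cong[symmetric]) (simp_all add: assms(2))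
  show ?thesis
  proof (intro conjI ballI allI)
    show "(\<lambda>p. \<lambda>v\<in>rvecs n. v \<circ> Hilbert_Choice.inv p) \<in> iso (sym_group n) (parabolic n I)"
      using perm_map_iso_parabolic[OF n2 I] unfolding assms(2) perm_map_def .
    show "qp_triple n I U" unfolding assms(2) U by (rule qp_triple_sum_roots[OF k I])
    show Omega: "Omega n U = matching_roots k ` perfect_matchings n"
      unfolding assms(2) U by (rule Omega_sum_roots)
    \<comment> \<open>The matchings are counted through their involutions, whose number is the
      generating function at \<open>q = 1\<close>.\<close>
    have "card (Omega n U) = card (fpf {1..2 * k})"
      unfolding Omega unfolding assms(2) card_image[OF inj_on_matching_roots_fun]
      by (rule bij_betw_same_card[OF bij_betw_tau])
    then show "card (Omega n U) = (\<Prod>i=1..k. 2 * i - 1)"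
      using card_fpf[of "{1..2 * k}" k] by simp
  next
    fix M assume M: "M \<in> perfect_matchings n"
    note M' = M[unfolded assms(2)]
    show Res: "Res n U (matching_roots k M) =
        {sum_root i j | i j. 1 \<le> i \<and> i < j \<and> j \<le> n \<and> tau k M i > j \<and> tau k M j > i}" (is "?L = ?R")
    proof
      show "?L \<subseteq> ?R"
      proof
        fix v assume v: "v \<in> ?L"
        then have "v \<in> U" by (simp add: Res_def)
        then obtain i j where ij: "v = sum_root i j" "1 \<le> i" "i < j" "j \<le> n" unfolding assms(4) by blast
        then have "(i, j) \<in> matching_diagram k M" using v Res_iff[OF M ij(2-4)] by simp
        then show "v \<in> ?R" using ij by (auto simp: matching_diagram_def)
      qed
      show "?R \<subseteq> ?L"
      proof
        fix v assume "v \<in> ?R"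
        then obtain i j where ij: "v = sum_root i j" "1 \<le> i" "i < j" "j \<le> n"
          and "tau k M i > j" "tau k M j > i" by blast
        then have "(i, j) \<in> matching_diagram k M" by (simp add: matching_diagram_def assms(2))
        then show "v \<in> ?L" using Res_iff[OF M ij(2-4)] ij(1) by simp
      qed
    qed
    have "i \<in> {1..n} \<and> j \<in> {1..n} \<and> j < i \<and> sum_root j i \<in> Res n U (matching_roots k M)
        \<longleftrightarrow> (j, i) \<in> matching_diagram k M" for i j
    proof -
      have "(j, i) \<in> matching_diagram k M \<Longrightarrow> 1 \<le> j \<and> j < i \<and> i \<le> n"
        by (simp add: matching_diagram_def assms(2))
      then show ?thesis using Res_iff[OF M, of j i] by auto
    qed
    then show "{(i, j). i \<in> {1..n} \<and> j \<in> {1..n} \<and> j < i \<and> sum_root j i \<in> Res n U (matching_roots k M)}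
        = {(i, j). (j, i) \<in> matching_diagram k M}"
      by (simp only:)
    show "{(i, j). (j, i) \<in> matching_diagram k M} = rothe_FPF n (tau k M)"
      by (auto simp: matching_diagram_def rothe_FPF_def assms(2))
    show "rho n U (matching_roots k M) = perm_length n (sigma k M)"
      unfolding assms(2) U by (rule rho_matching_roots[OF M'])
    show "real (perm_length n (sigma k M)) = (real (perm_length n (tau k M)) - real k) / 2"
      unfolding assms(2) perm_length_sigma[OF M'] perm_length_fpf[OF tau_in_fpf[OF M']] by simp
  next
    show "QHf n U = (\<Sum>M\<in>perfect_matchings n. qvar ^ perm_length n (sigma k M) *
        (\<Prod>t=1..k. xvar (sum_root (fst_pt M t) (snd_pt M t))))"
      unfolding assms(2) U by (rule QHf_eq_sum_matchings)
    show "QHf n U = q_hafnian k qvar (\<lambda>i j. xvar (sum_root i j))"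
      unfolding assms(2) U QHf_eq_sum_matchings by (rule sum_matchings_eq_q_hafnian)
    show "QPf n U = (\<Sum>M\<in>perfect_matchings n. (- qvar) ^ perm_length n (sigma k M) *
        (\<Prod>t=1..k. xvar (sum_root (fst_pt M t) (snd_pt M t))))"
      unfolding assms(2) U by (rule QPf_eq_sum_matchings)
    show "QPf n U = q_pfaffian k qvar (\<lambda>i j. xvar (sum_root i j))"
      unfolding assms(2) U QPf_eq_sum_matchings by (rule sum_matchings_eq_q_pfaffian)
  next
    \<comment> \<open>Sorting the two indices extends the upper entries symmetrically.\<close>
    have "symmetric_mat n (\<lambda>i j. x (min i j) (max i j))"
      by (simp add: symmetric_mat_def min.commute max.commute)
    moreover have "\<forall>i j. 1 \<le> i \<and> i < j \<and> j \<le> n \<longrightarrow> x (min i j) (max i j) = xvar (sum_root i j)"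
      by (simp add: x_def)
    ultimately show "\<exists>a. symmetric_mat n a \<and>
        (\<forall>i j. 1 \<le> i \<and> i < j \<and> j \<le> n \<longrightarrow> a i j = xvar (sum_root i j)) \<and> Hf n U = hafnian k a"
      using hafnian[of "\<lambda>i j. x (min i j) (max i j)"] by blast
    \<comment> \<open>The entries below the diagonal are negated copies, and the diagonal is 0 to
      agree with its own negative.\<close>
    let ?a = "\<lambda>i j. if i < j then x i j else if j < i then - x j i else 0"
    have "skew_symmetric_mat n ?a" by (auto simp: skew_symmetric_mat_def)
    moreover have "\<forall>i j. 1 \<le> i \<and> i < j \<and> j \<le> n \<longrightarrow> ?a i j = xvar (sum_root i j)"
      by (simp add: x_def)
    ultimately show "\<exists>a. skew_symmetric_mat n a \<and>
        (\<forall>i j. 1 \<le> i \<and> i < j \<and> j \<le> n \<longrightarrow> a i j = xvar (sum_root i j)) \<and> Pf n U = pfaffian k a"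
      using pfaffian[of ?a] by blast
  next
    fix a :: "nat \<Rightarrow> nat \<Rightarrow> ((nat \<Rightarrow> real) \<Rightarrow>\<^sub>0 nat) \<Rightarrow>\<^sub>0 int"
    show "symmetric_mat n a \<and> (\<forall>i j. 1 \<le> i \<and> i < j \<and> j \<le> n \<longrightarrow> a i j = xvar (sum_root i j)) \<longrightarrow>
        Hf n U = hafnian k a"
      using hafnian[of a] by blast
    show "skew_symmetric_mat n a \<and> (\<forall>i j. 1 \<le> i \<and> i < j \<and> j \<le> n \<longrightarrow> a i j = xvar (sum_root i j)) \<longrightarrow>
        Pf n U = pfaffian k a"
      using pfaffian[of a] by blast
  next
    show "PS n U = (\<Prod>i=2..k. qint (2 * i - 1))"
      unfolding assms(2) U by (rule PS_eq_prod_qint[OF k])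
    fix D
    show "has_degrees n U D \<longleftrightarrow> D = image_mset (\<lambda>i. 2 * i - 1) (mset_set {2..k})"
      unfolding assms(2) U by (rule has_degrees_iff[OF k])
  qed
qed

end
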